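(* Let $K, L$ be number fields. Suppose that $K$ is totally real of degree $n$ and has fundamental discriminant. Then $(O_K, \mathrm{tr}_{K/\mathbb{Q}}) \cong (O_L, \mathrm{tr}_{L/\mathbb{Q}})$ if and only if $K \cong L$.
   Context: For a number field $K$ with ring of integers $O_K$, $(O_K,\mathrm{tr}_{K/\mathbb{Q}})$ denotes the $\mathbb{Z}$-lattice $O_K$ with the integral bilinear form $(x,y)\mapsto \mathrm{Tr}_{K/\mathbb{Q}}(xy)$; $\cong$ between such lattices means there is a $\mathbb{Z}$-linear bijection $O_K\to O_L$ preserving these forms. A fundamental discriminant is an integer that is the discriminant of a quadratic field (or $1$). *)

theory Defs
  imports Complex_Main
    "HOL-Computational_Algebra.Polynomial"
    "Jordan_Normal_Form.Determinant"
begin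

text \<open>
  Number fields are subfields, finite over the rationals, of an arbitrary ambient field of
  characteristic 0 (the ambient field may be the number field itself, with carrier UNIV).
\<close>

definition rat_scale :: "rat \<Rightarrow> 'a::field_char_0 \<Rightarrow> 'a" where
  "rat_scale q x = of_rat q * x"

definition int_scale :: "int \<Rightarrow> 'a::field_char_0 \<Rightarrow> 'a" where
  "int_scale k x = of_int k * x"

global_interpretation rat_vs: vector_space "rat_scale :: rat \<Rightarrow> 'a \<Rightarrow> 'a::field_char_0"
  by unfold_locales (simp_all add: rat_scale_def algebra_simps of_rat_add of_rat_mult)

global_interpretation int_mod: Modules.module "int_scale :: int \<Rightarrow> 'a \<Rightarrow> 'a::field_char_0"
  by unfold_locales (simp_all add: int_scale_def algebra_simps)

definition subfield_set :: "'a::field_char_0 set \<Rightarrow> bool" where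
  "subfield_set K \<longleftrightarrow> 1 \<in> K \<and> (\<forall>x\<in>K. \<forall>y\<in>K. x - y \<in> K \<and> x * y \<in> K) \<and> (\<forall>x\<in>K. inverse x \<in> K)"

definition number_field :: "'a::field_char_0 set \<Rightarrow> bool" where
  "number_field K \<longleftrightarrow> subfield_set K \<and> (\<exists>B. finite B \<and> rat_vs.span B = K)"

definition field_degree :: "'a::field_char_0 set \<Rightarrow> nat" where
  "field_degree K = rat_vs.dim K"

definition field_hom_on :: "'a::field_char_0 set \<Rightarrow> ('a \<Rightarrow> 'b::field_char_0) \<Rightarrow> bool" where
  "field_hom_on K \<sigma> \<longleftrightarrow>
     \<sigma> 1 = 1 \<and> (\<forall>x\<in>K. \<forall>y\<in>K. \<sigma> (x + y) = \<sigma> x + \<sigma> y \<and> \<sigma> (x * y) = \<sigma> x * \<sigma> y)"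

definition field_isomorphic :: "'a::field_char_0 set \<Rightarrow> 'b::field_char_0 set \<Rightarrow> bool" where
  "field_isomorphic K L \<longleftrightarrow> (\<exists>\<phi>. field_hom_on K \<phi> \<and> bij_betw \<phi> K L)"

definition totally_real :: "'a::field_char_0 set \<Rightarrow> bool" where
  "totally_real K \<longleftrightarrow> (\<forall>\<sigma> :: 'a \<Rightarrow> complex. field_hom_on K \<sigma> \<longrightarrow> \<sigma> ` K \<subseteq> \<real>)"

definition ring_of_integers :: "'a::field_char_0 set \<Rightarrow> 'a set" where
  "ring_of_integers K = {x \<in> K. algebraic_int x}"

text \<open>
  The trace of the rational endomorphism \<open>y \<mapsto> x * y\<close> of K: the sum of the diagonal
  entries of its matrix with respect to a basis of K, whose choice does not matter.
\<close>

definition field_trace :: "'a::field_char_0 set \<Rightarrow> 'a \<Rightarrow> rat" where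
  "field_trace K x =
     (let B = (SOME B. rat_vs.independent B \<and> rat_vs.span B = K)
      in \<Sum>b\<in>B. rat_vs.representation B (x * b) b)"

definition integral_basis :: "'a::field_char_0 set \<Rightarrow> 'a list \<Rightarrow> bool" where
  "integral_basis K bs \<longleftrightarrow>
     distinct bs \<and> int_mod.independent (set bs) \<and> int_mod.span (set bs) = ring_of_integers K"

text \<open>The determinant below is the same for every integral basis.\<close>

definition field_disc :: "'a::field_char_0 set \<Rightarrow> rat" where
  "field_disc K =
     (let bs = (SOME bs. integral_basis K bs); n = length bs
      in det (mat n n (\<lambda>(i, j). field_trace K (bs ! i * bs ! j))))"

text \<open>Every quadratic field embeds in the complex numbers, so it suffices to range over subfields of them.\<close>

definition fundamental_discriminant :: "int \<Rightarrow> bool" where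
  "fundamental_discriminant d \<longleftrightarrow>
     d = 1 \<or>
     (\<exists>F :: complex set. number_field F \<and> field_degree F = 2 \<and> field_disc F = of_int d)"

definition trace_lattices_isometric :: "'a::field_char_0 set \<Rightarrow> 'b::field_char_0 set \<Rightarrow> bool" where
  "trace_lattices_isometric K L \<longleftrightarrow>
     (\<exists>\<phi>. bij_betw \<phi> (ring_of_integers K) (ring_of_integers L) \<and>
          (\<forall>x\<in>ring_of_integers K. \<forall>y\<in>ring_of_integers K. \<phi> (x + y) = \<phi> x + \<phi> y) \<and>
          (\<forall>k. \<forall>x\<in>ring_of_integers K. \<phi> (int_scale k x) = int_scale k (\<phi> x)) \<and>
          (\<forall>x\<in>ring_of_integers K. \<forall>y\<in>ring_of_integers K.
             field_trace L (\<phi> x * \<phi> y) = field_trace K (x * y)))"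

end

(* Let phi be an isometry between the rings of integers. In the coordinates given by the complex
   embeddings s_j of K and t_i of L it is a complex matrix U with U^T U = 1, and U is real because K is
   totally real and complex conjugation only permutes the rows of U.

   The heart of the proof is that 2 u^2 is an algebraic integer for every entry u of U. By Cramer's
   rule d u^2 is one, where d is the discriminant. To remove a prime p from d, take an integer x outside
   p O_K with Tr(x O_K) in p Z; as p^2 does not divide d (p odd), such x form a line modulo p, so that
   x^2 lies in p O_K. The same holds for phi(x) in L, so both are divisible by sqrt p among all algebraic
   integers, and Cramer's rule applied to a basis containing x / sqrt p gains a factor p. At p = 2 one
   only has that 16 does not divide d, and the radical of the trace form modulo 2 has dimension at most
   3; it is a line or a plane that can be treated in the same way, and dimension 3 does not occur.

   The numbers z = 2 u^2 - 1 lie in [-1,1], are algebraic integers, and the sum of their 2k-th powers is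
   a rational integer for every k, as U is a function on pairs of embeddings that comes from the tensor
   product of K and L. Hence z is -1, 0 or 1. The row sums of U are the conjugates of y = phi(1), and
   an entry with u^2 = 1/2 would give y^2 = 0 or y^2 = 2, contrary to Tr(y^2) = n. So every row has a
   single nonzero entry, which is 1 or -1, and t_0 phi = s_j or -s_j: L and K have the same image under
   t_0 and s_j.

   That d has no odd square factor and is not divisible by 16 follows from its being the discriminant of
   a quadratic field. *)
theory Submission
  imports Defs "Jordan_Normal_Form.Char_Poly"
begin

section \<open>Algebraic integers\<close>

text \<open>The obstacle is that an isometry is only additive: a divisibility of
  \<open>x\<^sup>2\<close> in one ring says nothing about the other. Each such divisibility is
  therefore derived from hypotheses that can be read off the Gram matrix, and is then applied in
  both rings to the same coordinate vector. The tool is that multiplication by an element of the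
  radical maps the whole ring into the radical, so that traces can be computed on a space of
  dimension at most 3.

  The embeddings are obtained together with the trace formula, by triangularising all
  multiplications simultaneously. In place of a Galois group acting on the entries of U, functions
  on pairs of embeddings are summed over all pairs: a tensor then yields a sum of products of two
  traces.

  At the prime 2 the elementary divisors of the Gram matrix decide. If 4 divides d exactly they are
  4 or 2, 2; if 8 does, they are 8 or 2, 4 or 2, 2, 2. Here 8 contradicts integral closedness, 2, 2,
  2 contradicts a trace computation, and 2, 4 is resolved by the algebraic integer (x + sqrt 2 y) /
  2. The factor 2 in 2 u^2 is what these cases leave over.\<close>

lemma algebraic_int_if_span_stable:
  fixes x :: "'a::field_char_0"
  assumes S: "finite S" "s0 \<in> S" "s0 \<noteq> 0"
    and stable: "\<And>s. s \<in> S \<Longrightarrow> x * s \<in> int_mod.span S"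
  shows "algebraic_int x"
proof -
  obtain xs where xs: "set xs = S" "distinct xs" using finite_distinct_list[OF S(1)] by blast
  define n where "n = length xs"
  have "\<exists>u. x * s = (\<Sum>t\<in>S. of_int (u t) * t)" if "s \<in> S" for s
    using stable[OF that] S(1) by (auto simp: int_mod.span_finite int_scale_def)
  then obtain c where c: "\<And>s. s \<in> S \<Longrightarrow> x * s = (\<Sum>t\<in>S. of_int (c s t) * t)" by metis
  define A where "A = mat n n (\<lambda>(i,j). c (xs ! i) (xs ! j))"
  define A' where "A' = map_mat (of_int :: int \<Rightarrow> 'a) A"
  have A: "A \<in> carrier_mat n n" and A': "A' \<in> carrier_mat n n" by (auto simp: A_def A'_def)
  define v where "v = vec n (\<lambda>i. xs ! i)"
  have v: "v \<in> carrier_vec n" by (simp add: v_def)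
  obtain i0 where i0: "i0 < n" "xs ! i0 = s0" using S(2) xs(1) by (metis in_set_conv_nth n_def)
  have "v \<noteq> 0\<^sub>v n" using i0 S(3) by (auto simp: v_def dest!: arg_cong[of _ _ "\<lambda>v. v $ i0"])
  moreover have "A' *\<^sub>v v = x \<cdot>\<^sub>v v"
  proof (rule eq_vecI)
    fix i assume "i < dim_vec (x \<cdot>\<^sub>v v)"
    then have i: "i < n" by (simp add: v_def)
    have "(A' *\<^sub>v v) $ i = (\<Sum>j<n. of_int (c (xs ! i) (xs ! j)) * xs ! j)"
      using i by (simp add: A'_def A_def v_def scalar_prod_def atLeast0LessThan)
    also have "\<dots> = (\<Sum>t\<in>S. of_int (c (xs ! i) t) * t)"
      using xs sum.reindex_bij_betw[OF bij_betw_nth[OF xs(2) refl refl, unfolded xs(1)]]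
      by (auto simp: n_def)
    also have "\<dots> = x * xs ! i"
      by (rule c[symmetric]) (use i xs(1) in \<open>auto simp: n_def\<close>)
    finally show "(A' *\<^sub>v v) $ i = (x \<cdot>\<^sub>v v) $ i" using i by (simp add: v_def)
  qed (simp add: v_def A'_def A_def)
  \<comment> \<open>The elements of \<open>S\<close> form an eigenvector of an integer matrix,
    nonzero because of \<open>s0\<close>; its characteristic polynomial is the monic equation
    sought.\<close>
  ultimately have "eigenvalue A' x"
    using v A' by (auto simp: eigenvalue_def eigenvector_def)
  then have root: "poly (char_poly A') x = 0" using eigenvalue_root_char_poly[OF A'] by blast
  have "char_poly A' = map_poly of_int (char_poly A)"
    unfolding A'_def by (rule of_int_hom.char_poly_hom[OF A])
  moreover have "lead_coeff (char_poly A) = 1" using degree_monic_char_poly[OF A] by auto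
  ultimately show ?thesis unfolding algebraic_int_altdef_ipoly using root by metis
qed

text \<open>A monic equation is solved for its leading term. Here \<open>m\<close> is positive
  because a monic constant has no root.\<close>

lemma algebraic_int_power_span:
  fixes x :: "'a::field_char_0"
  assumes "algebraic_int x"
  obtains m where "m > 0" "x ^ m \<in> int_mod.span ((\<lambda>i. x ^ i) ` {..<m})"
proof -
  obtain p where p: "lead_coeff p = 1" "poly (map_poly of_int p) x = 0"
    using assms by (auto simp: algebraic_int_altdef_ipoly)
  define m where "m = degree p"
  have deg: "degree (map_poly (of_int :: int \<Rightarrow> 'a) p) = m" by (simp add: m_def degree_map_poly)
  have "m > 0"
  proof (rule ccontr)
    assume "\<not> m > 0"
    then have "p = [:1:]" using p(1) unfolding m_def by (metis degree_0_id gr0I of_nat_0 pCons_one one_pCons)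
    then show False using p(2) by (simp add: map_poly_pCons)
  qed
  have "0 = (\<Sum>i\<le>m. of_int (coeff p i) * x ^ i)"
    using p(2) unfolding poly_altdef deg by (simp add: coeff_map_poly)
  also have "\<dots> = x ^ m + (\<Sum>i<m. of_int (coeff p i) * x ^ i)"
    using p(1) by (simp add: m_def lessThan_Suc_atMost[symmetric])
  finally have "x ^ m = (\<Sum>i<m. int_scale (- coeff p i) (x ^ i))"
    by (simp add: int_scale_def sum_negf eq_neg_iff_add_eq_0)
  moreover have "(\<Sum>i<m. int_scale (- coeff p i) (x ^ i)) \<in> int_mod.span ((\<lambda>i. x ^ i) ` {..<m})"
    by (intro int_mod.span_sum int_mod.span_scale int_mod.span_base) auto
  ultimately show ?thesis using that \<open>m > 0\<close> by metis
qed

lemma int_span_mult_right: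
  fixes c :: "'a::field_char_0"
  assumes "y \<in> int_mod.span S" "\<And>s. s \<in> S \<Longrightarrow> c * s \<in> int_mod.span T"
  shows "c * y \<in> int_mod.span T"
  using assms(1)
proof (induction rule: int_mod.span_induct_alt)
  case base
  show ?case by (simp add: int_mod.span_zero)
next
  case (step k s y)
  have "c * (int_scale k s + y) = int_scale k (c * s) + c * y"
    by (simp add: int_scale_def algebra_simps)
  then show ?case using step assms(2) by (simp add: int_mod.span_add int_mod.span_scale)
qed

text \<open>The products \<open>x ^ i * y ^ j\<close> with bounded exponents span a module that is
  stable under both \<open>x\<close> and \<open>y\<close>, hence under their sum and
  product.\<close>

lemma algebraic_int_times_plus:
  fixes x y :: "'a::field_char_0"
  assumes x: "algebraic_int x" and y: "algebraic_int y"
  shows "algebraic_int (x * y)" and "algebraic_int (x + y)"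
proof -
  obtain m where m: "m > 0" "x ^ m \<in> int_mod.span ((\<lambda>i. x ^ i) ` {..<m})"
    using algebraic_int_power_span[OF x] by blast
  obtain k where k: "k > 0" "y ^ k \<in> int_mod.span ((\<lambda>i. y ^ i) ` {..<k})"
    using algebraic_int_power_span[OF y] by blast
  define S where "S = (\<lambda>(i,j). x ^ i * y ^ j) ` ({..<m} \<times> {..<k})"
  have fin: "finite S" by (simp add: S_def)
  have one: "1 \<in> S" unfolding S_def using m k by (auto intro!: image_eqI[of _ _ "(0,0)"])
  have base: "x ^ i * y ^ j \<in> int_mod.span S" if "i < m" "j < k" for i j
    using that by (intro int_mod.span_base) (auto simp: S_def)
  have xS: "x * s \<in> int_mod.span S" if sS: "s \<in> S" for s
  proof -
    obtain i j where s: "s = x ^ i * y ^ j" "i < m" "j < k" using sS by (auto simp: S_def)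
    show ?thesis
    proof (cases "Suc i < m")
      case True
      then show ?thesis using base[of "Suc i" j] s by (simp add: mult.assoc)
    next
      case False
      then have "Suc i = m" using s by simp
      then have "x * s = y ^ j * x ^ m" using s by (auto simp: mult_ac)
      moreover have "y ^ j * x ^ m \<in> int_mod.span S"
        using m(2) by (rule int_span_mult_right) (use base s in \<open>auto simp: mult.commute\<close>)
      ultimately show ?thesis by simp
    qed
  qed
  have yS: "y * s \<in> int_mod.span S" if sS: "s \<in> S" for s
  proof -
    obtain i j where s: "s = x ^ i * y ^ j" "i < m" "j < k" using sS by (auto simp: S_def)
    show ?thesis
    proof (cases "Suc j < k")
      case True
      then show ?thesis using base[of i "Suc j"] s by (simp add: mult_ac)
    next
      case False
      then have "Suc j = k" using s by simp
      then have "y * s = x ^ i * y ^ k" using s by (auto simp: mult_ac)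
      moreover have "x ^ i * y ^ k \<in> int_mod.span S"
        using k(2) by (rule int_span_mult_right) (use base s in auto)
      ultimately show ?thesis by simp
    qed
  qed
  show "algebraic_int (x + y)"
    by (rule algebraic_int_if_span_stable[OF fin one])
      (use xS yS in \<open>auto simp: distrib_right int_mod.span_add\<close>)
  show "algebraic_int (x * y)"
    by (rule algebraic_int_if_span_stable[OF fin one])
      (use int_span_mult_right[OF yS xS] in \<open>auto simp: mult.assoc\<close>)
qed

lemma algebraic_int_diff:
  "algebraic_int x \<Longrightarrow> algebraic_int y \<Longrightarrow> algebraic_int (x - y :: 'a::field_char_0)"
  using algebraic_int_times_plus(2)[of x "- y"] by auto

lemma algebraic_int_power: "algebraic_int x \<Longrightarrow> algebraic_int (x ^ k :: 'a::field_char_0)"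
  by (induction k) (auto intro: algebraic_int_times_plus)

lemma algebraic_int_sum:
  "(\<And>i. i \<in> I \<Longrightarrow> algebraic_int (f i)) \<Longrightarrow> algebraic_int (\<Sum>i\<in>I. f i :: 'a::field_char_0)"
  by (induction I rule: infinite_finite_induct) (auto intro: algebraic_int_times_plus)

lemma algebraic_int_prod:
  "(\<And>i. i \<in> I \<Longrightarrow> algebraic_int (f i)) \<Longrightarrow> algebraic_int (\<Prod>i\<in>I. f i :: 'a::field_char_0)"
  by (induction I rule: infinite_finite_induct) (auto intro: algebraic_int_times_plus)

lemma algebraic_int_det:
  fixes A :: "'a::field_char_0 mat"
  assumes "A \<in> carrier_mat n n" "\<And>i j. i < n \<Longrightarrow> j < n \<Longrightarrow> algebraic_int (A $$ (i,j))"
  shows "algebraic_int (det A)"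
  unfolding det_def'[OF assms(1)]
  by (intro algebraic_int_sum algebraic_int_times_plus algebraic_int_prod)
    (auto intro!: assms(2) simp: sign_def permutes_in_image)

lemma algebraic_int_of_power:
  fixes x :: "'a::field_char_0"
  assumes "algebraic_int (x ^ k)" "k > 0"
  shows "algebraic_int x"
  by (rule algebraic_int_root[OF assms(1), where p = "monom 1 k"])
    (use assms in \<open>auto simp: poly_monom degree_monom_eq\<close>)

text \<open>Transitivity of integrality: the only coefficient of the equation that may fail to be a
  rational integer is \<open>c\<close>, itself integral.\<close>

lemma algebraic_int_quadratic:
  fixes x :: "'a::field_char_0"
  assumes "x\<^sup>2 = of_int b * x + c" "algebraic_int c"
  shows "algebraic_int x"
  by (rule algebraic_int_root[OF assms(2), where p = "[:0, - of_int b, 1:]"])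
    (use assms in \<open>auto simp: algebra_simps power2_eq_square coeff_pCons split: nat.splits\<close>)


section \<open>Embeddings of a number field\<close>

lemma mult_mat_entry:
  assumes "A \<in> carrier_mat n n" "B \<in> carrier_mat n n" "i < n" "j < n"
  shows "(A * B) $$ (i,j) = (\<Sum>k<n. A $$ (i,k) * B $$ (k,j))"
  using assms by (auto simp: scalar_prod_def atLeast0LessThan)

lemma sum_diag_mult_comm:
  fixes A B :: "'a::comm_ring_1 mat"
  assumes "A \<in> carrier_mat n n" "B \<in> carrier_mat n n"
  shows "(\<Sum>i<n. (A * B) $$ (i,i)) = (\<Sum>i<n. (B * A) $$ (i,i))"
proof -
  have "(\<Sum>i<n. (A * B) $$ (i,i)) = (\<Sum>i<n. \<Sum>k<n. A $$ (i,k) * B $$ (k,i))"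
    by (intro sum.cong refl mult_mat_entry[OF assms]) auto
  also have "\<dots> = (\<Sum>k<n. \<Sum>i<n. B $$ (k,i) * A $$ (i,k))"
    by (subst sum.swap) (simp add: mult.commute)
  also have "\<dots> = (\<Sum>i<n. (B * A) $$ (i,i))"
    by (intro sum.cong refl mult_mat_entry[OF assms(2,1), symmetric]) auto
  finally show ?thesis .
qed

lemma mat_inverse_field:
  fixes S :: "'a::field mat"
  assumes S: "S \<in> carrier_mat n n" and det: "det S \<noteq> 0"
  obtains S' where "S' \<in> carrier_mat n n" "S * S' = 1\<^sub>m n" "S' * S = 1\<^sub>m n"
proof -
  let ?S' = "inverse (det S) \<cdot>\<^sub>m adj_mat S"
  have one: "inverse (det S) \<cdot>\<^sub>m (det S \<cdot>\<^sub>m 1\<^sub>m n) = 1\<^sub>m n"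
    using det by (intro eq_matI) auto
  have "?S' \<in> carrier_mat n n" using adj_mat(1)[OF S] by simp
  moreover have "S * ?S' = 1\<^sub>m n"
    using mult_smult_distrib[OF S adj_mat(1)[OF S]] adj_mat(2)[OF S] one by simp
  moreover have "?S' * S = 1\<^sub>m n"
    using mult_smult_assoc_mat[OF adj_mat(1)[OF S] S] adj_mat(3)[OF S] one by simp
  ultimately show ?thesis using that by blast
qed

lemma sum_diag_similar:
  fixes S M T :: "'a::field mat"
  assumes S: "S \<in> carrier_mat n n" and M: "M \<in> carrier_mat n n" and T: "T \<in> carrier_mat n n"
    and det: "det S \<noteq> 0" and eq: "S * M = T * S"
  shows "(\<Sum>i<n. M $$ (i,i)) = (\<Sum>i<n. T $$ (i,i))"
proof -
  obtain S' where S': "S' \<in> carrier_mat n n" "S * S' = 1\<^sub>m n" "S' * S = 1\<^sub>m n"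
    using mat_inverse_field[OF S det] by blast
  have "M = S' * (T * S)" using S S' M eq by (metis assoc_mult_mat left_mult_one_mat)
  then have "(\<Sum>i<n. M $$ (i,i)) = (\<Sum>i<n. ((T * S) * S') $$ (i,i))"
    using sum_diag_mult_comm[of S' n "T * S"] S' T S by simp
  also have "(T * S) * S' = T" using S S' T by (simp add: assoc_mult_mat[of _ n n _ n _ n])
  finally show ?thesis .
qed

lemma subfield_set_closed:
  assumes "subfield_set K"
  shows "0 \<in> K" "1 \<in> K" "x \<in> K \<Longrightarrow> y \<in> K \<Longrightarrow> x + y \<in> K" "x \<in> K \<Longrightarrow> y \<in> K \<Longrightarrow> x - y \<in> K"
    "x \<in> K \<Longrightarrow> y \<in> K \<Longrightarrow> x * y \<in> K" "x \<in> K \<Longrightarrow> - x \<in> K" "x \<in> K \<Longrightarrow> inverse x \<in> K"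
    "x \<in> K \<Longrightarrow> y \<in> K \<Longrightarrow> x / y \<in> K" "x \<in> K \<Longrightarrow> x ^ k \<in> K"
proof -
  note K = assms[unfolded subfield_set_def]
  show 1: "1 \<in> K" using K by blast
  show diff: "x \<in> K \<Longrightarrow> y \<in> K \<Longrightarrow> x - y \<in> K" for x y using K by blast
  show 0: "0 \<in> K" using diff[OF 1 1] by simp
  show neg: "x \<in> K \<Longrightarrow> - x \<in> K" for x using diff[OF 0, of x] by simp
  show "x \<in> K \<Longrightarrow> y \<in> K \<Longrightarrow> x + y \<in> K" using diff[of x "- y"] neg[of y] by simp
  show mult: "x \<in> K \<Longrightarrow> y \<in> K \<Longrightarrow> x * y \<in> K" for x y using K by blast
  show inv: "x \<in> K \<Longrightarrow> inverse x \<in> K" for x using K by blast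
  show "x \<in> K \<Longrightarrow> y \<in> K \<Longrightarrow> x / y \<in> K" using mult inv by (simp add: divide_inverse)
  show "x \<in> K \<Longrightarrow> x ^ k \<in> K" by (induction k) (auto intro: 1 mult)
qed

lemma subfield_set_of_int:
  assumes "subfield_set (K :: 'a::field_char_0 set)"
  shows "of_nat m \<in> K" "of_int k \<in> K" "of_rat q \<in> K"
proof -
  note cl = subfield_set_closed[OF assms]
  show nat: "of_nat m \<in> K" for m by (induction m) (auto intro: cl)
  show int: "of_int k \<in> K" for k by (cases k rule: int_cases2) (auto intro: nat cl(6))
  obtain a b where "q = of_int a / of_int b" "b \<noteq> 0" by (metis Fract_of_int_quotient Rat_cases less_irrefl)
  then show "of_rat q \<in> K" by (auto simp: of_rat_divide intro: cl(8) int)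
qed

lemma subfield_set_sum:
  assumes "subfield_set K" "\<And>i. i \<in> I \<Longrightarrow> f i \<in> K"
  shows "sum f I \<in> K"
  using assms(2) by (induction I rule: infinite_finite_induct) (auto intro: subfield_set_closed[OF assms(1)])

text \<open>The basis is indexed, unlike in the definition of the trace, so that multiplications
  become matrices. As \<open>K\<close> is a subset of an ambient field, all maps are compared on
  \<open>K\<close> only.\<close>

locale based_field =
  fixes K :: "'a::field_char_0 set" and n :: nat and b :: "nat \<Rightarrow> 'a"
  assumes K: "subfield_set K"
    and b_in: "i < n \<Longrightarrow> b i \<in> K"
    and b_span: "x \<in> K \<Longrightarrow> \<exists>q::nat \<Rightarrow> rat. x = (\<Sum>i<n. of_rat (q i) * b i)"
    and b_indep: "(\<Sum>i<n. of_rat (q i) * b i) = 0 \<Longrightarrow> i < n \<Longrightarrow> q i = 0"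
begin

lemmas K_closed = subfield_set_closed[OF K] subfield_set_of_int[OF K]

definition coord :: "'a \<Rightarrow> nat \<Rightarrow> rat" where
  "coord x = (SOME q. x = (\<Sum>i<n. of_rat (q i) * b i))"

lemma coord: "x \<in> K \<Longrightarrow> x = (\<Sum>i<n. of_rat (coord x i) * b i)"
  unfolding coord_def using someI_ex[OF b_span[of x]] by blast

lemma comb_in: "(\<Sum>i<n. of_rat (q i) * b i) \<in> K"
  by (intro subfield_set_sum[OF K] K_closed b_in) auto

lemma coord_eq:
  assumes x: "x = (\<Sum>i<n. of_rat (q i) * b i)" and i: "i < n"
  shows "coord x i = q i"
proof -
  have "x \<in> K" unfolding x by (rule comb_in)
  have "(\<Sum>i<n. of_rat (coord x i - q i) * b i)
      = (\<Sum>i<n. of_rat (coord x i) * b i) - (\<Sum>i<n. of_rat (q i) * b i)"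
    by (simp add: of_rat_diff left_diff_distrib sum_subtractf)
  also have "\<dots> = 0" using coord[OF \<open>x \<in> K\<close>] x by simp
  finally show ?thesis using b_indep[of "\<lambda>i. coord x i - q i" i] i by simp
qed

lemma coord_add: "x \<in> K \<Longrightarrow> y \<in> K \<Longrightarrow> i < n \<Longrightarrow> coord (x + y) i = coord x i + coord y i"
  by (rule coord_eq) (use coord[of x] coord[of y] in \<open>simp_all add: of_rat_add distrib_right sum.distrib\<close>)

lemma coord_scale: "x \<in> K \<Longrightarrow> i < n \<Longrightarrow> coord (of_rat q * x) i = q * coord x i"
  by (rule coord_eq) (subst coord[of x], simp_all add: of_rat_mult mult.assoc sum_distrib_left)

lemma coord_basis: "i < n \<Longrightarrow> j < n \<Longrightarrow> coord (b j) i = (if i = j then 1 else 0)"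
  by (rule coord_eq) (simp_all add: if_distrib[of of_rat] if_distrib[of "\<lambda>x. x * _"] cong: if_cong)

text \<open>Cayley--Hamilton for multiplication by \<open>x\<close>.\<close>
lemma algebraic:
  assumes x: "x \<in> K"
  obtains p :: "rat poly" where "lead_coeff p = 1" "poly (map_poly of_rat p) x = 0"
proof -
  define A where "A = mat n n (\<lambda>(i,j). coord (x * b i) j)"
  define A' where "A' = map_mat (of_rat :: rat \<Rightarrow> 'a) A"
  have A: "A \<in> carrier_mat n n" and A': "A' \<in> carrier_mat n n" by (auto simp: A_def A'_def)
  define v where "v = vec n b"
  have v: "v \<in> carrier_vec n" by (simp add: v_def)
  have "v \<noteq> 0\<^sub>v n"
  proof
    assume "v = 0\<^sub>v n"
    then have "b i = 0" if "i < n" for i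
      using that by (auto simp: v_def dest!: arg_cong[of _ _ "\<lambda>v. v $ i"])
    then have "1 = (0::'a)" using coord[of 1] K_closed by simp
    then show False by simp
  qed
  moreover have "A' *\<^sub>v v = x \<cdot>\<^sub>v v"
  proof (rule eq_vecI)
    fix i assume "i < dim_vec (x \<cdot>\<^sub>v v)"
    then have i: "i < n" by (simp add: v_def)
    have "(A' *\<^sub>v v) $ i = (\<Sum>j<n. of_rat (coord (x * b i) j) * b j)"
      using i by (simp add: A'_def A_def v_def scalar_prod_def atLeast0LessThan)
    also have "\<dots> = x * b i" using coord[of "x * b i"] K_closed(5)[OF x b_in[OF i]] by simp
    finally show "(A' *\<^sub>v v) $ i = (x \<cdot>\<^sub>v v) $ i" using i by (simp add: v_def)
  qed (simp add: v_def A'_def A_def)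
  ultimately have "eigenvalue A' x"
    using v A' by (auto simp: eigenvalue_def eigenvector_def)
  then have root: "poly (char_poly A') x = 0" using eigenvalue_root_char_poly[OF A'] by blast
  have "char_poly A' = map_poly of_rat (char_poly A)"
    unfolding A'_def by (rule of_rat_hom.char_poly_hom[OF A])
  moreover have "lead_coeff (char_poly A) = 1" using degree_monic_char_poly[OF A] by auto
  ultimately show ?thesis using that root by metis
qed

section \<open>Simultaneous triangularisation of the multiplications on complex functionals\<close>

definition qlinear :: "('a \<Rightarrow> complex) \<Rightarrow> bool" where
  "qlinear f \<longleftrightarrow> (\<forall>x\<in>K. \<forall>y\<in>K. f (x + y) = f x + f y) \<and> (\<forall>q. \<forall>x\<in>K. f (of_rat q * x) = of_rat q * f x)"

lemma qlinear_sum: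
  assumes f: "qlinear f" and x: "\<And>i. i \<in> I \<Longrightarrow> x i \<in> K"
  shows "f (\<Sum>i\<in>I. of_rat (q i) * x i) = (\<Sum>i\<in>I. of_rat (q i) * f (x i))"
  using x
proof (induction I rule: infinite_finite_induct)
  case (insert i I)
  have "(\<Sum>i\<in>I. of_rat (q i) * x i) \<in> K"
    using insert by (intro subfield_set_sum[OF K] K_closed) auto
  then show ?case using insert f K_closed by (simp add: qlinear_def)
qed (use f K_closed(1) in \<open>auto simp: qlinear_def dest!: spec[of _ 0]\<close>)

text \<open>A subspace of the complex functions on \<open>K\<close>. Membership in it stands for
  vanishing in the quotient space.\<close>

definition combs :: "(nat \<Rightarrow> 'a \<Rightarrow> complex) \<Rightarrow> nat \<Rightarrow> ('a \<Rightarrow> complex) set" where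
  "combs f k = {g. \<exists>c. \<forall>y\<in>K. g y = (\<Sum>j<k. c j * f j y)}"

lemma combs_add: "g \<in> combs f k \<Longrightarrow> h \<in> combs f k \<Longrightarrow> (\<lambda>y. g y + h y) \<in> combs f k"
  unfolding combs_def
  by (clarsimp, rule_tac x = "\<lambda>j. c j + ca j" in exI) (simp add: distrib_right sum.distrib)

lemma combs_scale: "g \<in> combs f k \<Longrightarrow> (\<lambda>y. a * g y) \<in> combs f k"
  unfolding combs_def
  by (clarsimp, rule_tac x = "\<lambda>j. a * c j" in exI) (simp add: sum_distrib_left mult.assoc)

lemma combs_cong: "g \<in> combs f k \<Longrightarrow> (\<And>y. y \<in> K \<Longrightarrow> g y = h y) \<Longrightarrow> h \<in> combs f k"
  unfolding combs_def by auto

lemma combs_zero: "(\<lambda>y. 0) \<in> combs f k"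
  unfolding combs_def by (auto intro!: exI[of _ "\<lambda>_. 0"])

lemma combs_sum: "(\<And>i. i \<in> I \<Longrightarrow> g i \<in> combs f k) \<Longrightarrow> (\<lambda>y. \<Sum>i\<in>I. a i * g i y) \<in> combs f k"
proof (induction I rule: infinite_finite_induct)
  case (insert i I)
  have "(\<lambda>y. a i * g i y + (\<Sum>i\<in>I. a i * g i y)) \<in> combs f k"
    by (rule combs_add[OF combs_scale]) (use insert in auto)
  then show ?case using insert by simp
qed (simp_all add: combs_zero)

lemma combs_base: "j < k \<Longrightarrow> f j \<in> combs f k"
  unfolding combs_def
  by (auto intro!: exI[of _ "\<lambda>i. if i = j then 1 else 0"] simp: if_distrib[of "\<lambda>x. x * _"] cong: if_cong)

text \<open>A dimension count. Fewer than \<open>n\<close> functionals have a common zero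
  \<open>v\<close> in the complexified space, found as a kernel vector of a square matrix padded
  with zero rows; a coordinate functional that does not vanish at \<open>v\<close> is no combination
  of them.\<close>

lemma qlinear_notin_combs:
  assumes k: "k < n"
  obtains f where "qlinear f" "f \<notin> combs g k"
proof -
  define F where "F = mat n n (\<lambda>(j,i). if j < k then g j (b i) else 0)"
  have F: "F \<in> carrier_mat n n" by (simp add: F_def)
  have "det F = 0" using k F
    by (subst laplace_expansion_row[OF F, of k]) (auto simp: F_def)
  then obtain v where v: "v \<in> carrier_vec n" "v \<noteq> 0\<^sub>v n" "F *\<^sub>v v = 0\<^sub>v n"
    using det_0_iff_vec_prod_zero[OF F] by blast
  obtain i0 where i0: "i0 < n" "v $ i0 \<noteq> 0"
    using v(1,2) by (metis carrier_vecD eq_vecI index_zero_vec)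
  have Fv: "(\<Sum>i<n. g j (b i) * v $ i) = 0" if "j < k" for j
  proof -
    have "(F *\<^sub>v v) $ j = (\<Sum>i<n. g j (b i) * v $ i)"
      using that k v(1) by (simp add: F_def scalar_prod_def atLeast0LessThan)
    then show ?thesis using v(3) that k by simp
  qed
  define f :: "'a \<Rightarrow> complex" where "f = (\<lambda>x. of_rat (coord x i0))"
  have "qlinear f"
    unfolding qlinear_def f_def using i0 by (simp add: coord_add coord_scale of_rat_add of_rat_mult)
  moreover have "f \<notin> combs g k"
  proof
    assume "f \<in> combs g k"
    then obtain c where c: "\<And>y. y \<in> K \<Longrightarrow> f y = (\<Sum>j<k. c j * g j y)" by (auto simp: combs_def)
    have "v $ i0 = (\<Sum>i<n. f (b i) * v $ i)"
      using i0 by (simp add: f_def coord_basis if_distrib[of of_rat] if_distrib[of "\<lambda>x. x * _"] cong: if_cong)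
    also have "\<dots> = (\<Sum>i<n. \<Sum>j<k. c j * (g j (b i) * v $ i))"
      by (intro sum.cong refl) (simp add: c b_in sum_distrib_right mult.assoc)
    also have "\<dots> = (\<Sum>j<k. c j * (\<Sum>i<n. g j (b i) * v $ i))"
      by (subst sum.swap) (simp add: sum_distrib_left)
    also have "\<dots> = 0" by (simp add: Fv)
    finally show False using i0 by simp
  qed
  ultimately show ?thesis using that by blast
qed

text \<open>The polynomial \<open>p\<close> in the operator that sends \<open>f\<close> to
  \<open>\<lambda>y. f (a * y)\<close>, applied to \<open>f\<close>.\<close>

definition pact :: "'a \<Rightarrow> complex poly \<Rightarrow> ('a \<Rightarrow> complex) \<Rightarrow> 'a \<Rightarrow> complex" where
  "pact a p f = (\<lambda>y. \<Sum>i\<le>degree p. coeff p i * f (a ^ i * y))"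

lemma pact_linear_factor:
  "pact a ([:- l, 1:] * q) f y = pact a q f (a * y) - l * pact a q f y"
proof (cases "q = 0")
  case False
  then have deg: "degree ([:- l, 1:] * q) = Suc (degree q)" by (subst degree_mult_eq) auto
  have co: "coeff ([:- l, 1:] * q) i = (case i of 0 \<Rightarrow> 0 | Suc j \<Rightarrow> coeff q j) - l * coeff q i" for i
    by (cases i) auto
  have "pact a ([:- l, 1:] * q) f y
      = (\<Sum>i\<le>Suc (degree q). (case i of 0 \<Rightarrow> 0 | Suc j \<Rightarrow> coeff q j) * f (a ^ i * y))
        - (\<Sum>i\<le>Suc (degree q). l * coeff q i * f (a ^ i * y))"
    unfolding pact_def deg co by (simp add: left_diff_distrib sum_subtractf)
  also have "(\<Sum>i\<le>Suc (degree q). (case i of 0 \<Rightarrow> 0 | Suc j \<Rightarrow> coeff q j) * f (a ^ i * y))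
      = pact a q f (a * y)"
    by (subst sum.atMost_Suc_shift) (simp add: pact_def mult_ac)
  also have "(\<Sum>i\<le>Suc (degree q). l * coeff q i * f (a ^ i * y)) = l * pact a q f y"
    by (simp add: pact_def sum_distrib_left mult.assoc coeff_eq_0)
  finally show ?thesis .
qed (simp add: pact_def)

text \<open>Linear factors are removed from \<open>r\<close> one at a time. At the first quotient
  \<open>q\<close> for which \<open>pact a q f\<close> leaves the subspace, that function is an
  eigenvector modulo the subspace, the removed root being its eigenvalue.\<close>

lemma eigenvector_mod:
  assumes r: "r \<noteq> 0" "pact a r f \<in> combs g k" and f: "f \<notin> combs g k"
  shows "\<exists>q l. pact a q f \<notin> combs g k \<and> (\<lambda>y. pact a q f (a * y) - l * pact a q f y) \<in> combs g k"
  using r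
proof (induction "degree r" arbitrary: r rule: less_induct)
  case less
  show ?case
  proof (cases "degree r = 0")
    case True
    then obtain c where c: "r = [:c:]" "c \<noteq> 0" using less.prems(1) by (metis degree_0_id pCons_0_0)
    have "f \<in> combs g k"
      using combs_scale[OF less.prems(2), of "inverse c"] c by (simp add: pact_def field_simps)
    then show ?thesis using f by simp
  next
    case False
    then obtain l where "poly r l = 0"
      using fundamental_theorem_of_algebra[of r] by (auto simp: constant_degree)
    then obtain q where q: "r = [:- l, 1:] * q" by (metis dvdE poly_eq_0_iff_dvd)
    have "q \<noteq> 0" using less.prems(1) q by auto
    show ?thesis
    proof (cases "pact a q f \<in> combs g k")
      case True
      have "degree q < degree r" using \<open>q \<noteq> 0\<close> unfolding q by (subst degree_mult_eq) auto
      then show ?thesis using less.hyps[of q] \<open>q \<noteq> 0\<close> True by blast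
    next
      case False
      moreover have "(\<lambda>y. pact a q f (a * y) - l * pact a q f y) \<in> combs g k"
        using less.prems(2) by (rule combs_cong) (simp add: q pact_linear_factor del: mult_pCons_left)
      ultimately show ?thesis by blast
    qed
  qed
qed

lemma pact_rational:
  assumes f: "qlinear f" and a: "a \<in> K" and p: "poly (map_poly of_rat p) a = 0" and y: "y \<in> K"
  shows "pact a (map_poly of_rat p) f y = 0"
proof -
  have deg: "degree (map_poly (of_rat :: rat \<Rightarrow> 'c::field_char_0) p) = degree p" by (simp add: degree_map_poly)
  have "pact a (map_poly of_rat p) f y = (\<Sum>i\<le>degree p. of_rat (coeff p i) * f (a ^ i * y))"
    unfolding pact_def deg by (simp add: coeff_map_poly)
  also have "\<dots> = f (\<Sum>i\<le>degree p. of_rat (coeff p i) * (a ^ i * y))"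
    by (rule qlinear_sum[OF f, symmetric]) (use a y in \<open>auto intro: K_closed\<close>)
  also have "(\<Sum>i\<le>degree p. of_rat (coeff p i) * (a ^ i * y)) = poly (map_poly of_rat p) a * y"
    unfolding poly_altdef deg by (simp add: coeff_map_poly sum_distrib_right mult.assoc)
  also have "f \<dots> = 0" using f p K_closed(1) by (auto simp: qlinear_def dest!: spec[of _ 0])
  finally show ?thesis .
qed

lemma qlinear_pact:
  assumes f: "qlinear f" and a: "a \<in> K"
  shows "qlinear (pact a p f)"
proof -
  have "f (a ^ i * (x + y)) = f (a ^ i * x) + f (a ^ i * y)"
    "f (a ^ i * (of_rat q * x)) = of_rat q * f (a ^ i * x)" if "x \<in> K" "y \<in> K" for i x y q
    using f a that K_closed unfolding qlinear_def by (simp_all add: distrib_left mult.left_commute)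
  then show ?thesis
    unfolding qlinear_def pact_def
    by (simp add: distrib_left sum.distrib sum_distrib_left mult.left_commute K_closed)
qed

lemma combs_act:
  assumes stable: "\<And>x j. x \<in> K \<Longrightarrow> j < k \<Longrightarrow> (\<lambda>y. g j (x * y)) \<in> combs g k"
    and h: "h \<in> combs g k" and x: "x \<in> K"
  shows "(\<lambda>y. h (x * y)) \<in> combs g k"
proof -
  obtain c where c: "\<And>y. y \<in> K \<Longrightarrow> h y = (\<Sum>j<k. c j * g j y)" using h by (auto simp: combs_def)
  have "(\<lambda>y. \<Sum>j<k. c j * g j (x * y)) \<in> combs g k" using stable[OF x] by (intro combs_sum) auto
  then show ?thesis by (rule combs_cong) (use x in \<open>simp add: c K_closed\<close>)
qed

text \<open>Commuting operators have a common eigenvector: the step to \<open>m + 1\<close> replaces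
  \<open>f\<close> by a polynomial in the action of \<open>b m\<close>, which commutes with the
  action of the earlier \<open>b i\<close> and so keeps their eigenvalues.\<close>

lemma common_eigenvector_mod:
  assumes stable: "\<And>x j. x \<in> K \<Longrightarrow> j < k \<Longrightarrow> (\<lambda>y. g j (x * y)) \<in> combs g k" and k: "k < n"
  shows "m \<le> n \<Longrightarrow> \<exists>f. qlinear f \<and> f \<notin> combs g k \<and>
    (\<forall>i<m. \<exists>l. (\<lambda>y. f (b i * y) - l * f y) \<in> combs g k)"
proof (induction m)
  case 0
  show ?case using qlinear_notin_combs[OF k] by (metis not_less_zero)
next
  case (Suc m)
  then obtain f where f: "qlinear f" "f \<notin> combs g k"
    and ev: "\<And>i. i < m \<Longrightarrow> \<exists>l. (\<lambda>y. f (b i * y) - l * f y) \<in> combs g k" by auto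
  have bm: "b m \<in> K" using Suc.prems b_in by simp
  obtain p :: "rat poly" where p: "lead_coeff p = 1" "poly (map_poly of_rat p) (b m) = 0"
    using algebraic[OF bm] by blast
  have "map_poly of_rat p \<noteq> (0 :: complex poly)" using p(1) by (auto simp: map_poly_eq_0_iff)
  moreover have "pact (b m) (map_poly of_rat p) f \<in> combs g k"
    by (rule combs_cong[OF combs_zero]) (simp add: pact_rational[OF f(1) bm p(2)])
  ultimately obtain q l where q: "pact (b m) q f \<notin> combs g k"
      "(\<lambda>y. pact (b m) q f (b m * y) - l * pact (b m) q f y) \<in> combs g k"
    using eigenvector_mod[OF _ _ f(2)] by blast
  have "\<exists>l. (\<lambda>y. pact (b m) q f (b i * y) - l * pact (b m) q f y) \<in> combs g k" if i: "i < Suc m" for i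
  proof (cases "i = m")
    case True
    then show ?thesis using q(2) by blast
  next
    case False
    then obtain l where l: "(\<lambda>y. f (b i * y) - l * f y) \<in> combs g k" using ev i by force
    have "(\<lambda>y. \<Sum>j\<le>degree q. coeff q j * (f (b i * (b m ^ j * y)) - l * f (b m ^ j * y))) \<in> combs g k"
      by (intro combs_sum combs_act[OF stable l] K_closed bm)
    then have "(\<lambda>y. pact (b m) q f (b i * y) - l * pact (b m) q f y) \<in> combs g k"
      by (rule combs_cong)
        (simp add: pact_def right_diff_distrib sum_subtractf sum_distrib_left mult.left_commute)
    then show ?thesis by blast
  qed
  then show ?case using qlinear_pact[OF f(1) bm, of q] q(1) by blast
qed

lemma combs_cancel:
  assumes "f \<notin> combs g k" "(\<lambda>y. c * f y) \<in> combs g k"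
  shows "c = 0"
  using combs_scale[OF assms(2), of "inverse c"] assms(1) by (cases "c = 0") (auto simp: mult.assoc[symmetric])

text \<open>This is where an embedding arises. The eigenvalue of a common eigenvector is extended
  linearly from the basis to \<open>K\<close>; it is additive and multiplicative because an
  eigenvalue modulo the subspace is unique.\<close>

lemma flag_step:
  assumes stable: "\<And>x j. x \<in> K \<Longrightarrow> j < k \<Longrightarrow> (\<lambda>y. g j (x * y)) \<in> combs g k" and k: "k < n"
  obtains f s where "qlinear f" "f \<notin> combs g k" "field_hom_on K s"
    "\<And>x. x \<in> K \<Longrightarrow> (\<lambda>y. f (x * y) - s x * f y) \<in> combs g k"
proof -
  obtain f where f: "qlinear f" "f \<notin> combs g k"
    and ev: "\<And>i. i < n \<Longrightarrow> \<exists>l. (\<lambda>y. f (b i * y) - l * f y) \<in> combs g k"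
    using common_eigenvector_mod[OF stable k order_refl] by blast
  obtain l where l: "\<And>i. i < n \<Longrightarrow> (\<lambda>y. f (b i * y) - l i * f y) \<in> combs g k" using ev by metis
  define s where "s x = (\<Sum>i<n. of_rat (coord x i) * l i)" for x
  have s: "(\<lambda>y. f (x * y) - s x * f y) \<in> combs g k" if x: "x \<in> K" for x
  proof -
    have "(\<lambda>y. \<Sum>i<n. of_rat (coord x i) * (f (b i * y) - l i * f y)) \<in> combs g k"
      using l by (intro combs_sum) auto
    then show ?thesis
    proof (rule combs_cong)
      fix y assume y: "y \<in> K"
      have "f (x * y) = f (\<Sum>i<n. of_rat (coord x i) * (b i * y))"
        by (subst coord[OF x]) (simp add: sum_distrib_right mult.assoc)
      also have "\<dots> = (\<Sum>i<n. of_rat (coord x i) * f (b i * y))"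
        by (rule qlinear_sum[OF f(1)]) (use y b_in in \<open>auto intro: K_closed\<close>)
      finally show "(\<Sum>i<n. of_rat (coord x i) * (f (b i * y) - l i * f y)) = f (x * y) - s x * f y"
        by (simp add: s_def right_diff_distrib sum_subtractf sum_distrib_right mult.assoc)
    qed
  qed
  have uniq: "c = c'" if "(\<lambda>y. f (x * y) - c * f y) \<in> combs g k" "(\<lambda>y. f (x * y) - c' * f y) \<in> combs g k"
    for x c c'
  proof -
    have "(\<lambda>y. (f (x * y) - c * f y) + (- 1) * (f (x * y) - c' * f y)) \<in> combs g k"
      using that by (intro combs_add combs_scale)
    then have "(\<lambda>y. (c' - c) * f y) \<in> combs g k"
      by (rule combs_cong) (simp add: algebra_simps)
    then show ?thesis using combs_cancel[OF f(2)] by fastforce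
  qed
  have "field_hom_on K s"
    unfolding field_hom_on_def
  proof (intro conjI ballI)
    show "s 1 = 1"
      by (rule uniq[OF s[OF K_closed(2)]]) (simp add: combs_zero)
    fix x y assume x: "x \<in> K" and y: "y \<in> K"
    show "s (x + y) = s x + s y"
    proof (rule uniq[OF s])
      show "x + y \<in> K" using x y by (rule K_closed)
      show "(\<lambda>z. f ((x + y) * z) - (s x + s y) * f z) \<in> combs g k"
        by (rule combs_cong[OF combs_add[OF s[OF x] s[OF y]]])
          (use f(1) x y in \<open>simp add: qlinear_def K_closed distrib_right\<close>)
    qed
    show "s (x * y) = s x * s y"
    proof (rule uniq[OF s])
      show "x * y \<in> K" using x y by (rule K_closed)
      show "(\<lambda>z. f ((x * y) * z) - (s x * s y) * f z) \<in> combs g k"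
        by (rule combs_cong[OF combs_add[OF combs_act[OF stable s[OF x] y] combs_scale[OF s[OF y], of "s x"]]])
          (simp_all add: algebra_simps)
    qed
  qed
  then show ?thesis using that f s by blast
qed

lemma flag:
  "k \<le> n \<Longrightarrow> \<exists>f s. \<forall>i<k. f i \<notin> combs f i \<and> qlinear (f i) \<and> field_hom_on K (s i) \<and>
     (\<forall>x\<in>K. (\<lambda>y. f i (x * y) - s i x * f i y) \<in> combs f i)"
proof (induction k)
  case (Suc k)
  then obtain f s where fs: "\<And>i. i < k \<Longrightarrow> f i \<notin> combs f i" "\<And>i. i < k \<Longrightarrow> qlinear (f i)"
    "\<And>i. i < k \<Longrightarrow> field_hom_on K (s i)"
    "\<And>i x. i < k \<Longrightarrow> x \<in> K \<Longrightarrow> (\<lambda>y. f i (x * y) - s i x * f i y) \<in> combs f i" by auto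
  have mono: "h \<in> combs f k" if "h \<in> combs f i" "i \<le> k" for h i
  proof -
    obtain c where c: "\<forall>y\<in>K. h y = (\<Sum>j<i. c j * f j y)" using \<open>h \<in> combs f i\<close> by (auto simp: combs_def)
    have "(\<Sum>j<k. (if j < i then c j else 0) * f j y) = (\<Sum>j<i. c j * f j y)" for y
      using \<open>i \<le> k\<close> by (intro sum.mono_neutral_cong_right) auto
    then show ?thesis using c unfolding combs_def by (auto intro!: exI[of _ "\<lambda>j. if j < i then c j else 0"])
  qed
  have stable: "(\<lambda>y. f j (x * y)) \<in> combs f k" if x: "x \<in> K" and j: "j < k" for x j
    by (rule combs_cong[OF combs_add[OF mono[OF fs(4)[OF j x]] combs_scale[OF combs_base[OF j], of "s j x"]]])
      (use j in auto)
  obtain f' s' where f': "qlinear f'" "f' \<notin> combs f k" "field_hom_on K s'"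
    "\<And>x. x \<in> K \<Longrightarrow> (\<lambda>y. f' (x * y) - s' x * f' y) \<in> combs f k"
    using flag_step[OF stable] Suc.prems by (metis Suc_le_lessD)
  have eq: "combs (f(k := f')) i = combs f i" if "i \<le> k" for i
    using that by (simp add: combs_def)
  have "(f(k := f')) i \<notin> combs (f(k := f')) i \<and> qlinear ((f(k := f')) i) \<and>
      field_hom_on K ((s(k := s')) i) \<and>
      (\<forall>x\<in>K. (\<lambda>y. (f(k := f')) i (x * y) - (s(k := s')) i x * (f(k := f')) i y) \<in> combs (f(k := f')) i)"
    if "i < Suc k" for i
  proof (cases "i = k")
    case True
    show ?thesis unfolding True eq[OF order_refl] using f' by simp
  next
    case False
    then have "i < k" using that by simp
    then show ?thesis using fs[of i] eq[of i] False by simp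
  qed
  then show ?case by blast
qed simp

text \<open>With respect to the flag, multiplication by \<open>x\<close> is a triangular matrix
  \<open>T\<close> with diagonal \<open>s i x\<close>. It is similar, through \<open>S\<close>, to
  the rational matrix of the same multiplication, so the traces agree.\<close>

lemma trace_embeddings:
  obtains s :: "nat \<Rightarrow> 'a \<Rightarrow> complex" where "\<And>i. i < n \<Longrightarrow> field_hom_on K (s i)"
    "\<And>x. x \<in> K \<Longrightarrow> of_rat (\<Sum>i<n. coord (x * b i) i) = (\<Sum>i<n. s i x)"
proof -
  obtain f s where fs: "\<And>i. i < n \<Longrightarrow> f i \<notin> combs f i" "\<And>i. i < n \<Longrightarrow> qlinear (f i)"
    "\<And>i. i < n \<Longrightarrow> field_hom_on K (s i)"
    "\<And>i x. i < n \<Longrightarrow> x \<in> K \<Longrightarrow> (\<lambda>y. f i (x * y) - s i x * f i y) \<in> combs f i"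
    using flag[OF order_refl] by metis
  define S where "S = mat n n (\<lambda>(i,j). f i (b j))"
  have S: "S \<in> carrier_mat n n" by (simp add: S_def)
  have "det S \<noteq> 0"
  proof
    assume "det S = 0"
    then have "det (transpose_mat S) = 0" using det_transpose[OF S] by simp
    then obtain v where v: "v \<in> carrier_vec n" "v \<noteq> 0\<^sub>v n" "transpose_mat S *\<^sub>v v = 0\<^sub>v n"
      using det_0_iff_vec_prod_zero[of "transpose_mat S" n] S by auto
    have vb: "(\<Sum>i<n. v $ i * f i (b j)) = 0" if "j < n" for j
    proof -
      have "(transpose_mat S *\<^sub>v v) $ j = (\<Sum>i<n. v $ i * f i (b j))"
        using that v(1) by (simp add: S_def scalar_prod_def atLeast0LessThan mult.commute)
      then show ?thesis using v(3) that by simp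
    qed
    have vK: "(\<Sum>i<n. v $ i * f i y) = 0" if y: "y \<in> K" for y
    proof -
      have "f i y = (\<Sum>j<n. of_rat (coord y j) * f i (b j))" if "i < n" for i
        by (subst coord[OF y], rule qlinear_sum[OF fs(2)[OF that]]) (use b_in in auto)
      then have "(\<Sum>i<n. v $ i * f i y) = (\<Sum>i<n. \<Sum>j<n. of_rat (coord y j) * (v $ i * f i (b j)))"
        by (simp add: sum_distrib_left mult.left_commute)
      also have "\<dots> = (\<Sum>j<n. of_rat (coord y j) * (\<Sum>i<n. v $ i * f i (b j)))"
        by (subst sum.swap) (simp add: sum_distrib_left)
      finally show ?thesis by (simp add: vb)
    qed
    obtain i1 where i1: "i1 < n" "v $ i1 \<noteq> 0"
      using v(1,2) by (metis carrier_vecD eq_vecI index_zero_vec)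
    \<comment> \<open>The last nonzero coefficient of the relation: dividing by it expresses
      \<open>f m\<close> through its predecessors, which the flag forbids.\<close>
    define m where "m = Max {i. i < n \<and> v $ i \<noteq> 0}"
    have "m \<in> {i. i < n \<and> v $ i \<noteq> 0}" unfolding m_def by (rule Max_in) (use i1 in auto)
    then have m: "m < n" "v $ m \<noteq> 0" by auto
    have above: "v $ i = 0" if "m < i" "i < n" for i
      using that Max_ge[of "{i. i < n \<and> v $ i \<noteq> 0}" i] unfolding m_def by fastforce
    have "f m y = (\<Sum>i<m. (- v $ i / v $ m) * f i y)" if "y \<in> K" for y
    proof -
      have "0 = (\<Sum>i<Suc m. v $ i * f i y)"
        unfolding vK[OF that, symmetric] using m above by (intro sum.mono_neutral_right) auto
      then have "v $ m * f m y = - (\<Sum>i<m. v $ i * f i y)" by (simp add: eq_neg_iff_add_eq_0 add.commute)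
      then have "f m y = - (\<Sum>i<m. v $ i * f i y) / v $ m" using m by (simp add: field_simps)
      then show ?thesis by (simp add: sum_divide_distrib sum_negf)
    qed
    then have "f m \<in> combs f m"
      unfolding combs_def by (intro CollectI exI[of _ "\<lambda>i. - v $ i / v $ m"]) blast
    then show False using fs(1) m by blast
  qed
  have tr: "of_rat (\<Sum>i<n. coord (x * b i) i) = (\<Sum>i<n. s i x)" if x: "x \<in> K" for x
  proof -
    have "\<exists>c. \<forall>y\<in>K. f i (x * y) - s i x * f i y = (\<Sum>j<i. c j * f j y)" if "i < n" for i
      using fs(4)[OF that x] by (simp add: combs_def)
    then obtain c where c: "\<And>i y. i < n \<Longrightarrow> y \<in> K \<Longrightarrow> f i (x * y) - s i x * f i y = (\<Sum>j<i. c i j * f j y)"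
      by metis
    define M :: "complex mat" where "M = mat n n (\<lambda>(k,j). of_rat (coord (x * b j) k))"
    define T where "T = mat n n (\<lambda>(i,j). if j < i then c i j else if j = i then s i x else 0)"
    have M: "M \<in> carrier_mat n n" and T: "T \<in> carrier_mat n n" by (auto simp: M_def T_def)
    have "S * M = T * S"
    proof (rule eq_matI)
      fix i j assume "i < dim_row (T * S)" "j < dim_col (T * S)"
      then have ij: "i < n" "j < n" using S T by auto
      have xb: "x * b j \<in> K" using x b_in ij by (auto intro: K_closed)
      have "(S * M) $$ (i,j) = (\<Sum>k<n. of_rat (coord (x * b j) k) * f i (b k))"
        unfolding mult_mat_entry[OF S M ij] using ij by (simp add: S_def M_def mult.commute)
      also have "\<dots> = f i (\<Sum>k<n. of_rat (coord (x * b j) k) * b k)"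
        by (rule qlinear_sum[OF fs(2)[OF ij(1)], symmetric]) (use b_in in auto)
      also have "\<dots> = f i (x * b j)" using coord[OF xb] by simp
      also have "\<dots> = (\<Sum>k<i. c i k * f k (b j)) + s i x * f i (b j)"
        using c[OF ij(1) b_in[OF ij(2)]] by (simp add: algebra_simps)
      also have "\<dots> = (\<Sum>k<Suc i. T $$ (i,k) * S $$ (k,j))"
        using ij by (simp add: T_def S_def)
      also have "\<dots> = (\<Sum>k<n. T $$ (i,k) * S $$ (k,j))"
        using ij by (intro sum.mono_neutral_left) (auto simp: T_def)
      also have "\<dots> = (T * S) $$ (i,j)" by (rule mult_mat_entry[OF T S ij, symmetric])
      finally show "(S * M) $$ (i,j) = (T * S) $$ (i,j)" .
    qed (use S M T in auto)
    from sum_diag_similar[OF S M T \<open>det S \<noteq> 0\<close> this] show ?thesis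
      by (simp add: M_def T_def of_rat_sum)
  qed
  show ?thesis using that[of s] fs(3) tr by blast
qed

end


section \<open>Clearing denominators\<close>

lemma common_denominator:
  fixes q :: "nat \<Rightarrow> rat"
  obtains D :: int where "D > 0" "\<And>i. i < n \<Longrightarrow> of_int D * q i \<in> \<int>"
proof -
  have "\<exists>D::int. D > 0 \<and> (\<forall>i<n. of_int D * q i \<in> \<int>)"
  proof (induction n)
    case (Suc n)
    then obtain D where D: "D > 0" "\<forall>i<n. of_int D * q i \<in> \<int>" by blast
    obtain a b where ab: "q n = of_int a / of_int b" "b > 0" by (metis Fract_of_int_quotient Rat_cases)
    have "of_int (D * b) * q i \<in> \<int>" if "i < Suc n" for i
    proof (cases "i = n")
      case True
      then have "of_int (D * b) * q i = of_int (D * a)" using ab by simp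
      then show ?thesis by (metis Ints_of_int)
    next
      case False
      then have "of_int D * q i \<in> \<int>" using D that by simp
      moreover have "of_int (D * b) * q i = of_int b * (of_int D * q i)" by simp
      ultimately show ?thesis by (metis Ints_mult Ints_of_int)
    qed
    then show ?case using D(1) ab(2) by (intro exI[of _ "D * b"]) auto
  qed (auto intro: exI[of _ 1])
  then show ?thesis using that by blast
qed

text \<open>Multiplied by \<open>D ^ N\<close>, the equation of \<open>x\<close> becomes one of
  \<open>y = D * x\<close> in which the coefficient of \<open>y ^ i\<close> carries the factor
  \<open>D ^ (N - i)\<close>. As \<open>i < N\<close>, one \<open>D\<close> clears the denominator
  and the rest is \<open>D ^ (N - 1 - i)\<close>.\<close>

lemma rat_monic_root_multiple_integral:
  fixes x :: "'a::field_char_0" and p :: "rat poly"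
  assumes p: "lead_coeff p = 1" "poly (map_poly of_rat p) x = 0"
  obtains D :: int where "D > 0" "algebraic_int (of_int D * x)"
proof -
  define N where "N = degree p"
  obtain D :: int where D: "D > 0" "\<And>i. i < N \<Longrightarrow> of_int D * coeff p i \<in> \<int>"
    using common_denominator[of N "coeff p"] by blast
  have "\<exists>z::int. of_int D * coeff p i = of_int z" if "i < N" for i
    using D(2)[OF that] by (auto elim: Ints_cases)
  then obtain c :: "nat \<Rightarrow> int" where c: "\<And>i. i < N \<Longrightarrow> of_int D * coeff p i = of_int (c i)" by metis
  have deg: "degree (map_poly (of_rat :: rat \<Rightarrow> 'a) p) = N" by (simp add: degree_map_poly N_def)
  have "N > 0"
  proof (rule ccontr)
    assume "\<not> N > 0"
    then have "p = [:1:]" using p(1) unfolding N_def by (metis degree_0_id gr0I of_nat_0 pCons_one one_pCons)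
    then show False using p(2) by (simp add: map_poly_pCons)
  qed
  define y where "y = of_int D * x"
  have "0 = (\<Sum>i\<le>N. of_rat (coeff p i) * x ^ i)"
    using p(2) unfolding poly_altdef deg by (simp add: coeff_map_poly)
  also have "\<dots> = x ^ N + (\<Sum>i<N. of_rat (coeff p i) * x ^ i)"
    using p(1) by (simp add: N_def lessThan_Suc_atMost[symmetric])
  finally have "x ^ N = - (\<Sum>i<N. of_rat (coeff p i) * x ^ i)" by (simp add: eq_neg_iff_add_eq_0)
  then have "y ^ N = - (\<Sum>i<N. of_int D ^ N * (of_rat (coeff p i) * x ^ i))"
    by (simp add: y_def power_mult_distrib sum_distrib_left)
  also have "\<dots> = - (\<Sum>i<N. int_scale (c i * D ^ (N - 1 - i)) (y ^ i))"
  proof (intro arg_cong[of _ _ uminus] sum.cong refl)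
    fix i assume "i \<in> {..<N}"
    then have i: "i < N" by simp
    have N: "N = Suc (N - 1 - i) + i" using i by simp
    have "(of_int D :: 'a) ^ N = of_int D * of_int D ^ (N - 1 - i) * of_int D ^ i"
      by (subst N, subst power_add) simp
    moreover have "(of_int D :: 'a) * of_rat (coeff p i) = of_int (c i)"
      using arg_cong[OF c[OF i], of "of_rat :: rat \<Rightarrow> 'a"] by (simp add: of_rat_mult)
    ultimately show "of_int D ^ N * (of_rat (coeff p i) * x ^ i) = int_scale (c i * D ^ (N - 1 - i)) (y ^ i)"
      by (simp add: int_scale_def y_def power_mult_distrib mult_ac)
  qed
  finally have yN: "y ^ N = - (\<Sum>i<N. int_scale (c i * D ^ (N - 1 - i)) (y ^ i))" .
  define S where "S = (\<lambda>i. y ^ i) ` {..<N}"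
  have "y * t \<in> int_mod.span S" if t: "t \<in> S" for t
  proof -
    obtain i where i: "t = y ^ i" "i < N" using t by (auto simp: S_def)
    show ?thesis
    proof (cases "Suc i < N")
      case True
      then show ?thesis using i by (intro int_mod.span_base) (auto simp: S_def intro!: image_eqI[of _ _ "Suc i"])
    next
      case False
      then have "y * t = y ^ N" using i by (metis Suc_lessI power_Suc)
      moreover have "y ^ N \<in> int_mod.span S"
        unfolding yN
        by (intro int_mod.span_neg int_mod.span_sum int_mod.span_scale int_mod.span_base) (auto simp: S_def)
      ultimately show ?thesis by simp
    qed
  qed
  moreover have "1 \<in> S" unfolding S_def using \<open>N > 0\<close> by (intro image_eqI[of _ _ 0]) auto
  ultimately have "algebraic_int y"
    by (intro algebraic_int_if_span_stable[of S 1]) (auto simp: S_def)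
  then show ?thesis using that D(1) by (simp add: y_def)
qed

section \<open>Degree and trace do not depend on the basis\<close>

context based_field
begin

lemma inj_basis: "inj_on b {..<n}"
proof (rule inj_onI)
  fix i j assume ij: "i \<in> {..<n}" "j \<in> {..<n}" "b i = b j"
  then have "coord (b i) i = coord (b j) i" by simp
  then show "i = j" using ij coord_basis[of i i] coord_basis[of i j] by (auto split: if_splits)
qed

lemma independent_basis: "rat_vs.independent (b ` {..<n})"
  unfolding rat_vs.dependent_finite[OF finite_imageI[OF finite_lessThan]]
proof clarify
  fix u i assume u: "(\<Sum>v\<in>b ` {..<n}. rat_scale (u v) v) = 0" and i: "i < n" "u (b i) \<noteq> 0"
  have "(\<Sum>i<n. of_rat (u (b i)) * b i) = 0"
    using u by (simp add: sum.reindex[OF inj_basis] rat_scale_def)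
  from b_indep[OF this i(1)] i(2) show False by simp
qed

lemma span_basis: "rat_vs.span (b ` {..<n}) = K"
proof
  show "rat_vs.span (b ` {..<n}) \<subseteq> K"
    by (rule rat_vs.span_minimal)
      (use b_in K_closed in \<open>auto simp: rat_vs.subspace_def rat_scale_def\<close>)
  show "K \<subseteq> rat_vs.span (b ` {..<n})"
  proof
    fix x assume "x \<in> K"
    then have "x = (\<Sum>i<n. rat_scale (coord x i) (b i))" using coord by (simp add: rat_scale_def)
    also have "\<dots> \<in> rat_vs.span (b ` {..<n})"
      by (intro rat_vs.span_sum rat_vs.span_scale rat_vs.span_base) auto
    finally show "x \<in> rat_vs.span (b ` {..<n})" .
  qed
qed

lemma dim_field: "field_degree K = n"
  unfolding field_degree_def
  using rat_vs.dim_span_eq_card_independent[OF independent_basis]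
  by (simp add: span_basis card_image[OF inj_basis])

lemma n_pos: "n > 0"
  using coord[of 1] K_closed(2) by (cases n) auto

definition coord_trace :: "'a \<Rightarrow> rat" where
  "coord_trace x = (\<Sum>i<n. coord (x * b i) i)"

lemma coord_sum:
  "(\<And>j. j \<in> J \<Longrightarrow> x j \<in> K) \<Longrightarrow> i < n \<Longrightarrow>
    coord (\<Sum>j\<in>J. of_rat (q j) * x j) i = (\<Sum>j\<in>J. q j * coord (x j) i)"
proof (induction J rule: infinite_finite_induct)
  case (insert j J)
  have "(\<Sum>j\<in>J. of_rat (q j) * x j) \<in> K"
    using insert by (intro subfield_set_sum[OF K] K_closed) auto
  then show ?case using insert by (simp add: coord_add coord_scale K_closed)
qed (use coord_scale[of 0 i 0] K_closed(1) in auto)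

end

text \<open>The two matrices of multiplication by \<open>x\<close> are similar through the
  transition matrix \<open>C\<close>, which is invertible as \<open>C * D\<close> is the
  identity.\<close>

lemma coord_trace_unique:
  assumes "based_field K n b" "based_field K m c" and x: "x \<in> K"
  shows "based_field.coord_trace n b x = based_field.coord_trace m c x"
proof -
  interpret b: based_field K n b by fact
  interpret c: based_field K m c by fact
  have m: "m = n" using b.dim_field c.dim_field by simp
  note c_in = c.b_in[unfolded m]
  define C where "C = mat n n (\<lambda>(i,j). b.coord (c j) i)"
  define D where "D = mat n n (\<lambda>(i,j). c.coord (b j) i)"
  define M where "M = mat n n (\<lambda>(i,j). b.coord (x * b j) i)"
  define N where "N = mat n n (\<lambda>(i,j). c.coord (x * c j) i)"
  have car: "C \<in> carrier_mat n n" "D \<in> carrier_mat n n" "M \<in> carrier_mat n n" "N \<in> carrier_mat n n"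
    by (auto simp: C_def D_def M_def N_def)
  have "C * D = 1\<^sub>m n"
  proof (rule eq_matI)
    fix i j assume "i < dim_row (1\<^sub>m n :: rat mat)" "j < dim_col (1\<^sub>m n :: rat mat)"
    then have ij: "i < n" "j < n" by auto
    have "(C * D) $$ (i,j) = (\<Sum>k<n. c.coord (b j) k * b.coord (c k) i)"
      unfolding mult_mat_entry[OF car(1,2) ij] using ij by (simp add: C_def D_def mult.commute)
    also have "\<dots> = b.coord (\<Sum>k<n. of_rat (c.coord (b j) k) * c k) i"
      using b.coord_sum[of "{..<n}" c i "c.coord (b j)"] c_in ij by simp
    also have "\<dots> = b.coord (b j) i" using c.coord[OF b.b_in[OF ij(2)]] m by simp
    finally show "(C * D) $$ (i,j) = 1\<^sub>m n $$ (i,j)" using ij by (simp add: b.coord_basis)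
  qed (use car in auto)
  then have "det C \<noteq> 0" using det_mult[OF car(1,2)] by auto
  moreover have "C * N = M * C"
  proof (rule eq_matI)
    fix i j assume "i < dim_row (M * C)" "j < dim_col (M * C)"
    then have ij: "i < n" "j < n" using car by auto
    have xc: "x * c j \<in> K" using x c_in ij by (auto intro: b.K_closed)
    have "(C * N) $$ (i,j) = (\<Sum>k<n. c.coord (x * c j) k * b.coord (c k) i)"
      unfolding mult_mat_entry[OF car(1,4) ij] using ij by (simp add: C_def N_def mult.commute)
    also have "\<dots> = b.coord (\<Sum>k<n. of_rat (c.coord (x * c j) k) * c k) i"
      using b.coord_sum[of "{..<n}" c i "c.coord (x * c j)"] c_in ij by simp
    also have "\<dots> = b.coord (x * c j) i" using c.coord[OF xc] m by simp
    also have "x * c j = (\<Sum>k<n. of_rat (b.coord (c j) k) * (x * b k))"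
      by (subst b.coord[OF c_in[OF ij(2)]]) (simp add: sum_distrib_left mult.left_commute)
    also have "b.coord \<dots> i = (\<Sum>k<n. b.coord (c j) k * b.coord (x * b k) i)"
      by (rule b.coord_sum) (use x b.b_in ij in \<open>auto intro: b.K_closed\<close>)
    also have "\<dots> = (M * C) $$ (i,j)"
      unfolding mult_mat_entry[OF car(3,1) ij] using ij by (simp add: C_def M_def mult.commute)
    finally show "(C * N) $$ (i,j) = (M * C) $$ (i,j)" .
  qed (use car in auto)
  ultimately have "(\<Sum>i<n. N $$ (i,i)) = (\<Sum>i<n. M $$ (i,i))"
    using sum_diag_similar car by blast
  then show ?thesis unfolding b.coord_trace_def c.coord_trace_def by (simp add: M_def N_def m)
qed

lemma based_field_of_basis:
  assumes K: "subfield_set K" and B: "rat_vs.independent B" "rat_vs.span B = K"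
    and b: "bij_betw b {..<n} B"
  shows "based_field K n b"
    and "x \<in> K \<Longrightarrow> (\<Sum>t\<in>B. rat_vs.representation B (x * t) t) = based_field.coord_trace n b x"
proof -
  have fin: "finite B" using b bij_betw_finite by blast
  have reindex: "(\<Sum>i<n. h (b i)) = (\<Sum>t\<in>B. h t)" for h :: "'a \<Rightarrow> 'c::comm_monoid_add"
    by (rule sum.reindex_bij_betw[OF b])
  have bB: "b i \<in> B" if "i < n" for i using b that by (auto simp: bij_betw_def)
  have rep: "y = (\<Sum>i<n. of_rat (rat_vs.representation B y (b i)) * b i)" if "y \<in> K" for y
    using rat_vs.sum_representation_eq[OF B(1), of y B] B(2) that fin reindex[of "\<lambda>t. of_rat (rat_vs.representation B y t) * t"]
    by (simp add: rat_scale_def)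
  show bf: "based_field K n b"
  proof
    show "subfield_set K" by fact
    show "b i \<in> K" if "i < n" for i using bB[OF that] B(2) rat_vs.span_base by blast
    show "\<exists>q::nat \<Rightarrow> rat. x = (\<Sum>i<n. of_rat (q i) * b i)" if "x \<in> K" for x
      using rep[OF that] by (intro exI[of _ "\<lambda>i. rat_vs.representation B x (b i)"])
    fix q :: "nat \<Rightarrow> rat" and i assume q: "(\<Sum>i<n. of_rat (q i) * b i) = 0" and i: "i < n"
    have "(\<Sum>t\<in>B. rat_scale (q (the_inv_into {..<n} b t)) t) = 0"
      unfolding reindex[symmetric] rat_scale_def using q
      by (simp add: the_inv_into_f_f[OF bij_betw_imp_inj_on[OF b]])
    from rat_vs.independentD[OF B(1) fin order_refl this bB[OF i]] show "q i = 0"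
      using i by (simp add: the_inv_into_f_f[OF bij_betw_imp_inj_on[OF b]])
  qed
  interpret based_field K n b by fact
  show "(\<Sum>t\<in>B. rat_vs.representation B (x * t) t) = coord_trace x" if x: "x \<in> K"
  proof -
    have "coord (x * b i) i = rat_vs.representation B (x * b i) (b i)" if "i < n" for i
      by (rule coord_eq[OF rep that]) (use x b_in that in \<open>auto intro: K_closed\<close>)
    then show ?thesis unfolding coord_trace_def reindex[symmetric] by simp
  qed
qed

lemma number_field_based:
  assumes "number_field K"
  obtains n b where "based_field K n b"
proof -
  obtain A where A: "subfield_set K" "finite A" "rat_vs.span A = K"
    using assms by (auto simp: number_field_def)
  obtain B where B: "B \<subseteq> A" "rat_vs.independent B" "A \<subseteq> rat_vs.span B"
    using rat_vs.maximal_independent_subset by blast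
  have span: "rat_vs.span B = K"
    using A B by (metis rat_vs.span_mono rat_vs.span_span subset_antisym)
  have "finite B" using A B finite_subset by blast
  then obtain b where "bij_betw b {..<card B} B"
    using ex_bij_betw_nat_finite[of B] by (auto simp: atLeast0LessThan)
  then show ?thesis using that based_field_of_basis(1)[OF A(1) B(2) span] by blast
qed

text \<open>The definition of the trace picks an unknown basis. It is finite, being independent in
  the span of a finite set, and so can be indexed and compared with \<open>b\<close>.\<close>

lemma field_trace_eq_coord_trace:
  assumes bf: "based_field K n b" and x: "x \<in> K"
  shows "field_trace K x = based_field.coord_trace n b x"
proof -
  interpret based_field K n b by fact
  define B where "B = (SOME B. rat_vs.independent B \<and> rat_vs.span B = K)"
  have B: "rat_vs.independent B" "rat_vs.span B = K"
    using someI_ex[of "\<lambda>B. rat_vs.independent B \<and> rat_vs.span B = K"] independent_basis span_basis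
    unfolding B_def by blast+
  have "finite B"
    using rat_vs.independent_span_bound[of "b ` {..<n}" B] B span_basis
    by (metis finite_imageI finite_lessThan rat_vs.span_superset)
  then obtain c where c: "bij_betw c {..<card B} B"
    using ex_bij_betw_nat_finite[of B] by (auto simp: atLeast0LessThan)
  note bc = based_field_of_basis[OF K B c]
  show ?thesis
    unfolding field_trace_def B_def[symmetric] Let_def
    using bc(2)[OF x] coord_trace_unique[OF bf bc(1) x] by simp
qed

lemma field_hom_on_simps:
  assumes K: "subfield_set K" and s: "field_hom_on K s"
  shows "s 0 = 0" "s 1 = 1" "x \<in> K \<Longrightarrow> y \<in> K \<Longrightarrow> s (x + y) = s x + s y"
    "x \<in> K \<Longrightarrow> y \<in> K \<Longrightarrow> s (x * y) = s x * s y"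
    "x \<in> K \<Longrightarrow> s (- x) = - s x" "x \<in> K \<Longrightarrow> y \<in> K \<Longrightarrow> s (x - y) = s x - s y"
    "x \<in> K \<Longrightarrow> s (x ^ k) = s x ^ k" "s (of_nat m) = of_nat m" "s (of_int j) = of_int j"
    "s (of_rat q) = of_rat q" "x \<in> K \<Longrightarrow> s x = 0 \<longleftrightarrow> x = 0"
    "x \<in> K \<Longrightarrow> y \<in> K \<Longrightarrow> y \<noteq> 0 \<Longrightarrow> s (x / y) = s x / s y"
proof -
  note cl = subfield_set_closed[OF K] subfield_set_of_int[OF K]
  show one: "s 1 = 1" and add: "x \<in> K \<Longrightarrow> y \<in> K \<Longrightarrow> s (x + y) = s x + s y"
    and mult: "x \<in> K \<Longrightarrow> y \<in> K \<Longrightarrow> s (x * y) = s x * s y" for x y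
    using s by (auto simp: field_hom_on_def)
  show zero: "s 0 = 0" using add[OF cl(1) cl(1)] by simp
  show neg: "x \<in> K \<Longrightarrow> s (- x) = - s x" for x
    using add[of x "- x"] cl(6)[of x] zero by (simp add: eq_neg_iff_add_eq_0 add.commute)
  show "x \<in> K \<Longrightarrow> y \<in> K \<Longrightarrow> s (x - y) = s x - s y"
    using add[of x "- y"] neg[of y] cl(6)[of y] by simp
  show "x \<in> K \<Longrightarrow> s (x ^ k) = s x ^ k" by (induction k) (auto simp: one mult cl)
  show nat: "s (of_nat m) = of_nat m" for m by (induction m) (auto simp: zero one add cl)
  show int: "s (of_int j) = of_int j" for j by (cases j rule: int_cases2) (auto simp: nat neg cl)
  show nz: "x \<in> K \<Longrightarrow> s x = 0 \<longleftrightarrow> x = 0" for x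
    using mult[of x "inverse x"] cl(7)[of x] zero one by (cases "x = 0") auto
  show div: "x \<in> K \<Longrightarrow> y \<in> K \<Longrightarrow> y \<noteq> 0 \<Longrightarrow> s (x / y) = s x / s y" for x y
    using mult[of "x / y" y] nz[of y] cl(8)[of x y] by (simp add: field_simps)
  obtain a b where "q = of_int a / of_int b" "b \<noteq> 0" by (metis Fract_of_int_quotient Rat_cases less_irrefl)
  then show "s (of_rat q) = of_rat q"
    using div[of "of_int a" "of_int b"] by (simp add: of_rat_divide int cl)
qed

lemma field_hom_on_sum:
  assumes K: "subfield_set K" and s: "field_hom_on K s" and x: "\<And>i. i \<in> I \<Longrightarrow> x i \<in> K"
  shows "s (\<Sum>i\<in>I. x i) = (\<Sum>i\<in>I. s (x i))"
  using x by (induction I rule: infinite_finite_induct)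
    (auto simp: field_hom_on_simps[OF K s] subfield_set_sum[OF K])

text \<open>A homomorphism of fields is injective and commutes with integer polynomials, so
  \<open>x\<close> and \<open>s x\<close> are roots of the same ones.\<close>

lemma field_hom_on_algebraic_int:
  assumes K: "subfield_set K" and s: "field_hom_on K s" and x: "x \<in> K"
  shows "algebraic_int (s x) \<longleftrightarrow> algebraic_int x"
proof -
  note cl = subfield_set_closed[OF K] subfield_set_of_int[OF K]
  have deg: "degree (map_poly (of_int :: int \<Rightarrow> 'c::field_char_0) p) = degree p" for p
    by (simp add: degree_map_poly)
  have in_K: "poly (map_poly of_int p) x \<in> K" for p
    unfolding poly_altdef by (intro subfield_set_sum[OF K]) (auto intro: cl x simp: coeff_map_poly)
  have "s (poly (map_poly of_int p) x) = poly (map_poly of_int p) (s x)" for p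
    unfolding poly_altdef deg
    by (subst field_hom_on_sum[OF K s]) (auto simp: cl x coeff_map_poly field_hom_on_simps[OF K s])
  then show ?thesis
    using field_hom_on_simps(11)[OF K s in_K] unfolding algebraic_int_altdef_ipoly by metis
qed


section \<open>Integral bases\<close>

text \<open>By the trace formula the matrix of the \<open>s i (b j)\<close> has the Gram matrix as
  the product of its transpose with itself; this is how the embeddings enter later.\<close>

locale embedded_field = based_field K n b
  for K :: "'a::field_char_0 set" and n :: nat and b :: "nat \<Rightarrow> 'a" +
  fixes s :: "nat \<Rightarrow> 'a \<Rightarrow> complex"
  assumes s_hom: "i < n \<Longrightarrow> field_hom_on K (s i)"
    and s_trace: "x \<in> K \<Longrightarrow> of_rat (field_trace K x) = (\<Sum>i<n. s i x)"
begin

lemmas s_simps = field_hom_on_simps[OF K s_hom]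

lemma tr_eqI: "x \<in> K \<Longrightarrow> (\<Sum>i<n. s i x) = of_rat q \<Longrightarrow> field_trace K x = q"
  using s_trace by (metis of_rat_eq_iff)

lemma tr_add: "x \<in> K \<Longrightarrow> y \<in> K \<Longrightarrow> field_trace K (x + y) = field_trace K x + field_trace K y"
  by (rule tr_eqI) (simp_all add: K_closed s_simps sum.distrib of_rat_add s_trace)

lemma tr_scale: "x \<in> K \<Longrightarrow> field_trace K (of_rat q * x) = q * field_trace K x"
  by (rule tr_eqI) (simp_all add: K_closed s_simps of_rat_mult s_trace sum_distrib_left)

lemma tr_scale_int: "x \<in> K \<Longrightarrow> field_trace K (of_int k * x) = of_int k * field_trace K x"
  using tr_scale[of x "of_int k"] by simp

lemma tr_zero: "field_trace K 0 = 0"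
  using tr_scale[of 0 0] K_closed(1) by simp

lemma tr_one: "field_trace K 1 = of_nat n"
  by (rule tr_eqI) (simp_all add: K_closed s_simps)

lemma tr_sum: "(\<And>j. j \<in> J \<Longrightarrow> x j \<in> K) \<Longrightarrow> field_trace K (\<Sum>j\<in>J. x j) = (\<Sum>j\<in>J. field_trace K (x j))"
  by (induction J rule: infinite_finite_induct) (auto simp: tr_zero tr_add subfield_set_sum[OF K])

lemma tr_sum_scale:
  "(\<And>j. j \<in> J \<Longrightarrow> x j \<in> K) \<Longrightarrow>
    field_trace K (\<Sum>j\<in>J. of_rat (q j) * x j) = (\<Sum>j\<in>J. q j * field_trace K (x j))"
  by (subst tr_sum) (auto simp: tr_scale K_closed intro!: sum.cong)

lemma tr_int:
  assumes x: "x \<in> K" "algebraic_int x"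
  shows "field_trace K x \<in> \<int>"
proof -
  have "algebraic_int (of_rat (field_trace K x) :: complex)"
    unfolding s_trace[OF x(1)] using x by (intro algebraic_int_sum) (simp add: field_hom_on_algebraic_int[OF K s_hom])
  then have "of_rat (field_trace K x) \<in> (\<int> :: complex set)"
    by (rule rational_algebraic_int_is_int) simp
  then obtain z where "(of_rat (field_trace K x) :: complex) = of_int z" by (auto elim: Ints_cases)
  then have "(of_rat (field_trace K x) :: complex) = of_rat (of_int z)" by simp
  then have "field_trace K x = of_int z" by (simp only: of_rat_eq_iff)
  then show ?thesis by simp
qed

text \<open>The product of \<open>x\<close> with its inverse has trace \<open>n\<close>, which is
  nonzero; the inverse is expanded in the basis.\<close>

lemma tr_nondegenerate:
  assumes x: "x \<in> K" and orth: "\<And>i. i < n \<Longrightarrow> field_trace K (x * b i) = 0"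
  shows "x = 0"
proof (rule ccontr)
  assume "x \<noteq> 0"
  have ix: "inverse x \<in> K" using x by (rule K_closed)
  have "1 = x * inverse x" using \<open>x \<noteq> 0\<close> by simp
  also have "\<dots> = (\<Sum>i<n. of_rat (coord (inverse x) i) * (x * b i))"
    by (subst (1) coord[OF ix]) (simp add: sum_distrib_left mult.left_commute)
  finally have "field_trace K 1 = field_trace K (\<Sum>i<n. of_rat (coord (inverse x) i) * (x * b i))"
    by simp
  also have "\<dots> = (\<Sum>i<n. coord (inverse x) i * field_trace K (x * b i))"
    using x b_in by (intro tr_sum_scale) (auto intro: K_closed)
  also have "\<dots> = 0" by (simp add: orth)
  finally show False using tr_one n_pos by simp
qed

definition gram :: "(nat \<Rightarrow> 'a) \<Rightarrow> rat mat" where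
  "gram e = mat n n (\<lambda>(i,j). field_trace K (e i * e j))"

lemma gram_carrier: "gram e \<in> carrier_mat n n"
  by (simp add: gram_def)

lemma gram_change:
  assumes C: "C \<in> carrier_mat n n" and e: "\<And>i. i < n \<Longrightarrow> e i \<in> K"
    and e': "\<And>j. j < n \<Longrightarrow> e' j = (\<Sum>i<n. of_rat (C $$ (i,j)) * e i)"
  shows "gram e' = transpose_mat C * (gram e * C)"
    and "det (gram e') = (det C)\<^sup>2 * det (gram e)"
proof -
  show eq: "gram e' = transpose_mat C * (gram e * C)"
  proof (rule eq_matI)
    fix i j assume "i < dim_row (transpose_mat C * (gram e * C))" "j < dim_col (transpose_mat C * (gram e * C))"
    then have ij: "i < n" "j < n" using C by auto
    have "e' i * e' j = (\<Sum>k<n. \<Sum>l<n. of_rat (C $$ (k,i) * C $$ (l,j)) * (e k * e l))"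
      unfolding e'[OF ij(1)] e'[OF ij(2)] sum_product by (simp add: of_rat_mult mult_ac)
    then have "field_trace K (e' i * e' j)
        = (\<Sum>k<n. field_trace K (\<Sum>l<n. of_rat (C $$ (k,i) * C $$ (l,j)) * (e k * e l)))"
      by (simp only:) (rule tr_sum, intro subfield_set_sum[OF K] K_closed e, auto)
    also have "\<dots> = (\<Sum>k<n. \<Sum>l<n. C $$ (k,i) * C $$ (l,j) * field_trace K (e k * e l))"
      by (intro sum.cong refl tr_sum_scale K_closed e) auto
    also have "\<dots> = (\<Sum>k<n. C $$ (k,i) * (\<Sum>l<n. field_trace K (e k * e l) * C $$ (l,j)))"
      by (simp add: sum_distrib_left mult_ac)
    also have "\<dots> = (transpose_mat C * (gram e * C)) $$ (i,j)"
    proof -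
      have tC: "transpose_mat C \<in> carrier_mat n n" using C by simp
      have GC: "gram e * C \<in> carrier_mat n n" using C gram_carrier[of e] by simp
      show ?thesis
        unfolding mult_mat_entry[OF tC GC ij]
        using ij C by (intro sum.cong refl) (subst mult_mat_entry[OF gram_carrier C], auto simp: gram_def)
    qed
    finally show "gram e' $$ (i,j) = (transpose_mat C * (gram e * C)) $$ (i,j)"
      using ij by (simp add: gram_def)
  qed (use C in \<open>auto simp: gram_def\<close>)
  show "det (gram e') = (det C)\<^sup>2 * det (gram e)"
    unfolding eq using C gram_carrier[of e]
    by (simp add: det_mult[of _ n] det_transpose[OF C] power2_eq_square)
qed

lemma det_gram_basis: "det (gram b) \<noteq> 0"
proof
  assume "det (gram b) = 0"
  then obtain v where v: "v \<in> carrier_vec n" "v \<noteq> 0\<^sub>v n" "gram b *\<^sub>v v = 0\<^sub>v n"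
    using det_0_iff_vec_prod_zero[OF gram_carrier] by blast
  define x where "x = (\<Sum>i<n. of_rat (v $ i) * b i)"
  have "field_trace K (x * b j) = 0" if j: "j < n" for j
  proof -
    have "x * b j = (\<Sum>i<n. of_rat (v $ i) * (b j * b i))"
      unfolding x_def sum_distrib_right by (intro sum.cong refl) (simp add: mult_ac)
    then have "field_trace K (x * b j) = (\<Sum>i<n. v $ i * field_trace K (b j * b i))"
      using j by (simp only:) (intro tr_sum_scale K_closed b_in, auto)
    also have "\<dots> = (gram b *\<^sub>v v) $ j"
      using j v(1) by (simp add: gram_def scalar_prod_def atLeast0LessThan mult.commute)
    finally show ?thesis using v(3) j by simp
  qed
  then have "x = 0" by (intro tr_nondegenerate) (simp_all add: x_def comb_in)
  then have "v $ i = 0" if "i < n" for i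
    using b_indep[of "\<lambda>i. v $ i" i] that by (simp add: x_def)
  then show False using v(1,2) by (metis carrier_vecD eq_vecI index_zero_vec)
qed

text \<open>The transition matrix from the given basis has a nonzero determinant, since its square
  is a factor of the Gram determinant.\<close>

lemma based_field_if_det:
  assumes e: "\<And>i. i < n \<Longrightarrow> e i \<in> K" and det: "det (gram e) \<noteq> 0"
  shows "based_field K n e"
proof -
  define C where "C = mat n n (\<lambda>(i,j). coord (e j) i)"
  have C: "C \<in> carrier_mat n n" by (simp add: C_def)
  have e_eq: "e j = (\<Sum>i<n. of_rat (C $$ (i,j)) * b i)" if "j < n" for j
    using coord[OF e[OF that]] that by (simp add: C_def)
  have "det C \<noteq> 0" using gram_change(2)[OF C b_in e_eq] det by auto
  then obtain D where D: "D \<in> carrier_mat n n" "C * D = 1\<^sub>m n" "D * C = 1\<^sub>m n"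
    using mat_inverse_field[OF C] by blast
  have b_eq: "b j = (\<Sum>i<n. of_rat (D $$ (i,j)) * e i)" if j: "j < n" for j
  proof -
    have "(\<Sum>i<n. of_rat (D $$ (i,j)) * e i) = (\<Sum>i<n. \<Sum>k<n. of_rat (C $$ (k,i) * D $$ (i,j)) * b k)"
      by (simp add: e_eq sum_distrib_left of_rat_mult mult_ac)
    also have "\<dots> = (\<Sum>k<n. of_rat ((C * D) $$ (k,j)) * b k)"
      by (subst sum.swap) (simp add: mult_mat_entry[OF C D(1)] j of_rat_sum sum_distrib_right)
    also have "\<dots> = b j"
      using j by (simp add: D(2) if_distrib[of of_rat] if_distrib[of "\<lambda>x. x * _"] cong: if_cong)
    finally show ?thesis by simp
  qed
  show ?thesis
  proof
    show "subfield_set K" by (rule K)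
    show "e i \<in> K" if "i < n" for i using that by (rule e)
    show "\<exists>q::nat \<Rightarrow> rat. x = (\<Sum>i<n. of_rat (q i) * e i)" if x: "x \<in> K" for x
    proof (intro exI)
      have "x = (\<Sum>j<n. \<Sum>i<n. of_rat (D $$ (i,j) * coord x j) * e i)"
        by (subst coord[OF x]) (simp add: b_eq sum_distrib_left of_rat_mult mult_ac)
      also have "\<dots> = (\<Sum>i<n. of_rat (\<Sum>j<n. D $$ (i,j) * coord x j) * e i)"
        by (subst sum.swap) (simp add: of_rat_sum sum_distrib_right)
      finally show "x = (\<Sum>i<n. of_rat (\<Sum>j<n. D $$ (i,j) * coord x j) * e i)" .
    qed
    fix q :: "nat \<Rightarrow> rat" and i assume q: "(\<Sum>i<n. of_rat (q i) * e i) = 0" and i: "i < n"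
    have "(\<Sum>k<n. of_rat (\<Sum>j<n. C $$ (k,j) * q j) * b k) = (\<Sum>k<n. \<Sum>j<n. of_rat (q j) * (of_rat (C $$ (k,j)) * b k))"
      unfolding of_rat_sum sum_distrib_right by (intro sum.cong refl) (simp add: of_rat_mult mult_ac)
    also have "\<dots> = (\<Sum>i<n. of_rat (q i) * e i)"
      by (subst sum.swap) (simp add: e_eq sum_distrib_left)
    finally have Cq: "(\<Sum>j<n. C $$ (k,j) * q j) = 0" if "k < n" for k
      using b_indep[of "\<lambda>k. \<Sum>j<n. C $$ (k,j) * q j" k] q that by simp
    have "q i = (\<Sum>j<n. (D * C) $$ (i,j) * q j)"
      using i by (simp add: D(3) if_distrib[of "\<lambda>x. x * _"] cong: if_cong)
    also have "\<dots> = (\<Sum>j<n. \<Sum>k<n. D $$ (i,k) * (C $$ (k,j) * q j))"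
      using i by (intro sum.cong refl) (simp add: mult_mat_entry[OF D(1) C] sum_distrib_right mult.assoc)
    also have "\<dots> = (\<Sum>k<n. D $$ (i,k) * (\<Sum>j<n. C $$ (k,j) * q j))"
      by (subst sum.swap) (simp add: sum_distrib_left)
    finally show "q i = 0" by (simp add: Cq)
  qed
qed

lemma gram_det_int:
  assumes "\<And>i. i < n \<Longrightarrow> e i \<in> K \<and> algebraic_int (e i)"
  shows "det (gram e) \<in> \<int>"
  unfolding det_def'[OF gram_carrier]
proof (intro Ints_sum Ints_mult Ints_prod)
  fix p i assume p: "p \<in> {p. p permutes {0..<n}}" and i: "i \<in> {0..<n}"
  then have "i < n" "p i < n" using permutes_in_image[of p "{0..<n}" i] by auto
  then show "gram e $$ (i, p i) \<in> \<int>"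
    using assms[of i] assms[of "p i"]
    by (simp add: gram_def tr_int K_closed algebraic_int_times_plus)
qed (simp add: sign_def)

text \<open>Among the bases made of algebraic integers one with minimal absolute Gram determinant is
  taken. If an integer \<open>x\<close> had a fractional coordinate at \<open>k\<close>, then
  replacing \<open>e k\<close> by \<open>x\<close> minus an integer multiple of \<open>e k\<close>
  would multiply the determinant by the square of a number strictly between 0 and 1.\<close>

lemma exists_integral_coordinates:
  obtains e where "based_field K n e" "\<And>i. i < n \<Longrightarrow> algebraic_int (e i)"
    "\<And>x i. x \<in> K \<Longrightarrow> algebraic_int x \<Longrightarrow> i < n \<Longrightarrow> based_field.coord n e x i \<in> \<int>"
proof -
  define P where "P e \<longleftrightarrow> (\<forall>i<n. e i \<in> K \<and> algebraic_int (e i)) \<and> det (gram e) \<noteq> 0" for e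
  \<comment> \<open>On families satisfying \<open>P\<close> the determinant is an integer, so the
    floor loses nothing and a minimum exists.\<close>
  define size where "size e = nat \<lfloor>\<bar>det (gram e)\<bar>\<rfloor>" for e
  have "\<exists>m::int. m > 0 \<and> algebraic_int (of_int m * b i)" if "i < n" for i
    using algebraic[OF b_in[OF that]] rat_monic_root_multiple_integral by metis
  then obtain m :: "nat \<Rightarrow> int" where m: "\<And>i. i < n \<Longrightarrow> m i > 0" "\<And>i. i < n \<Longrightarrow> algebraic_int (of_int (m i) * b i)"
    by metis
  have "P (\<lambda>i. of_int (m i) * b i)"
  proof -
    define C where "C = mat n n (\<lambda>(i,j). if i = j then of_int (m i) else 0 :: rat)"
    have C: "C \<in> carrier_mat n n" by (simp add: C_def)
    have "upper_triangular C" by (auto simp: C_def)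
    then have "det C = (\<Prod>i<n. of_int (m i))"
      using det_upper_triangular[OF _ C] by (simp add: C_def diag_mat_def prod.list_conv_set_nth atLeast0LessThan)
    also have "\<dots> \<noteq> 0" using m(1) by (simp add: prod_zero_iff) force
    finally have "det C \<noteq> 0" .
    moreover have "det (gram (\<lambda>i. of_int (m i) * b i)) = (det C)\<^sup>2 * det (gram b)"
      by (rule gram_change(2)[OF C b_in])
        (simp_all add: C_def if_distrib[of of_rat] if_distrib[of "\<lambda>x. x * _"] cong: if_cong)
    ultimately show ?thesis using m det_gram_basis by (simp add: P_def b_in K_closed)
  qed
  then obtain e where e: "P e" and min: "\<And>f. P f \<Longrightarrow> size e \<le> size f"
    using exists_least_iff[of "\<lambda>k. \<exists>e. P e \<and> size e = k"] by (metis not_le)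
  have bf: "based_field K n e" using e by (intro based_field_if_det) (auto simp: P_def)
  interpret e: based_field K n e by fact
  have "e.coord x k \<in> \<int>" if x: "x \<in> K" "algebraic_int x" and k: "k < n" for x k
  proof (rule ccontr)
    assume nonint: "e.coord x k \<notin> \<int>"
    define q where "q = (\<lambda>i. e.coord x i - (if i = k then of_int \<lfloor>e.coord x k\<rfloor> else 0))"
    define f where "f = e(k := x - of_int \<lfloor>e.coord x k\<rfloor> * e k)"
    \<comment> \<open>The identity with column \<open>k\<close> replaced by the coordinates of
      \<open>f k\<close>; by Cramer its determinant is \<open>q k\<close>.\<close>
    define C where "C = replace_col (1\<^sub>m n) (1\<^sub>m n *\<^sub>v vec n q) k"
    have C: "C \<in> carrier_mat n n" by (simp add: C_def replace_col_def)
    have "det C = q k" using cramer_lemma_mat[of "1\<^sub>m n" n "vec n q" k] k by (simp add: C_def)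
    have fk: "f k = (\<Sum>i<n. of_rat (q i) * e i)"
    proof -
      have "(\<Sum>i<n. of_rat (q i) * e i) = (\<Sum>i<n. of_rat (e.coord x i) * e i)
          - (\<Sum>i<n. (if i = k then of_int \<lfloor>e.coord x k\<rfloor> * e k else 0))"
        unfolding sum_subtractf[symmetric]
        by (intro sum.cong refl) (auto simp: q_def of_rat_diff left_diff_distrib)
      then show ?thesis using k e.coord[OF x(1)] by (simp add: f_def)
    qed
    have f_eq: "f j = (\<Sum>i<n. of_rat (C $$ (i,j)) * e i)" if j: "j < n" for j
    proof (cases "j = k")
      case True
      then show ?thesis using fk k by (simp add: C_def replace_col_def)
    next
      case False
      then have "(\<Sum>i<n. of_rat (C $$ (i,j)) * e i) = (\<Sum>i<n. if i = j then e i else 0)"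
        using j by (intro sum.cong refl) (auto simp: C_def replace_col_def)
      then show ?thesis using False j by (simp add: f_def)
    qed
    have det_f: "det (gram f) = (q k)\<^sup>2 * det (gram e)"
      using gram_change(2)[OF C e.b_in f_eq] \<open>det C = q k\<close> by simp
    have qk: "q k = frac (e.coord x k)" by (simp add: q_def frac_def)
    have "q k \<noteq> 0" "q k < 1" "q k \<ge> 0" using nonint by (auto simp: qk frac_lt_1)
    have "P f"
      using det_f \<open>q k \<noteq> 0\<close> e x k
      by (auto simp: P_def f_def K_closed intro!: algebraic_int_diff algebraic_int_times_plus)
    have ints: "det (gram e) \<in> \<int>" "det (gram f) \<in> \<int>"
      using e \<open>P f\<close> by (auto intro!: gram_det_int simp: P_def)
    have "(q k)\<^sup>2 < 1" using \<open>q k < 1\<close> \<open>q k \<ge> 0\<close> by (simp add: power_less_one_iff abs_square_less_1)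
    then have lt: "\<bar>det (gram f)\<bar> < \<bar>det (gram e)\<bar>" using e by (simp add: det_f abs_mult P_def)
    obtain z where z: "det (gram e) = of_int z" using ints(1) by (rule Ints_cases)
    obtain w where w: "det (gram f) = of_int w" using ints(2) by (rule Ints_cases)
    note zw = z w
    have "\<bar>(of_int u :: rat)\<bar> = of_int \<bar>u\<bar>" for u by simp
    then have "size f < size e" using lt unfolding size_def zw by (simp add: of_int_abs[symmetric] del: of_int_abs)
    then show False using min[OF \<open>P f\<close>] by simp
  qed
  then show ?thesis using that[OF bf] e by (auto simp: P_def)
qed

end

lemma embedded_field_exists:
  assumes "based_field K n b"
  obtains s where "embedded_field K n b s"
proof -
  interpret based_field K n b by fact
  show ?thesis
  proof (rule trace_embeddings)
    fix s :: "nat \<Rightarrow> 'a \<Rightarrow> complex"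
    assume s: "\<And>i. i < n \<Longrightarrow> field_hom_on K (s i)"
      "\<And>x. x \<in> K \<Longrightarrow> of_rat (\<Sum>i<n. coord (x * b i) i) = (\<Sum>i<n. s i x)"
    have "embedded_field K n b s"
      by unfold_locales (auto simp: s field_trace_eq_coord_trace[OF assms] coord_trace_def)
    then show ?thesis by (rule that)
  qed
qed

locale integral_field = embedded_field K n a s
  for K :: "'a::field_char_0 set" and n :: nat and a :: "nat \<Rightarrow> 'a" and s +
  assumes a_int: "i < n \<Longrightarrow> algebraic_int (a i)"
    and coord_int: "x \<in> K \<Longrightarrow> algebraic_int x \<Longrightarrow> i < n \<Longrightarrow> coord x i \<in> \<int>"

lemma integral_basis_exists:
  assumes "number_field K"
  shows "\<exists>bs. integral_basis K bs"
proof -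
  obtain n b where "based_field K n b" using number_field_based[OF assms] by blast
  then obtain s where "embedded_field K n b s" using embedded_field_exists by blast
  then interpret embedded_field K n b s .
  obtain e where "based_field K n e" and e_int: "\<And>i. i < n \<Longrightarrow> algebraic_int (e i)"
    and co: "\<And>x i. x \<in> K \<Longrightarrow> algebraic_int x \<Longrightarrow> i < n \<Longrightarrow> based_field.coord n e x i \<in> \<int>"
    using exists_integral_coordinates by blast
  interpret e: based_field K n e by fact
  have "integral_basis K (map e [0..<n])"
    unfolding integral_basis_def
  proof (intro conjI)
    show "distinct (map e [0..<n])"
      using e.inj_basis by (simp add: distinct_map lessThan_atLeast0)
    have set: "set (map e [0..<n]) = e ` {..<n}" by (auto simp: lessThan_atLeast0)
    show "int_mod.independent (set (map e [0..<n]))"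
      unfolding set int_mod.dependent_finite[OF finite_imageI[OF finite_lessThan]]
    proof clarify
      fix u i assume u: "(\<Sum>v\<in>e ` {..<n}. int_scale (u v) v) = 0" and i: "i < n" "u (e i) \<noteq> 0"
      have "(\<Sum>i<n. of_rat (of_int (u (e i))) * e i) = 0"
        using u by (simp add: sum.reindex[OF e.inj_basis] int_scale_def)
      from e.b_indep[OF this i(1)] i(2) show False by simp
    qed
    show "int_mod.span (set (map e [0..<n])) = ring_of_integers K"
      unfolding set
    proof
      show "int_mod.span (e ` {..<n}) \<subseteq> ring_of_integers K"
        by (rule int_mod.span_minimal)
          (auto simp: int_mod.subspace_def int_scale_def ring_of_integers_def K_closed e.b_in e_int
            intro: algebraic_int_times_plus)
      show "ring_of_integers K \<subseteq> int_mod.span (e ` {..<n})"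
      proof
        fix x assume "x \<in> ring_of_integers K"
        then have x: "x \<in> K" "algebraic_int x" by (auto simp: ring_of_integers_def)
        have "x = (\<Sum>i<n. int_scale \<lfloor>e.coord x i\<rfloor> (e i))"
        proof (subst e.coord[OF x(1)], intro sum.cong refl)
          fix i assume "i \<in> {..<n}"
          then obtain z where "e.coord x i = of_int z" using co[OF x, of i] by (auto elim: Ints_cases)
          then show "of_rat (e.coord x i) * e i = int_scale \<lfloor>e.coord x i\<rfloor> (e i)"
            by (simp add: int_scale_def)
        qed
        also have "\<dots> \<in> int_mod.span (e ` {..<n})"
          by (intro int_mod.span_sum int_mod.span_scale int_mod.span_base) auto
        finally show "x \<in> int_mod.span (e ` {..<n})" .
      qed
    qed
  qed
  then show ?thesis by blast
qed

text \<open>The discriminant is defined through an arbitrarily chosen integral basis, so the later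
  arguments must be available for that basis.\<close>

lemma integral_field_of_integral_basis:
  assumes K: "number_field K" and bs: "integral_basis K bs"
  obtains s where "integral_field K (length bs) ((!) bs) s"
proof -
  define n where "n = length bs"
  have sub: "subfield_set K" using K by (simp add: number_field_def)
  have dist: "distinct bs" and indep: "int_mod.independent (set bs)"
    and span: "int_mod.span (set bs) = ring_of_integers K"
    using bs by (auto simp: integral_basis_def)
  have reindex: "(\<Sum>i<n. h (bs ! i)) = (\<Sum>t\<in>set bs. h t)" for h :: "'a \<Rightarrow> 'c::comm_monoid_add"
    unfolding n_def by (rule sum.reindex_bij_betw[OF bij_betw_nth[OF dist refl refl]])
  have in_O: "bs ! i \<in> ring_of_integers K" if "i < n" for i
    using that span int_mod.span_base[of "bs ! i" "set bs"] by (simp add: n_def)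
  have int_span: "\<exists>c::nat \<Rightarrow> int. x = (\<Sum>i<n. of_int (c i) * bs ! i)" if "x \<in> ring_of_integers K" for x
  proof -
    have "x \<in> int_mod.span (set bs)" using that span by simp
    then obtain u where "x = (\<Sum>t\<in>set bs. of_int (u t) * t)"
      by (auto simp: int_mod.span_finite int_scale_def)
    then have "x = (\<Sum>i<n. of_int (u (bs ! i)) * bs ! i)" using reindex[of "\<lambda>t. of_int (u t) * t"] by simp
    then show ?thesis by (intro exI[of _ "\<lambda>i. u (bs ! i)"])
  qed
  obtain m b where mb: "based_field K m b" using number_field_based[OF K] by blast
  interpret b: based_field K m b by fact
  have bf: "based_field K n ((!) bs)"
  proof
    show "subfield_set K" by (rule sub)
    show "bs ! i \<in> K" if "i < n" for i using in_O[OF that] by (simp add: ring_of_integers_def)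
    show "\<exists>q::nat \<Rightarrow> rat. x = (\<Sum>i<n. of_rat (q i) * bs ! i)" if x: "x \<in> K" for x
    proof -
      obtain D :: int where D: "D > 0" "algebraic_int (of_int D * x)"
        using b.algebraic[OF x] rat_monic_root_multiple_integral by metis
      then have "of_int D * x \<in> ring_of_integers K" using x by (simp add: ring_of_integers_def b.K_closed)
      then obtain c where c: "of_int D * x = (\<Sum>i<n. of_int (c i) * bs ! i)" using int_span by blast
      have "x = inverse (of_int D) * (of_int D * x)" using D(1) by simp
      also have "\<dots> = (\<Sum>i<n. of_rat (of_int (c i) / of_int D) * bs ! i)"
        unfolding c by (simp add: sum_distrib_left of_rat_divide field_simps)
      finally show ?thesis by (intro exI[of _ "\<lambda>i. of_int (c i) / of_int D"])
    qed
    fix q :: "nat \<Rightarrow> rat" and i assume q: "(\<Sum>i<n. of_rat (q i) * bs ! i) = 0" and i: "i < n"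
    obtain D :: int where D: "D > 0" "\<And>i. i < n \<Longrightarrow> of_int D * q i \<in> \<int>"
      using common_denominator[of n q] by blast
    have "\<exists>z::int. of_int D * q i = of_int z" if "i < n" for i
      using D(2)[OF that] by (auto elim: Ints_cases)
    then obtain c :: "nat \<Rightarrow> int" where c: "\<And>i. i < n \<Longrightarrow> of_int D * q i = of_int (c i)" by metis
    define idx where "idx = the_inv_into {..<n} ((!) bs)"
    have inj: "inj_on ((!) bs) {..<n}" using inj_on_nth[OF dist] by (simp add: n_def)
    have idx: "idx (bs ! i) = i" if "i < n" for i
      unfolding idx_def by (rule the_inv_into_f_f[OF inj]) (use that in simp)
    have "(\<Sum>t\<in>set bs. int_scale (c (idx t)) t) = (\<Sum>i<n. of_int (c i) * bs ! i)"
      unfolding reindex[symmetric] by (simp add: int_scale_def idx)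
    also have "\<dots> = (\<Sum>i<n. of_int D * (of_rat (q i) * bs ! i))"
    proof (intro sum.cong refl)
      fix i assume "i \<in> {..<n}"
      then have "of_rat (of_int D * q i) = (of_int (c i) :: 'a)" using c by simp
      then show "of_int (c i) * bs ! i = of_int D * (of_rat (q i) * bs ! i)" by (simp add: of_rat_mult)
    qed
    also have "\<dots> = 0" using q by (simp add: sum_distrib_left[symmetric])
    finally have "c (idx (bs ! i)) = 0"
      by (rule int_mod.independentD[OF indep finite_set order_refl]) (use i in \<open>simp add: n_def\<close>)
    then show "q i = 0" using c[OF i] D(1) i by (simp add: idx)
  qed
  then obtain s where s: "embedded_field K n ((!) bs) s" using embedded_field_exists by blast
  interpret e: embedded_field K n "(!) bs" s by fact
  have "integral_field K n ((!) bs) s"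
  proof
    show "algebraic_int (bs ! i)" if "i < n" for i using in_O[OF that] by (simp add: ring_of_integers_def)
    fix x i assume x: "x \<in> K" "algebraic_int x" and i: "i < n"
    then obtain c where c: "x = (\<Sum>i<n. of_int (c i) * bs ! i)"
      using int_span[of x] by (auto simp: ring_of_integers_def)
    have "e.coord x i = of_int (c i)" by (rule e.coord_eq) (use c i in simp_all)
    then show "e.coord x i \<in> \<int>" by simp
  qed
  then show ?thesis using that by (simp add: n_def)
qed

lemma number_field_integral_field:
  assumes "number_field K"
  obtains n a s where "integral_field K n a s"
    "field_disc K = det (mat n n (\<lambda>(i,j). field_trace K (a i * a j)))" "field_degree K = n"
proof -
  define bs where "bs = (SOME bs. integral_basis K bs)"
  have bs: "integral_basis K bs" unfolding bs_def by (rule someI_ex) (rule integral_basis_exists[OF assms])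
  obtain s where s: "integral_field K (length bs) ((!) bs) s"
    using integral_field_of_integral_basis[OF assms bs] by blast
  interpret integral_field K "length bs" "(!) bs" s by fact
  show ?thesis
    by (rule that[OF s]) (simp_all add: field_disc_def bs_def[symmetric] Let_def dim_field)
qed


section \<open>The radical of an integral form modulo a prime\<close>

text \<open>Linear independence over the field with \<open>p\<close> elements of the first
  \<open>r\<close> rows of \<open>c\<close>, stated with integer representatives.\<close>

definition indep_mod :: "int \<Rightarrow> nat \<Rightarrow> nat \<Rightarrow> (nat \<Rightarrow> nat \<Rightarrow> int) \<Rightarrow> bool" where
  "indep_mod p n r c \<longleftrightarrow>
     (\<forall>e. (\<forall>i<n. p dvd (\<Sum>k<r. e k * c k i)) \<longrightarrow> (\<forall>k<r. p dvd e k))"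

lemma indep_modD:
  "indep_mod p n r c \<Longrightarrow> (\<And>i. i < n \<Longrightarrow> p dvd (\<Sum>k<r. e k * c k i)) \<Longrightarrow> k < r \<Longrightarrow> p dvd e k"
  unfolding indep_mod_def by blast

text \<open>Steinitz exchange modulo \<open>p\<close>. By the adjugate, \<open>det C\<close> times
  the new row is the combination of the rows of \<open>C\<close> with coefficients \<open>v\<close>.
  Some row from position \<open>r\<close> on has a coefficient prime to \<open>p\<close>, as
  otherwise the new row would depend on the old ones; it is replaced, and its coefficient becomes
  the determinant.\<close>

lemma extend_rows_mod_prime:
  fixes p :: int
  assumes p: "prime p" and indep: "indep_mod p n r c"
  shows "\<exists>C \<in> carrier_mat n n. \<not> p dvd det C \<and> r \<le> n \<and> (\<forall>k<r. \<forall>i<n. C $$ (k,i) = c k i)"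
  using indep
proof (induction r)
  case 0
  show ?case using p by (intro bexI[of _ "1\<^sub>m n"]) auto
next
  case (Suc r)
  have "indep_mod p n r c"
    unfolding indep_mod_def
  proof (intro allI impI)
    fix e k assume e: "\<forall>i<n. p dvd (\<Sum>k<r. e k * c k i)" and k: "k < r"
    have "p dvd (e(r := 0)) k" by (rule indep_modD[OF Suc.prems]) (use e k in auto)
    then show "p dvd e k" using k by simp
  qed
  then obtain C where C: "C \<in> carrier_mat n n" "\<not> p dvd det C" "r \<le> n"
    "\<And>k i. k < r \<Longrightarrow> i < n \<Longrightarrow> C $$ (k,i) = c k i" using Suc.IH by blast
  define v where "v k = (\<Sum>j<n. c r j * cofactor C k j)" for k
  have v: "(\<Sum>k<n. v k * C $$ (k,i)) = det C * c r i" if i: "i < n" for i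
  proof -
    have "(\<Sum>k<n. v k * C $$ (k,i)) = (\<Sum>j<n. c r j * (\<Sum>k<n. adj_mat C $$ (j,k) * C $$ (k,i)))"
      using C(1) unfolding v_def sum_distrib_right sum_distrib_left
      by (subst sum.swap) (simp add: adj_mat_def mult.assoc)
    also have "\<dots> = (\<Sum>j<n. c r j * (if j = i then det C else 0))"
    proof (intro sum.cong refl arg_cong2[of _ _ _ _ "(*)"])
      fix j assume "j \<in> {..<n}"
      then have j: "j < n" by simp
      have "(\<Sum>k<n. adj_mat C $$ (j,k) * C $$ (k,i)) = (adj_mat C * C) $$ (j,i)"
        by (rule mult_mat_entry[OF adj_mat(1)[OF C(1)] C(1) j i, symmetric])
      then show "(\<Sum>k<n. adj_mat C $$ (j,k) * C $$ (k,i)) = (if j = i then det C else 0)"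
        using adj_mat(3)[OF C(1)] i j by simp
    qed
    also have "\<dots> = det C * c r i" using i by (simp add: if_distrib[of "\<lambda>x. _ * x"] cong: if_cong)
    finally show ?thesis .
  qed
  have "\<exists>k0. r \<le> k0 \<and> k0 < n \<and> \<not> p dvd v k0"
  proof (rule ccontr)
    assume "\<not> ?thesis"
    then have small: "\<And>k. r \<le> k \<Longrightarrow> k < n \<Longrightarrow> p dvd v k" by blast
    have "p dvd (v(r := - det C)) r"
    proof (rule indep_modD[OF Suc.prems, where e = "v(r := - det C)" and k = r])
      fix i assume i: "i < n"
      have "(\<Sum>k<Suc r. (v(r := - det C)) k * c k i) = (\<Sum>k<r. v k * C $$ (k,i)) - det C * c r i"
        using C(4) i by simp
      also have "\<dots> = - (\<Sum>k\<in>{r..<n}. v k * C $$ (k,i))"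
        unfolding v[OF i, symmetric] using C(3) sum.atLeastLessThan_concat[of 0 r n "\<lambda>k. v k * C $$ (k,i)"]
        by (simp add: atLeast0LessThan)
      finally show "p dvd (\<Sum>k<Suc r. (v(r := - det C)) k * c k i)"
        using small by (auto intro!: dvd_sum)
    qed simp
    then show False using C(2) by simp
  qed
  then obtain k0 where k0: "r \<le> k0" "k0 < n" "\<not> p dvd v k0" by blast
  define C1 where "C1 = mat n n (\<lambda>(i,j). if i = k0 then c r j else C $$ (i,j))"
  have C1: "C1 \<in> carrier_mat n n" by (simp add: C1_def)
  have "cofactor C1 k0 j = cofactor C k0 j" if "j < n" for j
    unfolding cofactor_def using C(1) that k0
    by (intro arg_cong2[of _ _ _ _ "(*)"] arg_cong[of _ _ det] refl eq_matI)
      (auto simp: C1_def mat_delete_def)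
  then have det_C1: "det C1 = v k0"
    unfolding laplace_expansion_row[OF C1 k0(2)] v_def using k0 by (intro sum.cong) (auto simp: C1_def)
  \<comment> \<open>A transposition moves the new row to position \<open>r\<close> and changes at
    most the sign of the determinant.\<close>
  define C2 where "C2 = mat n n (\<lambda>(i,j). C1 $$ (Transposition.transpose r k0 i, j))"
  have C2: "C2 \<in> carrier_mat n n" by (simp add: C2_def)
  have "det C2 = signof (Transposition.transpose r k0) * det C1"
    unfolding C2_def using k0 by (intro det_permute_rows[OF C1] permutes_swap_id) auto
  then have "\<not> p dvd det C2" using k0(3) det_C1 by (auto simp: sign_def)
  moreover have "C2 $$ (k,i) = c k i" if "k < Suc r" "i < n" for k i
    using that k0 C(4) by (auto simp: C2_def C1_def Transposition.transpose_def less_Suc_eq)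
  ultimately show ?case using C2 k0 by (intro bexI[of _ C2]) auto
qed

text \<open>If the rows of \<open>M\<close> were independent modulo \<open>p\<close>, their
  completion would be \<open>M\<close> itself, with determinant prime to \<open>p\<close>.\<close>

lemma kernel_mod_prime:
  fixes p :: int
  assumes p: "prime p" and M: "M \<in> carrier_mat n n" and det: "p dvd det M"
  obtains c i where "i < n" "\<not> p dvd c i" "\<And>i. i < n \<Longrightarrow> p dvd (\<Sum>j<n. c j * M $$ (j,i))"
proof -
  have "\<not> indep_mod p n n (\<lambda>k i. M $$ (k,i))"
  proof
    assume "indep_mod p n n (\<lambda>k i. M $$ (k,i))"
    from extend_rows_mod_prime[OF p this] obtain C where C: "C \<in> carrier_mat n n" "\<not> p dvd det C"
      "\<And>k i. k < n \<Longrightarrow> i < n \<Longrightarrow> C $$ (k,i) = M $$ (k,i)" by blast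
    have "C = M" by (rule eq_matI) (use C M in auto)
    then show False using C(2) det by simp
  qed
  then show ?thesis using that unfolding indep_mod_def by blast
qed

lemma indep_mod_extend:
  fixes p :: int
  assumes p: "prime p" and indep: "indep_mod p n r c"
    and out: "\<And>e. \<exists>i<n. \<not> p dvd (c' i - (\<Sum>k<r. e k * c k i))"
  shows "indep_mod p n (Suc r) (c(r := c'))"
  unfolding indep_mod_def
proof (intro allI impI)
  fix e k assume e: "\<forall>i<n. p dvd (\<Sum>k<Suc r. e k * (c(r := c')) k i)" and k: "k < Suc r"
  have e': "p dvd (\<Sum>k<r. e k * c k i) + e r * c' i" if "i < n" for i
    using e that by simp
  have er: "p dvd e r"
  proof (rule ccontr)
    assume "\<not> p dvd e r"
    then have "coprime (e r) p" using p prime_imp_coprime coprime_commute by blast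
    \<comment> \<open>\<open>f\<close> inverts \<open>e r\<close> modulo \<open>p\<close>, so the
      relation can be solved for \<open>c'\<close>, against \<open>out\<close>.\<close>
    then obtain f g where fg: "f * e r + g * p = 1" using bezout_int[of "e r" p] by auto
    have "e r * f - 1 = p * (- g)" using fg by (simp add: algebra_simps)
    then have f: "p dvd e r * f - 1" by (metis dvd_triv_left)
    obtain i where i: "i < n" "\<not> p dvd (c' i - (\<Sum>k<r. (- f * e k) * c k i))"
      using out[of "\<lambda>k. - f * e k"] by blast
    have "c' i - (\<Sum>k<r. (- f * e k) * c k i) = f * ((\<Sum>k<r. e k * c k i) + e r * c' i) - (e r * f - 1) * c' i"
      by (simp add: algebra_simps sum_distrib_left sum_negf)
    moreover have "p dvd f * ((\<Sum>k<r. e k * c k i) + e r * c' i) - (e r * f - 1) * c' i"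
      by (rule dvd_diff[OF dvd_mult[OF e'[OF i(1)]] dvd_mult2[OF f]])
    ultimately show False using i(2) by metis
  qed
  show "p dvd e k"
  proof (cases "k = r")
    case False
    have "p dvd (\<Sum>k<r. e k * c k i)" if "i < n" for i
      using e'[OF that] er by (simp add: dvd_add_left_iff)
    then show ?thesis using indep_modD[OF indep, of e k] k False by simp
  qed (use er in simp)
qed

lemma indep_mod_single:
  fixes p :: int
  assumes "prime p" "i < n" "\<not> p dvd c 0 i"
  shows "indep_mod p n 1 c"
  unfolding indep_mod_def
proof (intro allI impI)
  fix e k assume e: "\<forall>i<n. p dvd (\<Sum>k<1. e k * c k i)" and k: "k < (1::nat)"
  have "p dvd e 0 * c 0 i" using e assms(2) by simp
  then show "p dvd e k" using prime_dvd_multD[OF assms(1)] assms(3) k by auto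
qed

section \<open>Powers of a prime in the determinant of an integral form\<close>

lemma det_scale_rows:
  fixes A :: "'a::comm_ring_1 mat"
  assumes A: "A \<in> carrier_mat n n"
  shows "det (mat n n (\<lambda>(i,j). w i * A $$ (i,j))) = (\<Prod>i<n. w i) * det A"
proof -
  have M: "mat n n (\<lambda>(i,j). w i * A $$ (i,j)) \<in> carrier_mat n n" by simp
  show ?thesis
    unfolding det_def'[OF M] det_def'[OF A] sum_distrib_left
    by (intro sum.cong refl) (auto simp: prod.distrib permutes_in_image atLeast0LessThan mult_ac)
qed

locale int_form =
  fixes n :: nat and G :: "int mat"
  assumes G: "G \<in> carrier_mat n n" and sym: "i < n \<Longrightarrow> j < n \<Longrightarrow> G $$ (i,j) = G $$ (j,i)"
begin

text \<open>The values of the form at \<open>c\<close> and the basis vectors. All of them are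
  divisible by \<open>p\<close> if and only if \<open>c\<close> lies in the radical modulo
  \<open>p\<close>.\<close>

definition dual :: "(nat \<Rightarrow> int) \<Rightarrow> nat \<Rightarrow> int" where
  "dual c j = (\<Sum>i<n. c i * G $$ (i,j))"

definition form :: "(nat \<Rightarrow> int) \<Rightarrow> (nat \<Rightarrow> int) \<Rightarrow> int" where
  "form c e = (\<Sum>j<n. dual c j * e j)"

lemma form_sym: "form c e = form e c"
proof -
  have "form c e = (\<Sum>j<n. \<Sum>i<n. c i * (G $$ (i,j) * e j))"
    by (simp add: form_def dual_def sum_distrib_right mult.assoc)
  also have "\<dots> = (\<Sum>i<n. \<Sum>j<n. e j * G $$ (j,i) * c i)"
    by (subst sum.swap) (intro sum.cong refl, use sym in \<open>simp add: mult_ac\<close>)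
  finally show ?thesis by (simp add: form_def dual_def sum_distrib_right)
qed

lemma dual_lin: "dual (\<lambda>i. x * c i + y * e i) j = x * dual c j + y * dual e j"
  by (simp add: dual_def distrib_right sum.distrib sum_distrib_left mult.assoc)

lemma form_lin: "form c (\<lambda>i. x * e i + y * f i) = x * form c e + y * form c f"
  by (simp add: form_def distrib_left sum.distrib sum_distrib_left mult.left_commute)

lemma form_sum: "form c (\<lambda>i. \<Sum>k\<in>I. x k * e k i) = (\<Sum>k\<in>I. x k * form c (e k))"
  unfolding form_def sum_distrib_left
  by (subst sum.swap) (intro sum.cong refl, simp add: mult.left_commute)

lemma form_cong: "(\<And>i. i < n \<Longrightarrow> e i = f i) \<Longrightarrow> form c e = form c f"
  by (simp add: form_def)

lemma dvd_form: "(\<And>j. j < n \<Longrightarrow> m dvd dual c j) \<Longrightarrow> m dvd form c e"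
  by (auto simp: form_def intro!: dvd_sum)

text \<open>\<open>C\<close> is a basis change invertible at \<open>p\<close> that starts with the
  rows \<open>c k\<close>. Row \<open>k\<close> of \<open>C * G\<close> is divisible by
  \<open>p ^ a k\<close>, and \<open>N\<close> is what remains after division, so the powers of
  \<open>p\<close> in \<open>det G\<close> are accounted for by \<open>a\<close> and
  \<open>det N\<close>.\<close>

lemma completed_rows:
  fixes p :: int
  assumes p: "prime p" and indep: "indep_mod p n r c"
    and a: "\<And>k j. k < r \<Longrightarrow> j < n \<Longrightarrow> p ^ a k dvd dual (c k) j"
  obtains C N where "C \<in> carrier_mat n n" "\<not> p dvd det C" "r \<le> n" "N \<in> carrier_mat n n"
    "\<And>k i. k < r \<Longrightarrow> i < n \<Longrightarrow> C $$ (k,i) = c k i"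
    "\<And>k j. k < r \<Longrightarrow> j < n \<Longrightarrow> p ^ a k * N $$ (k,j) = dual (c k) j"
    "\<And>k j. r \<le> k \<Longrightarrow> k < n \<Longrightarrow> j < n \<Longrightarrow> N $$ (k,j) = dual (\<lambda>i. C $$ (k,i)) j"
    "det C * det G = p ^ (\<Sum>k<r. a k) * det N"
proof -
  obtain C where C: "C \<in> carrier_mat n n" "\<not> p dvd det C" "r \<le> n"
    "\<And>k i. k < r \<Longrightarrow> i < n \<Longrightarrow> C $$ (k,i) = c k i"
    using extend_rows_mod_prime[OF p indep] by blast
  define w where "w k = (if k < r then p ^ a k else 1)" for k
  define N where "N = mat n n (\<lambda>(k,j). (C * G) $$ (k,j) div w k)"
  have N: "N \<in> carrier_mat n n" by (simp add: N_def)
  have CG: "(C * G) $$ (k,j) = dual (\<lambda>i. C $$ (k,i)) j" if "k < n" "j < n" for k j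
    by (simp add: mult_mat_entry[OF C(1) G that] dual_def)
  have CG': "(C * G) $$ (k,j) = dual (c k) j" if "k < r" "j < n" for k j
    using CG[of k j] C(3,4) that by (simp add: dual_def)
  have w: "w k dvd (C * G) $$ (k,j)" if "k < n" "j < n" for k j
    using that a[of k j] CG'[of k j] by (auto simp: w_def)
  have "C * G = mat n n (\<lambda>(k,j). w k * N $$ (k,j))"
    using w C(1) G by (intro eq_matI) (auto simp: N_def)
  then have "det (C * G) = (\<Prod>k<n. w k) * det N" using det_scale_rows[OF N] by simp
  moreover have "(\<Prod>k<n. w k) = p ^ (\<Sum>k<r. a k)"
  proof -
    have "(\<Prod>k<n. w k) = (\<Prod>k<r. w k)"
      using C(3) by (intro prod.mono_neutral_right) (auto simp: w_def)
    then show ?thesis by (simp add: w_def power_sum)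
  qed
  ultimately have "det C * det G = p ^ (\<Sum>k<r. a k) * det N" using det_mult[OF C(1) G] by simp
  moreover have "p ^ a k * N $$ (k,j) = dual (c k) j" if "k < r" "j < n" for k j
    using that C(3) w[of k j] CG'[of k j] by (auto simp: N_def w_def)
  moreover have "N $$ (k,j) = dual (\<lambda>i. C $$ (k,i)) j" if "r \<le> k" "k < n" "j < n" for k j
    using that CG[of k j] by (simp add: N_def w_def)
  ultimately show ?thesis using that C N by blast
qed

lemma power_dvd_det:
  fixes p :: int
  assumes p: "prime p" and indep: "indep_mod p n r c"
    and a: "\<And>k j. k < r \<Longrightarrow> j < n \<Longrightarrow> p ^ a k dvd dual (c k) j"
  shows "p ^ (\<Sum>k<r. a k) dvd det G"
proof -
  obtain C N where CN: "\<not> p dvd det C" "det C * det G = p ^ (\<Sum>k<r. a k) * det N"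
    using completed_rows[OF p indep a] by metis
  have "coprime (p ^ (\<Sum>k<r. a k)) (det C)" using CN(1) p by (simp add: prime_imp_coprime)
  moreover have "p ^ (\<Sum>k<r. a k) dvd det C * det G" using CN(2) by simp
  ultimately show ?thesis using coprime_dvd_mult_right_iff by blast
qed

text \<open>The vector \<open>v\<close> is in the kernel of \<open>N\<close> modulo
  \<open>p\<close>: the first \<open>r\<close> rows kill it by the assumption on
  \<open>form (c k) v\<close>, the others because \<open>v\<close> is in the radical. So
  \<open>det N\<close> contributes one more \<open>p\<close>.\<close>

lemma power_Suc_dvd_det:
  fixes p :: int
  assumes p: "prime p" and indep: "indep_mod p n r c"
    and a: "\<And>k j. k < r \<Longrightarrow> j < n \<Longrightarrow> p ^ a k dvd dual (c k) j"
    and v: "i0 < n" "\<not> p dvd v i0" "\<And>j. j < n \<Longrightarrow> p dvd dual v j"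
    and cv: "\<And>k. k < r \<Longrightarrow> p ^ Suc (a k) dvd form (c k) v"
  shows "p ^ Suc (\<Sum>k<r. a k) dvd det G"
proof -
  obtain C N where CN: "C \<in> carrier_mat n n" "\<not> p dvd det C" "r \<le> n" "N \<in> carrier_mat n n"
    "\<And>k i. k < r \<Longrightarrow> i < n \<Longrightarrow> C $$ (k,i) = c k i"
    "\<And>k j. k < r \<Longrightarrow> j < n \<Longrightarrow> p ^ a k * N $$ (k,j) = dual (c k) j"
    "\<And>k j. r \<le> k \<Longrightarrow> k < n \<Longrightarrow> j < n \<Longrightarrow> N $$ (k,j) = dual (\<lambda>i. C $$ (k,i)) j"
    "det C * det G = p ^ (\<Sum>k<r. a k) * det N"
    using completed_rows[OF p indep a] by metis
  have Nv: "p dvd (\<Sum>j<n. N $$ (k,j) * v j)" if k: "k < n" for k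
  proof (cases "k < r")
    case True
    have "p ^ a k * (\<Sum>j<n. N $$ (k,j) * v j) = form (c k) v"
      using CN(6)[OF True] by (simp add: form_def sum_distrib_left mult.assoc[symmetric])
    then have "p ^ a k * p dvd p ^ a k * (\<Sum>j<n. N $$ (k,j) * v j)" using cv[OF True] by (simp add: mult.commute)
    then show ?thesis using p by (subst (asm) dvd_mult_cancel_left) auto
  next
    case False
    then have "(\<Sum>j<n. N $$ (k,j) * v j) = form (\<lambda>i. C $$ (k,i)) v"
      using CN(7)[of k] k by (simp add: form_def)
    also have "\<dots> = form v (\<lambda>i. C $$ (k,i))" by (rule form_sym)
    finally show ?thesis using dvd_form[OF v(3)] by simp
  qed
  have "det N * v i0 = (\<Sum>j<n. (det N \<cdot>\<^sub>m 1\<^sub>m n) $$ (i0,j) * v j)"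
    using v(1) by (simp add: if_distrib[of "\<lambda>x. _ * x"] if_distrib[of "\<lambda>x. x * _"] cong: if_cong)
  also have "\<dots> = (\<Sum>j<n. \<Sum>k<n. adj_mat N $$ (i0,k) * (N $$ (k,j) * v j))"
    unfolding adj_mat(3)[OF CN(4), symmetric] using v(1)
    by (intro sum.cong refl) (simp add: mult_mat_entry[OF adj_mat(1)[OF CN(4)] CN(4)] sum_distrib_right mult.assoc)
  also have "\<dots> = (\<Sum>k<n. adj_mat N $$ (i0,k) * (\<Sum>j<n. N $$ (k,j) * v j))"
    by (subst sum.swap) (simp add: sum_distrib_left)
  finally have "p dvd det N * v i0" using Nv by (auto intro!: dvd_sum)
  then have "p dvd det N" using v(2) p prime_dvd_multD by blast
  then have "p ^ Suc (\<Sum>k<r. a k) dvd det C * det G"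
    unfolding CN(8) power_Suc2 by (intro mult_dvd_mono) auto
  moreover have "coprime (p ^ Suc (\<Sum>k<r. a k)) (det C)"
    using CN(2) p prime_imp_coprime by (simp only: coprime_power_left_iff) blast
  ultimately show ?thesis using coprime_dvd_mult_right_iff by blast
qed

text \<open>The first \<open>r\<close> rows are a basis of the radical modulo \<open>p\<close>, so
  \<open>r\<close> is its dimension.\<close>

definition spans_dual_kernel :: "int \<Rightarrow> nat \<Rightarrow> (nat \<Rightarrow> nat \<Rightarrow> int) \<Rightarrow> bool" where
  "spans_dual_kernel p r c \<longleftrightarrow> indep_mod p n r c \<and> (\<forall>k<r. \<forall>j<n. p dvd dual (c k) j) \<and>
     (\<forall>x. (\<forall>j<n. p dvd dual x j) \<longrightarrow> (\<exists>e. \<forall>i<n. p dvd (x i - (\<Sum>k<r. e k * c k i))))"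

lemma spans_or_extend:
  fixes p :: int
  assumes p: "prime p" and indep: "indep_mod p n r c" and ker: "\<And>k j. k < r \<Longrightarrow> j < n \<Longrightarrow> p dvd dual (c k) j"
  shows "spans_dual_kernel p r c \<or>
    (\<exists>x. indep_mod p n (Suc r) (c(r := x)) \<and> (\<forall>j<n. p dvd dual x j))"
proof (cases "\<exists>x. (\<forall>j<n. p dvd dual x j) \<and> (\<forall>e. \<exists>i<n. \<not> p dvd (x i - (\<Sum>k<r. e k * c k i)))")
  case True
  then show ?thesis using indep_mod_extend[OF p indep] by blast
next
  case False
  then show ?thesis using indep ker unfolding spans_dual_kernel_def by blast
qed

lemma dual_kernel_nonzero:
  fixes p :: int
  assumes p: "prime p" and "p dvd det G"
  obtains x where "indep_mod p n 1 (\<lambda>_. x)" "\<And>j. j < n \<Longrightarrow> p dvd dual x j"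
proof -
  obtain x i where "i < n" "\<not> p dvd x i" "\<And>i. i < n \<Longrightarrow> p dvd (\<Sum>j<n. x j * G $$ (j,i))"
    using kernel_mod_prime[OF p G assms(2)] by metis
  then show ?thesis using that indep_mod_single[OF p, of i n "\<lambda>_. x"] by (simp add: dual_def)
qed

text \<open>Every independent vector of the radical contributes a factor \<open>p\<close> to the
  determinant, so a second one is excluded.\<close>

lemma dual_kernel_line:
  fixes p :: int
  assumes p: "prime p" and d: "p dvd det G" "\<not> p\<^sup>2 dvd det G"
  obtains x where "spans_dual_kernel p 1 (\<lambda>_. x)"
proof -
  obtain x where x: "indep_mod p n 1 (\<lambda>_. x)" "\<And>j. j < n \<Longrightarrow> p dvd dual x j"
    using dual_kernel_nonzero[OF p d(1)] by blast
  from spans_or_extend[OF p x(1)] x(2) consider "spans_dual_kernel p 1 (\<lambda>_. x)"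
    | y where "indep_mod p n (Suc 1) ((\<lambda>_. x)(1 := y))" "\<And>j. j < n \<Longrightarrow> p dvd dual y j" by blast
  then show ?thesis
  proof cases
    case 2
    have "p ^ (\<Sum>k<Suc 1. 1) dvd det G"
      by (rule power_dvd_det[OF p 2(1)]) (use x(2) 2(2) in auto)
    then show ?thesis using d(2) by (simp add: power2_eq_square)
  qed (rule that)
qed

lemma dual_kernel_at_most_plane:
  assumes d: "4 dvd det G" "\<not> 8 dvd det G"
  obtains (line) x where "spans_dual_kernel 2 1 (\<lambda>_. x)"
    | (plane) c where "spans_dual_kernel 2 2 c"
proof -
  have p: "prime (2::int)" by simp
  have "2 dvd det G" using d(1) by presburger
  then obtain x where x: "indep_mod 2 n 1 (\<lambda>_. x)" "\<And>j. j < n \<Longrightarrow> 2 dvd dual x j"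
    using dual_kernel_nonzero[OF p] by blast
  from spans_or_extend[OF p x(1)] x(2) consider "spans_dual_kernel 2 1 (\<lambda>_. x)"
    | y where "indep_mod 2 n 2 ((\<lambda>_. x)(1 := y))" "\<And>j. j < n \<Longrightarrow> 2 dvd dual y j"
    by (auto simp: numeral_2_eq_2)
  then show ?thesis
  proof cases
    case 2
    define c :: "nat \<Rightarrow> nat \<Rightarrow> int" where "c = (\<lambda>_. x)(1 := y)"
    have c: "indep_mod 2 n 2 c" "\<And>k j. k < 2 \<Longrightarrow> j < n \<Longrightarrow> 2 dvd dual (c k) j"
      using 2 x(2) by (auto simp: c_def less_Suc_eq numeral_2_eq_2)
    have False if "indep_mod 2 n 3 (c(2 := z))" "\<And>j. j < n \<Longrightarrow> 2 dvd dual z j" for z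
    proof -
      have "2 ^ (\<Sum>k<(3::nat). 1) dvd det G"
        by (rule power_dvd_det[OF p that(1)]) (use c(2) that(2) in auto)
      then show False using d(2) by simp
    qed
    then have "spans_dual_kernel 2 2 c" using spans_or_extend[OF p c] by (auto simp: eval_nat_numeral)
    then show ?thesis by (rule plane)
  qed (rule line)
qed

text \<open>The vector \<open>x\<close> contributes 4 and every further independent vector of the
  radical 2, so a third one would give 16. So would \<open>4 dvd form y y\<close>: some combination
  of \<open>x\<close> and \<open>y\<close> then satisfies the criterion for an additional factor
  2.\<close>

lemma line_or_plane_with_quartic_vector:
  assumes d: "8 dvd det G" "\<not> 16 dvd det G"
    and x: "i0 < n" "odd (x i0)" "\<And>j. j < n \<Longrightarrow> 4 dvd dual x j"
  obtains (line) "spans_dual_kernel 2 1 (\<lambda>_. x)"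
    | (plane) y where "spans_dual_kernel 2 2 ((\<lambda>_. x)(1 := y))" "\<not> 4 dvd form y y"
proof -
  have p: "prime (2::int)" by simp
  have indep: "indep_mod 2 n 1 (\<lambda>_. x)" by (rule indep_mod_single[OF p x(1)]) (use x(2) in simp)
  have x2: "2 dvd dual x j" if "j < n" for j using x(3)[OF that] by presburger
  from spans_or_extend[OF p indep] x2 consider "spans_dual_kernel 2 1 (\<lambda>_. x)"
    | y where "indep_mod 2 n 2 ((\<lambda>_. x)(1 := y))" "\<And>j. j < n \<Longrightarrow> 2 dvd dual y j"
    by (auto simp: numeral_2_eq_2)
  then show ?thesis
  proof cases
    case 2
    define c :: "nat \<Rightarrow> nat \<Rightarrow> int" where "c = (\<lambda>_. x)(1 := y)"
    define a :: "nat \<Rightarrow> nat" where "a = (\<lambda>_. 1)(0 := 2)"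
    have ker: "2 dvd dual (c k) j" if "j < n" for k j
      using 2 x2 that by (auto simp: c_def)
    have c2: "indep_mod 2 n 2 c" using 2 by (simp add: c_def)
    have a: "2 ^ a k dvd dual (c k) j" if "k < 2" "j < n" for k j
      using x(3)[OF that(2)] 2(2)[OF that(2)] that(1) by (auto simp: a_def c_def)
    have False if "indep_mod 2 n 3 (c(2 := z))" "\<And>j. j < n \<Longrightarrow> 2 dvd dual z j" for z
    proof -
      have "2 ^ (\<Sum>k<(3::nat). a k) dvd det G"
      proof (rule power_dvd_det[OF p that(1)])
        fix k j :: nat assume "k < 3" "j < n"
        then show "2 ^ a k dvd dual ((c(2 := z)) k) j"
          using a[of k j] that(2)[of j] by (cases "k = 2") (auto simp: a_def)
      qed
      then show False using d(2) by (simp add: eval_nat_numeral a_def)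
    qed
    then have span: "spans_dual_kernel 2 2 c" using spans_or_extend[OF p c2] ker by (auto simp: eval_nat_numeral)
    have "\<not> 4 dvd form y y"
    proof
      assume yy: "4 dvd form y y"
      have xx: "4 dvd form x x" and xy: "4 dvd form x y" using dvd_form[OF x(3)] by auto
      have False if v: "i1 < n" "odd (v i1)" "\<And>j. j < n \<Longrightarrow> 2 dvd dual v j"
        "8 dvd form x v" "4 dvd form y v" for v i1
      proof -
        have "2 ^ Suc (\<Sum>k<(2::nat). a k) dvd det G"
        proof (rule power_Suc_dvd_det[OF p c2 a v(1) v(2) v(3)])
          fix k :: nat assume "k < 2"
          then show "2 ^ Suc (a k) dvd form (c k) v" using v(4,5) by (auto simp: a_def c_def less_2_cases_iff)
        qed
        then show False using d(2) by (simp add: eval_nat_numeral a_def)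
      qed note no_v = this
      obtain g h where gh: "form x x = 4 * g" "form x y = 4 * h" using xx xy by (auto elim!: dvdE)
      show False
      proof (cases "even g \<and> even h")
        case True
        then show False using no_v[OF x(1,2) x2] gh by (auto simp: form_sym[of y x] elim!: evenE)
      next
        case False
        \<comment> \<open>Chosen so that \<open>form x v\<close> is 0. When \<open>g\<close> and
          \<open>h\<close> are both even this vector vanishes modulo 2, and \<open>x\<close> itself
          has been used instead.\<close>
        define v where "v = (\<lambda>i. h * x i + (- g) * y i)"
        have "\<exists>i<n. odd (v i)"
        proof (rule ccontr)
          assume "\<not> ?thesis"
          then have "\<And>i. i < n \<Longrightarrow> 2 dvd (\<Sum>k<2. (if k = 0 then h else - g) * c k i)"
            by (auto simp: c_def v_def numeral_2_eq_2)
          from indep_modD[OF c2 this] have "2 dvd (if k = 0 then h else - g)" if "k < 2" for k :: nat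
            using that by blast
          from this[of 0] this[of 1] show False using \<open>\<not> (even g \<and> even h)\<close> by simp
        qed
        then obtain i1 where "i1 < n" "odd (v i1)" by blast
        moreover have "2 dvd dual v j" if "j < n" for j
          using x2[OF that] 2(2)[OF that] unfolding v_def dual_lin by simp
        moreover have "8 dvd form x v" unfolding v_def form_lin gh by (simp add: mult_ac)
        moreover have "4 dvd form y v"
          using yy xy unfolding v_def form_lin form_sym[of y x] by (simp add: dvd_mult)
        ultimately show False using no_v by blast
      qed
    qed
    then show ?thesis using span plane by (simp add: c_def)
  qed (rule line)
qed

text \<open>Half the form takes integer values on the radical modulo 2; the condition says that this
  halved form, modulo 2, is nondegenerate.\<close>

definition kernel_form_nondegenerate :: bool where
  "kernel_form_nondegenerate \<longleftrightarrow> (\<forall>v. (\<forall>j<n. 2 dvd dual v j) \<longrightarrow>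
     (\<forall>w. (\<forall>j<n. 2 dvd dual w j) \<longrightarrow> 4 dvd form w v) \<longrightarrow> (\<forall>i<n. 2 dvd v i))"

text \<open>Fewer than three rows leave \<open>det N\<close> even. A kernel vector of
  \<open>N\<close> modulo 2 is then both in the radical and orthogonal to it modulo 4, contrary to
  nondegeneracy.\<close>

lemma plane_not_spanning:
  assumes d: "8 dvd det G" and r: "r < 3"
    and c: "spans_dual_kernel 2 r c"
    and nondeg: kernel_form_nondegenerate
  shows False
proof -
  have p: "prime (2::int)" by simp
  have indep: "indep_mod 2 n r c" and ker: "\<And>k j. k < r \<Longrightarrow> j < n \<Longrightarrow> 2 dvd dual (c k) j"
    and span: "\<And>x. (\<And>j. j < n \<Longrightarrow> 2 dvd dual x j) \<Longrightarrow> \<exists>e. \<forall>i<n. 2 dvd (x i - (\<Sum>k<r. e k * c k i))"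
    using c unfolding spans_dual_kernel_def by auto
  define a :: "nat \<Rightarrow> nat" where "a = (\<lambda>_. 1)"
  have ker1: "\<And>k j. k < r \<Longrightarrow> j < n \<Longrightarrow> 2 ^ a k dvd dual (c k) j" using ker by (simp add: a_def)
  obtain C N where CN: "C \<in> carrier_mat n n" "\<not> 2 dvd det C" "r \<le> n" "N \<in> carrier_mat n n"
    "\<And>k i. k < r \<Longrightarrow> i < n \<Longrightarrow> C $$ (k,i) = c k i"
    "\<And>k j. k < r \<Longrightarrow> j < n \<Longrightarrow> 2 ^ a k * N $$ (k,j) = dual (c k) j"
    "\<And>k j. r \<le> k \<Longrightarrow> k < n \<Longrightarrow> j < n \<Longrightarrow> N $$ (k,j) = dual (\<lambda>i. C $$ (k,i)) j"
    "det C * det G = 2 ^ (\<Sum>k<r. a k) * det N"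
    using completed_rows[OF p indep ker1] by metis
  have "2 dvd det N"
  proof -
    have "8 dvd 2 ^ r * det N" using d CN(8)[symmetric] by (simp add: a_def)
    then have "2 ^ (3 - r) * 2 ^ r dvd det N * 2 ^ r"
      using r by (simp add: power_add[symmetric] mult.commute)
    then have "2 ^ (3 - r) dvd det N" by simp
    moreover have "2 dvd (2::int) ^ (3 - r)" using r by simp
    ultimately show ?thesis using dvd_trans by blast
  qed
  then have "2 dvd det (transpose_mat N)" using det_transpose[OF CN(4)] by simp
  then obtain v i0 where v: "i0 < n" "\<not> 2 dvd v i0"
    "\<And>k. k < n \<Longrightarrow> 2 dvd (\<Sum>j<n. v j * transpose_mat N $$ (j,k))"
    using kernel_mod_prime[OF p, of "transpose_mat N" n] CN(4) by (metis transpose_carrier_mat)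
  have Nv: "2 dvd (\<Sum>j<n. N $$ (k,j) * v j)" if "k < n" for k
    using v(3)[OF that] CN(4) that by (simp add: mult.commute)
  have cv: "4 dvd form (c k) v" if "k < r" for k
  proof -
    have "form (c k) v = 2 * (\<Sum>j<n. N $$ (k,j) * v j)"
      using CN(6)[OF that] by (simp add: a_def form_def sum_distrib_left mult.assoc[symmetric])
    then show ?thesis using Nv[of k] that CN(3) by auto
  qed
  \<comment> \<open>To place \<open>v\<close> in the radical, \<open>dual v\<close> is tested
    against the rows of \<open>C\<close>, which is invertible modulo 2.\<close>
  have Cv: "2 dvd (\<Sum>i<n. C $$ (k,i) * dual v i)" if k: "k < n" for k
  proof (cases "k < r")
    case True
    have "(\<Sum>i<n. C $$ (k,i) * dual v i) = form v (c k)"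
      using CN(5)[OF True] by (simp add: form_def mult.commute)
    then show ?thesis using cv[OF True] form_sym[of v "c k"] by presburger
  next
    case False
    have "(\<Sum>i<n. C $$ (k,i) * dual v i) = form v (\<lambda>i. C $$ (k,i))"
      by (simp add: form_def mult.commute)
    also have "\<dots> = (\<Sum>j<n. N $$ (k,j) * v j)"
      using CN(7)[of k] False k form_sym[of v] by (simp add: form_def)
    finally show ?thesis using Nv[OF k] by simp
  qed
  have dv: "2 dvd dual v i" if i: "i < n" for i
  proof -
    have "det C * dual v i = (\<Sum>j<n. (adj_mat C * C) $$ (i,j) * dual v j)"
      unfolding adj_mat(3)[OF CN(1)]
      using i by (simp add: if_distrib[of "\<lambda>x. _ * x"] if_distrib[of "\<lambda>x. x * _"] cong: if_cong)
    also have "\<dots> = (\<Sum>j<n. \<Sum>k<n. adj_mat C $$ (i,k) * (C $$ (k,j) * dual v j))"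
      using i by (intro sum.cong refl) (simp add: mult_mat_entry[OF adj_mat(1)[OF CN(1)] CN(1)] sum_distrib_right mult.assoc del: index_mult_mat(1))
    also have "\<dots> = (\<Sum>k<n. adj_mat C $$ (i,k) * (\<Sum>j<n. C $$ (k,j) * dual v j))"
      by (subst sum.swap) (simp add: sum_distrib_left)
    finally have "2 dvd det C * dual v i" using Cv by (auto intro!: dvd_sum)
    then show ?thesis using CN(2) by simp
  qed
  have "4 dvd form w v" if w: "\<forall>j<n. 2 dvd dual w j" for w
  proof -
    obtain e where e: "\<And>i. i < n \<Longrightarrow> 2 dvd (w i - (\<Sum>k<r. e k * c k i))" using span w by blast
    define z where "z i = (w i - (\<Sum>k<r. e k * c k i)) div 2" for i
    have "form w v = form v (\<lambda>i. 1 * (\<Sum>k<r. e k * c k i) + 2 * z i)"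
      using e by (subst form_sym, intro form_cong) (simp add: z_def)
    also have "\<dots> = (\<Sum>k<r. e k * form v (c k)) + 2 * form v z"
      unfolding form_lin form_sum by simp
    finally show ?thesis
      using cv dvd_form[OF dv, of z] by (auto simp: form_sym[of v] intro!: dvd_add dvd_sum elim!: dvdE)
  qed
  then show False using nondeg dv v(1,2) unfolding kernel_form_nondegenerate_def by blast
qed

text \<open>The adjugate separates the types of elementary divisors. If not all of its entries are
  divisible by 4, then one of its rows, or half of such a row, is nonzero modulo 2 and has all its
  products divisible by 4. If all are, then the halved form is nondegenerate and the radical has
  dimension 3.\<close>

lemma dual_kernel_cases_8:
  assumes d: "8 dvd det G" "\<not> 16 dvd det G"
  obtains (line) x where "spans_dual_kernel 2 1 (\<lambda>_. x)" "\<And>j. j < n \<Longrightarrow> 4 dvd dual x j"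
    | (plane) x y where "spans_dual_kernel 2 2 ((\<lambda>_. x)(1 := y))" "\<And>j. j < n \<Longrightarrow> 4 dvd dual x j"
        "\<not> 4 dvd form y y"
    | (space) c where "spans_dual_kernel 2 3 c" kernel_form_nondegenerate
proof -
  have p: "prime (2::int)" by simp
  define H where "H = adj_mat G"
  have H: "H \<in> carrier_mat n n" unfolding H_def by (rule adj_mat(1)[OF G])
  have HG: "dual (\<lambda>j. H $$ (i,j)) k = (if i = k then det G else 0)" if "i < n" "k < n" for i k
    unfolding dual_def mult_mat_entry[OF H G that, symmetric] using that by (simp add: H_def adj_mat(3)[OF G])
  show ?thesis
  proof (cases "\<forall>i<n. \<forall>j<n. 4 dvd H $$ (i,j)")
    case False
    then obtain i j where ij: "i < n" "j < n" "\<not> 4 dvd H $$ (i,j)" by blast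
    have "\<exists>x i0. i0 < n \<and> odd (x i0) \<and> (\<forall>j<n. 4 dvd dual x j)"
    proof (cases "\<exists>k<n. odd (H $$ (i,k))")
      case True
      then obtain k where k: "k < n" "odd (H $$ (i,k))" by blast
      have "4 dvd det G" using d(1) by presburger
      then show ?thesis using k HG[OF ij(1)] by (intro exI[of _ "\<lambda>j. H $$ (i,j)"] exI[of _ k]) auto
    next
      case False
      define h where "h k = H $$ (i,k) div 2" for k
      have h: "2 * h k = H $$ (i,k)" if "k < n" for k using False that by (auto simp: h_def)
      have "2 * dual h k = (if i = k then det G else 0)" if "k < n" for k
        unfolding HG[OF ij(1) that, symmetric] dual_def sum_distrib_left
        by (intro sum.cong refl) (simp add: h mult.assoc[symmetric])
      then have "4 dvd dual h k" if "k < n" for k using d(1) that by (cases "i = k") (force elim!: dvdE)+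
      moreover have "odd (h j)" using h[OF ij(2)] ij(3) by presburger
      ultimately show ?thesis using ij(2) by blast
    qed
    then obtain x i0 where x: "i0 < n" "odd (x i0)" "\<And>j. j < n \<Longrightarrow> 4 dvd dual x j" by blast
    from line_or_plane_with_quartic_vector[OF d x] show ?thesis
      using line plane x(3) by metis
  next
    case True
    have nondeg: kernel_form_nondegenerate
      unfolding kernel_form_nondegenerate_def
    proof (intro allI impI)
      fix v i assume v: "\<forall>w. (\<forall>j<n. 2 dvd dual w j) \<longrightarrow> 4 dvd form w v" and i: "i < n"
      \<comment> \<open>A quarter of row \<open>i\<close> of the adjugate lies in the radical and
        pairs with \<open>v\<close> to \<open>2 * m * v i\<close> with \<open>m\<close> odd, so it
        detects the parity of \<open>v i\<close>.\<close>
      define h where "h k = H $$ (i,k) div 4" for k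
      obtain m where m8: "det G = 8 * m" using d(1) by (auto elim!: dvdE)
      have "odd m" using d(2) unfolding m8 by (auto elim!: evenE)
      note m = m8 this
      have "4 * dual h k = (if i = k then det G else 0)" if "k < n" for k
        unfolding HG[OF i that, symmetric] dual_def sum_distrib_left
        using True i by (intro sum.cong refl) (simp add: h_def mult.assoc[symmetric])
      then have dh: "dual h k = (if i = k then 2 * m else 0)" if "k < n" for k using m that by force
      have "4 dvd form h v" using v by (simp add: dh)
      moreover have "form h v = 2 * m * v i"
        using i unfolding form_def by (simp add: dh if_distrib[of "\<lambda>x. x * _"] cong: if_cong)
      ultimately have "4 dvd 2 * (m * v i)" by (simp add: mult.assoc)
      then have "2 * 2 dvd 2 * (m * v i)" by simp
      then have "even (m * v i)" by (simp only: dvd_mult_cancel_left) simp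
      then show "2 dvd v i" using m(2) by simp
    qed
    have ext: "\<exists>x. indep_mod 2 n (Suc r) (c(r := x)) \<and> (\<forall>j<n. 2 dvd dual x j)"
      if "r < 3" "indep_mod 2 n r c" "\<And>k j. k < r \<Longrightarrow> j < n \<Longrightarrow> 2 dvd dual (c k) j" for r c
      using spans_or_extend[OF p that(2,3)] plane_not_spanning[OF d(1) that(1)] nondeg by blast
    have "\<exists>c. indep_mod 2 n r c \<and> (\<forall>k<r. \<forall>j<n. 2 dvd dual (c k) j)" if "r \<le> 3" for r
      using that
    proof (induction r)
      case 0
      show ?case by (simp add: indep_mod_def)
    next
      case (Suc r)
      then obtain c where c: "indep_mod 2 n r c" "\<And>k j. k < r \<Longrightarrow> j < n \<Longrightarrow> 2 dvd dual (c k) j" by auto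
      obtain x where x: "indep_mod 2 n (Suc r) (c(r := x))" "\<And>j. j < n \<Longrightarrow> 2 dvd dual x j"
        using ext[OF _ c] Suc.prems by (metis Suc_le_lessD)
      have "\<forall>k<Suc r. \<forall>j<n. 2 dvd dual ((c(r := x)) k) j" using x(2) c(2) by (auto simp: less_Suc_eq)
      then show ?case using x(1) by blast
    qed
    then obtain c where c: "indep_mod 2 n 3 c" "\<And>k j. k < 3 \<Longrightarrow> j < n \<Longrightarrow> 2 dvd dual (c k) j" by blast
    \<comment> \<open>Four independent vectors of the radical would give 16.\<close>
    have False if z: "indep_mod 2 n 4 (c(3 := z))" "\<And>j. j < n \<Longrightarrow> 2 dvd dual z j" for z
    proof -
      have "2 ^ (\<Sum>k<(4::nat). 1) dvd det G"
        by (rule power_dvd_det[OF p z(1)]) (use c(2) z(2) in auto)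
      then show False using d(2) by simp
    qed
    then have "spans_dual_kernel 2 3 c" using spans_or_extend[OF p c] by (auto simp: eval_nat_numeral)
    then show ?thesis using space nondeg by blast
  qed
qed

end


section \<open>The radical of the trace form\<close>

context integral_field
begin

abbreviation OK :: "'a set" where "OK \<equiv> ring_of_integers K"

lemma O_iff: "x \<in> OK \<longleftrightarrow> x \<in> K \<and> algebraic_int x"
  by (simp add: ring_of_integers_def)

lemma O_in_K: "x \<in> OK \<Longrightarrow> x \<in> K"
  by (simp add: O_iff)

lemma O_closed:
  "0 \<in> OK" "1 \<in> OK" "x \<in> OK \<Longrightarrow> y \<in> OK \<Longrightarrow> x + y \<in> OK" "x \<in> OK \<Longrightarrow> y \<in> OK \<Longrightarrow> x - y \<in> OK"
  "x \<in> OK \<Longrightarrow> y \<in> OK \<Longrightarrow> x * y \<in> OK" "x \<in> OK \<Longrightarrow> - x \<in> OK" "of_int k \<in> OK" "x \<in> OK \<Longrightarrow> x ^ m \<in> OK"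
  "i < n \<Longrightarrow> a i \<in> OK"
  by (auto simp: O_iff K_closed b_in a_int intro: algebraic_int_times_plus algebraic_int_diff algebraic_int_power)

lemma O_sum: "(\<And>i. i \<in> I \<Longrightarrow> f i \<in> OK) \<Longrightarrow> sum f I \<in> OK"
  by (induction I rule: infinite_finite_induct) (auto intro: O_closed)

definition icomb :: "(nat \<Rightarrow> int) \<Rightarrow> 'a" where
  "icomb c = (\<Sum>i<n. of_int (c i) * a i)"

lemma icomb_in: "icomb c \<in> OK"
  unfolding icomb_def by (intro O_sum O_closed) auto

lemma coord_icomb: "i < n \<Longrightarrow> coord (icomb c) i = of_int (c i)"
  by (rule coord_eq) (simp_all add: icomb_def)

definition icoord :: "'a \<Rightarrow> nat \<Rightarrow> int" where
  "icoord x i = \<lfloor>coord x i\<rfloor>"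

lemma coord_icoord: "x \<in> OK \<Longrightarrow> i < n \<Longrightarrow> coord x i = of_int (icoord x i)"
  using coord_int[of x i] by (auto simp: O_iff icoord_def elim!: Ints_cases)

lemma icomb_icoord: "x \<in> OK \<Longrightarrow> icomb (icoord x) = x"
  using coord[of x] by (simp add: icomb_def coord_icoord O_in_K)

lemma icoord_icomb: "i < n \<Longrightarrow> icoord (icomb c) i = c i"
  by (simp add: icoord_def coord_icomb)

lemma icomb_lin: "icomb (\<lambda>i. x * c i + y * e i) = of_int x * icomb c + of_int y * icomb e"
  by (simp add: icomb_def distrib_right sum.distrib sum_distrib_left mult.assoc)

lemma icomb_sum: "icomb (\<lambda>i. \<Sum>k\<in>I. x k * c k i) = (\<Sum>k\<in>I. of_int (x k) * icomb (c k))"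
  unfolding icomb_def of_int_sum sum_distrib_right sum_distrib_left
  by (subst sum.swap) (simp add: mult.assoc)

lemma icomb_cong: "(\<And>i. i < n \<Longrightarrow> c i = e i) \<Longrightarrow> icomb c = icomb e"
  by (simp add: icomb_def)

text \<open>On the ring of integers the trace is integral, so there the floor changes only its
  type.\<close>

definition tri :: "'a \<Rightarrow> int" where
  "tri x = \<lfloor>field_trace K x\<rfloor>"

lemma tri: "x \<in> OK \<Longrightarrow> of_int (tri x) = field_trace K x"
  using tr_int[of x] by (auto simp: O_iff tri_def elim!: Ints_cases)

lemma tri_eqI: "x \<in> OK \<Longrightarrow> field_trace K x = of_int k \<Longrightarrow> tri x = k"
  by (simp add: tri_def)

lemma tri_add: "x \<in> OK \<Longrightarrow> y \<in> OK \<Longrightarrow> tri (x + y) = tri x + tri y"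
  by (rule tri_eqI) (simp_all add: O_closed tr_add O_in_K tri)

lemma tri_scale: "x \<in> OK \<Longrightarrow> tri (of_int k * x) = k * tri x"
  by (rule tri_eqI) (simp_all add: O_closed tr_scale_int O_in_K tri)

lemma tri_zero: "tri 0 = 0"
  by (simp add: tri_def tr_zero)

lemma tri_sum: "(\<And>i. i \<in> I \<Longrightarrow> x i \<in> OK) \<Longrightarrow> tri (\<Sum>i\<in>I. x i) = (\<Sum>i\<in>I. tri (x i))"
  by (induction I rule: infinite_finite_induct) (auto simp: tri_zero tri_add O_sum)

lemma tri_lin_comb:
  "(\<And>i. i \<in> I \<Longrightarrow> x i \<in> OK) \<Longrightarrow> tri (\<Sum>i\<in>I. of_int (k i) * x i) = (\<Sum>i\<in>I. k i * tri (x i))"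
  by (subst tri_sum) (auto simp: tri_scale O_closed)

lemma tri_coord: "x \<in> OK \<Longrightarrow> tri x = (\<Sum>j<n. icoord (x * a j) j)"
proof (rule tri_eqI)
  assume x: "x \<in> OK"
  have "field_trace K x = coord_trace x"
    by (rule field_trace_eq_coord_trace[OF based_field_axioms O_in_K[OF x]])
  then show "field_trace K x = of_int (\<Sum>j<n. icoord (x * a j) j)"
    using x by (simp add: coord_trace_def coord_icoord O_closed)
qed

definition gram_int :: "int mat" where
  "gram_int = mat n n (\<lambda>(i,j). tri (a i * a j))"

sublocale lat: int_form n gram_int
  by unfold_locales (auto simp: gram_int_def mult.commute)

lemma det_gram_int: "det (gram a) = of_int (det gram_int)"
proof -
  have "gram a = map_mat of_int gram_int"
    by (rule eq_matI) (auto simp: gram_def gram_int_def tri O_closed)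
  then show ?thesis by simp
qed

lemma tri_icomb_basis: "j < n \<Longrightarrow> tri (icomb c * a j) = lat.dual c j"
  unfolding icomb_def lat.dual_def sum_distrib_right mult.assoc
  by (subst tri_lin_comb) (auto simp: O_closed gram_int_def)

lemma tri_icomb_icomb: "tri (icomb c * icomb e) = lat.form c e"
proof -
  have "icomb c * icomb e = (\<Sum>j<n. of_int (e j) * (icomb c * a j))"
    by (subst (2) icomb_def) (simp add: sum_distrib_left mult.left_commute)
  also have "tri \<dots> = (\<Sum>j<n. e j * tri (icomb c * a j))"
    by (rule tri_lin_comb) (auto intro: O_closed icomb_in)
  also have "\<dots> = lat.form c e"
    unfolding lat.form_def by (intro sum.cong refl) (simp add: tri_icomb_basis)
  finally show ?thesis .
qed

section \<open>Congruences in the ring of integers, and the ideal whose traces are divisible by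
  N\<close>

definition congr :: "int \<Rightarrow> 'a \<Rightarrow> 'a \<Rightarrow> bool" where
  "congr N x y \<longleftrightarrow> (\<exists>z\<in>OK. x - y = of_int N * z)"

lemma congrI: "z \<in> OK \<Longrightarrow> x = y + of_int N * z \<Longrightarrow> congr N x y"
  by (auto simp: congr_def)

lemma congrE:
  assumes "congr N x y"
  obtains z where "z \<in> OK" "x = y + of_int N * z"
  using assms unfolding congr_def by (metis add.commute diff_add_cancel)

lemma congr_refl: "congr N x x"
  by (rule congrI[of 0]) (auto intro: O_closed)

lemma congr_sym: "congr N x y \<Longrightarrow> congr N y x"
  by (elim congrE, rule_tac z = "- z" in congrI) (auto intro: O_closed)

lemma congr_trans [trans]: "congr N x y \<Longrightarrow> congr N y z \<Longrightarrow> congr N x z"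
  by (elim congrE, rule_tac z = "za + zaa" in congrI) (auto intro: O_closed simp: algebra_simps)

lemma congr_add: "congr N x y \<Longrightarrow> congr N u v \<Longrightarrow> congr N (x + u) (y + v)"
  by (elim congrE, rule_tac z = "z + za" in congrI) (auto intro: O_closed simp: algebra_simps)

lemma congr_mult_left: "congr N x y \<Longrightarrow> w \<in> OK \<Longrightarrow> congr N (w * x) (w * y)"
  by (elim congrE, rule_tac z = "w * z" in congrI) (auto intro: O_closed simp: algebra_simps)

lemma congr_mult: "congr N x y \<Longrightarrow> congr N u v \<Longrightarrow> x \<in> OK \<Longrightarrow> v \<in> OK \<Longrightarrow> congr N (x * u) (y * v)"
  using congr_trans[of N "x * u" "x * v" "y * v"] congr_mult_left[of N u v x] congr_mult_left[of N x y v]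
  by (simp add: mult.commute)

lemma congr_scale: "congr N x y \<Longrightarrow> congr N (of_int k * x) (of_int k * y)"
  by (intro congr_mult_left O_closed)

lemma congr_scale_mod: "congr N x y \<Longrightarrow> congr (k * N) (of_int k * x) (of_int k * y)"
  by (elim congrE, rule_tac z = z in congrI) (auto simp: algebra_simps)

lemma congr_minus: "congr N x y \<Longrightarrow> congr N (- x) (- y)"
  using congr_scale[of N x y "- 1"] by simp

lemma congr_diff: "congr N x y \<Longrightarrow> congr N u v \<Longrightarrow> congr N (x - u) (y - v)"
  using congr_add[of N x y "- u" "- v"] congr_minus[of N u v] by simp

lemma congr_int_coeff:
  assumes "N dvd k - l" "x \<in> OK"
  shows "congr N (of_int k * x) (of_int l * x)"
proof -
  obtain m where "k = l + N * m" using assms(1) by (metis add.commute diff_add_cancel dvdE)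
  then show ?thesis
    using assms(2) by (intro congrI[of "of_int m * x"]) (auto intro: O_closed simp: algebra_simps)
qed

lemma congr_dvd: "congr N x y \<Longrightarrow> M dvd N \<Longrightarrow> congr M x y"
  by (elim congrE dvdE, rule_tac z = "of_int k * z" in congrI) (auto intro: O_closed simp: algebra_simps)

lemma congr_icomb_iff:
  assumes "N \<noteq> 0"
  shows "congr N (icomb c) (icomb e) \<longleftrightarrow> (\<forall>i<n. N dvd c i - e i)"
proof
  assume "congr N (icomb c) (icomb e)"
  then obtain z where z: "z \<in> OK" "icomb c = icomb e + of_int N * z" by (rule congrE)
  have eq: "icomb c = icomb (\<lambda>i. 1 * e i + N * icoord z i)"
    unfolding icomb_lin icomb_icoord[OF z(1)] z(2) by simp
  have "c i = e i + N * icoord z i" if "i < n" for i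
    using icoord_icomb[OF that, of c] icoord_icomb[OF that, of "\<lambda>i. 1 * e i + N * icoord z i"] unfolding eq by simp
  then show "\<forall>i<n. N dvd c i - e i" by simp
next
  assume dvd: "\<forall>i<n. N dvd c i - e i"
  have "icomb c = icomb (\<lambda>i. 1 * e i + N * ((c i - e i) div N))"
    using dvd by (intro icomb_cong) simp
  then show "congr N (icomb c) (icomb e)"
    unfolding icomb_lin by (intro congrI[OF icomb_in, of _ _ _ "\<lambda>i. (c i - e i) div N"]) simp
qed

lemma congr_icomb_0: "N \<noteq> 0 \<Longrightarrow> congr N (icomb c) 0 \<longleftrightarrow> (\<forall>i<n. N dvd c i)"
  using congr_icomb_iff[of N c "\<lambda>_. 0"] by (simp add: icomb_def)

lemma congr_cancel:
  assumes "congr (k * N) (of_int k * x) (of_int k * y)" "k \<noteq> 0"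
  shows "congr N x y"
proof -
  obtain z where z: "z \<in> OK" "of_int k * x = of_int k * y + of_int (k * N) * z"
    using assms(1) by (rule congrE)
  then have "of_int k * x = of_int k * (y + of_int N * z)" by (simp add: algebra_simps)
  then have "x = y + of_int N * z" using assms(2) by simp
  then show ?thesis using z(1) by (intro congrI)
qed

text \<open>The ring of integers intersected with \<open>N\<close> times the inverse different,
  hence an ideal. For a prime \<open>N\<close> it is the preimage of the radical of the trace form
  modulo \<open>N\<close>.\<close>

definition tr_ker :: "int \<Rightarrow> 'a set" where
  "tr_ker N = {x \<in> OK. \<forall>y\<in>OK. N dvd tri (x * y)}"

lemma tr_kerD: "x \<in> tr_ker N \<Longrightarrow> x \<in> OK" "x \<in> tr_ker N \<Longrightarrow> y \<in> OK \<Longrightarrow> N dvd tri (x * y)"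
  "x \<in> tr_ker N \<Longrightarrow> N dvd tri x"
  using O_closed(2) by (auto simp: tr_ker_def dest!: bspec[of _ _ 1])

lemma tr_ker_mult: "x \<in> tr_ker N \<Longrightarrow> y \<in> OK \<Longrightarrow> x * y \<in> tr_ker N" "x \<in> tr_ker N \<Longrightarrow> y \<in> OK \<Longrightarrow> y * x \<in> tr_ker N"
  by (auto simp: tr_ker_def O_closed mult.assoc mult.commute[of y x])

lemma tr_ker_add: "x \<in> tr_ker N \<Longrightarrow> y \<in> tr_ker N \<Longrightarrow> x + y \<in> tr_ker N"
  by (auto simp: tr_ker_def O_closed distrib_right tri_add)

lemma tr_ker_mono: "x \<in> tr_ker N \<Longrightarrow> M dvd N \<Longrightarrow> x \<in> tr_ker M"
  by (auto simp: tr_ker_def intro: dvd_trans)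

lemma icomb_tr_ker: "icomb c \<in> tr_ker N \<longleftrightarrow> (\<forall>j<n. N dvd lat.dual c j)"
proof
  assume "icomb c \<in> tr_ker N"
  then show "\<forall>j<n. N dvd lat.dual c j" using tri_icomb_basis O_closed(9) tr_kerD(2) by metis
next
  assume dvd: "\<forall>j<n. N dvd lat.dual c j"
  have "N dvd tri (icomb c * y)" if y: "y \<in> OK" for y
    using lat.dvd_form[of N c "icoord y"] dvd tri_icomb_icomb[of c "icoord y"] by (simp add: icomb_icoord[OF y])
  then show "icomb c \<in> tr_ker N" by (simp add: tr_ker_def icomb_in)
qed

lemma half_tr_ker: "x \<in> OK \<Longrightarrow> of_int k * x \<in> tr_ker (k * N) \<Longrightarrow> k \<noteq> 0 \<Longrightarrow> x \<in> tr_ker N"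
  by (auto simp: tr_ker_def mult.assoc tri_scale O_closed)

lemma indep_congr:
  assumes "lat.spans_dual_kernel p r c" "p \<noteq> 0" "congr p (\<Sum>k<r. of_int (e k) * icomb (c k)) 0" "k < r"
  shows "p dvd e k"
proof -
  have "congr p (icomb (\<lambda>i. \<Sum>k<r. e k * c k i)) 0" using assms(3) by (simp add: icomb_sum)
  then have "\<forall>i<n. p dvd (\<Sum>k<r. e k * c k i)" using assms(2) by (simp add: congr_icomb_0)
  then show ?thesis using assms(1,4) indep_modD unfolding lat.spans_dual_kernel_def by blast
qed

lemma span_congr:
  assumes c: "lat.spans_dual_kernel p r c" and p: "p \<noteq> 0" and x: "x \<in> tr_ker p"
  obtains e where "congr p x (\<Sum>k<r. of_int (e k) * icomb (c k))"
proof -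
  have "\<forall>j<n. p dvd lat.dual (icoord x) j"
    using x icomb_tr_ker[of "icoord x"] by (simp add: icomb_icoord tr_kerD(1))
  then obtain e where "\<forall>i<n. p dvd icoord x i - (\<Sum>k<r. e k * c k i)"
    using c unfolding lat.spans_dual_kernel_def by blast
  then have "congr p (icomb (icoord x)) (icomb (\<lambda>i. \<Sum>k<r. e k * c k i))"
    using p by (simp add: congr_icomb_iff)
  then show ?thesis using that by (simp add: icomb_sum icomb_icoord tr_kerD(1)[OF x])
qed

lemma spans_in_tr_ker: "lat.spans_dual_kernel p r c \<Longrightarrow> k < r \<Longrightarrow> icomb (c k) \<in> tr_ker p"
  by (simp add: icomb_tr_ker lat.spans_dual_kernel_def)

text \<open>Multiplication by \<open>z\<close> factors modulo \<open>N\<close> through the span of the \<open>x\<^sub>k\<close>, so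
  its trace can be computed there.\<close>
lemma trace_factorization:
  assumes z: "z \<in> OK" and x: "\<And>k. k < r \<Longrightarrow> x k \<in> OK"
    and image: "\<And>y. y \<in> OK \<Longrightarrow> \<exists>e. congr N (z * y) (\<Sum>k<r. of_int (e k) * x k)"
  obtains t where "\<And>l. l < r \<Longrightarrow> congr N (z * x l) (\<Sum>k<r. of_int (t k l) * x k)"
    "N dvd tri z - (\<Sum>k<r. t k k)"
    "even N \<Longrightarrow> 2 * N dvd tri (z * z) - (\<Sum>k<r. \<Sum>l<r. t k l * t l k)"
proof -
  have "\<exists>e w. w \<in> OK \<and> z * a j = (\<Sum>k<r. of_int (e k) * x k) + of_int N * w" if j: "j < n" for j
  proof -
    obtain e where "congr N (z * a j) (\<Sum>k<r. of_int (e k) * x k)"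
      using image[OF O_closed(9)[OF j]] by blast
    then show ?thesis by (rule congrE) blast
  qed
  then obtain e w where ew: "\<And>j. j < n \<Longrightarrow> w j \<in> OK"
      "\<And>j. j < n \<Longrightarrow> z * a j = (\<Sum>k<r. of_int (e j k) * x k) + of_int N * w j" by metis
  \<comment> \<open>The matrix \<open>M\<close> of \<open>z\<close> is modulo \<open>N\<close> a
    product \<open>P\<close> of an \<open>n\<close> by \<open>r\<close> and an \<open>r\<close> by
    \<open>n\<close> matrix. The matrix \<open>t\<close> is the product in the opposite order, so it
    has the same trace, and so have the squares of \<open>P\<close> and \<open>t\<close>.\<close>
  define F where "F i k = icoord (x k) i" for i k
  define M where "M i j = icoord (z * a j) i" for i j
  define P where "P i j = (\<Sum>k<r. e j k * F i k)" for i j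
  define W where "W i j = icoord (w j) i" for i j
  have x_eq: "x k = (\<Sum>i<n. of_int (F i k) * a i)" if "k < r" for k
    using icomb_icoord[OF x[OF that]] by (simp add: icomb_def F_def)
  have M: "M i j = P i j + N * W i j" if ij: "i < n" "j < n" for i j
  proof -
    have "z * a j = icomb (\<lambda>i. 1 * P i j + N * W i j)"
      unfolding icomb_lin P_def icomb_sum W_def F_def ew(2)[OF ij(2)]
      using x by (simp add: icomb_icoord ew(1)[OF ij(2)])
    then show ?thesis using icoord_icomb[OF ij(1)] by (simp add: M_def)
  qed
  define t where "t k l = (\<Sum>j<n. F j l * e j k)" for k l
  have zx: "z * x l = (\<Sum>k<r. of_int (t k l) * x k) + of_int N * (\<Sum>j<n. of_int (F j l) * w j)"
    if l: "l < r" for l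
  proof -
    have "z * x l = (\<Sum>j<n. of_int (F j l) * (z * a j))"
      by (subst x_eq[OF l]) (simp add: sum_distrib_left mult.left_commute)
    also have "\<dots> = (\<Sum>j<n. \<Sum>k<r. of_int (F j l * e j k) * x k) + of_int N * (\<Sum>j<n. of_int (F j l) * w j)"
      by (simp add: ew(2) distrib_left sum.distrib sum_distrib_left mult.assoc mult.left_commute)
    also have "(\<Sum>j<n. \<Sum>k<r. of_int (F j l * e j k) * x k) = (\<Sum>k<r. of_int (t k l) * x k)"
      by (subst sum.swap) (simp add: t_def sum_distrib_right)
    finally show ?thesis .
  qed
  have "congr N (z * x l) (\<Sum>k<r. of_int (t k l) * x k)" if "l < r" for l
    by (rule congrI[OF _ zx[OF that]]) (auto intro!: O_sum O_closed ew)
  moreover have "N dvd tri z - (\<Sum>k<r. t k k)"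
  proof -
    have "tri z = (\<Sum>j<n. P j j) + N * (\<Sum>j<n. W j j)"
      using tri_coord[OF z] M by (simp add: M_def[symmetric] sum.distrib sum_distrib_left)
    moreover have "(\<Sum>j<n. P j j) = (\<Sum>k<r. t k k)"
      unfolding P_def t_def by (subst sum.swap) (simp add: mult.commute)
    ultimately show ?thesis by simp
  qed
  \<comment> \<open>Squaring \<open>P + N W\<close> produces two cross terms of equal trace,
    together divisible by \<open>2 * N\<close>; the last term is so because \<open>N\<close> is
    even. This gains a factor 2 over the modulus.\<close>
  moreover have "2 * N dvd tri (z * z) - (\<Sum>k<r. \<Sum>l<r. t k l * t l k)" if "even N"
  proof -
    have za: "z * a j = icomb (\<lambda>i. M i j)" if "j < n" for j
      unfolding M_def by (rule icomb_icoord[symmetric]) (use z that in \<open>auto intro: O_closed\<close>)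
    have "z * z * a j = icomb (\<lambda>i. \<Sum>k<n. M k j * M i k)" if "j < n" for j
    proof -
      have "z * z * a j = (\<Sum>k<n. of_int (M k j) * (z * a k))"
        by (subst mult.assoc, subst za[OF that]) (simp add: icomb_def sum_distrib_left mult.left_commute)
      also have "\<dots> = (\<Sum>k<n. of_int (M k j) * icomb (\<lambda>i. M i k))" by (simp add: za)
      finally show ?thesis by (simp add: icomb_sum)
    qed
    then have "tri (z * z) = (\<Sum>j<n. \<Sum>k<n. M k j * M j k)"
      using z by (simp add: tri_coord O_closed icoord_icomb)
    also have "\<dots> = (\<Sum>j<n. \<Sum>k<n. (P k j + N * W k j) * (P j k + N * W j k))"
      by (intro sum.cong refl) (simp add: M)
    also have "\<dots> = (\<Sum>j<n. \<Sum>k<n. P k j * P j k) + N * (\<Sum>j<n. \<Sum>k<n. W k j * P j k)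
        + N * (\<Sum>j<n. \<Sum>k<n. P k j * W j k) + N * N * (\<Sum>j<n. \<Sum>k<n. W k j * W j k)"
      by (simp add: sum.distrib sum_distrib_left algebra_simps)
    also have "(\<Sum>j<n. \<Sum>k<n. P k j * W j k) = (\<Sum>j<n. \<Sum>k<n. W k j * P j k)"
      by (subst sum.swap) (simp add: mult.commute)
    also have "(\<Sum>j<n. \<Sum>k<n. P k j * P j k) = (\<Sum>k<r. \<Sum>l<r. t k l * t l k)"
    proof -
      have "(\<Sum>j<n. \<Sum>k<n. P k j * P j k) = (\<Sum>j<n. \<Sum>i<n. \<Sum>k<r. \<Sum>l<r. (F i k * e i l) * (F j l * e j k))"
        unfolding P_def sum_product by (intro sum.cong refl) (simp add: mult_ac)
      also have "\<dots> = (\<Sum>k<r. \<Sum>l<r. \<Sum>j<n. \<Sum>i<n. (F i k * e i l) * (F j l * e j k))"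
      proof -
        have "(\<Sum>j<n. \<Sum>i<n. \<Sum>k<r. \<Sum>l<r. (F i k * e i l) * (F j l * e j k))
            = (\<Sum>j<n. \<Sum>k<r. \<Sum>i<n. \<Sum>l<r. (F i k * e i l) * (F j l * e j k))"
          by (intro sum.cong refl) (rule sum.swap)
        also have "\<dots> = (\<Sum>j<n. \<Sum>k<r. \<Sum>l<r. \<Sum>i<n. (F i k * e i l) * (F j l * e j k))"
          by (intro sum.cong refl) (rule sum.swap)
        also have "\<dots> = (\<Sum>k<r. \<Sum>j<n. \<Sum>l<r. \<Sum>i<n. (F i k * e i l) * (F j l * e j k))"
          by (rule sum.swap)
        also have "\<dots> = (\<Sum>k<r. \<Sum>l<r. \<Sum>j<n. \<Sum>i<n. (F i k * e i l) * (F j l * e j k))"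
          by (intro sum.cong refl) (rule sum.swap)
        finally show ?thesis .
      qed
      also have "\<dots> = (\<Sum>k<r. \<Sum>l<r. t k l * t l k)"
        unfolding t_def sum_product by (intro sum.cong refl) (simp add: mult_ac)
      finally show ?thesis .
    qed
    finally have "tri (z * z) - (\<Sum>k<r. \<Sum>l<r. t k l * t l k)
        = 2 * N * (\<Sum>j<n. \<Sum>k<n. W k j * P j k) + N * N * (\<Sum>j<n. \<Sum>k<n. W k j * W j k)"
      by (simp add: algebra_simps)
    moreover have "2 * N dvd N * N" using that by (simp add: mult_dvd_mono)
    ultimately show ?thesis by (simp add: dvd_add)
  qed
  ultimately show ?thesis using that by blast
qed

text \<open>Multiplication by \<open>x\<close> maps the whole ring to the line spanned by
  \<open>x\<close>, so the scalar by which \<open>x\<close> acts on that line is its trace modulo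
  \<open>p\<close>, and this vanishes.\<close>

lemma dual_kernel_line_square:
  assumes p: "p \<noteq> 0" and c: "lat.spans_dual_kernel p 1 (\<lambda>_. c)"
  shows "congr p ((icomb c)\<^sup>2) 0"
proof -
  let ?x = "icomb c"
  have x: "?x \<in> tr_ker p" using spans_in_tr_ker[OF c] by simp
  have image: "\<exists>e. congr p (?x * y) (\<Sum>k<(1::nat). of_int (e k) * ?x)" if "y \<in> OK" for y
    by (rule span_congr[OF c p tr_ker_mult(1)[OF x that]]) (rule exI)
  obtain t where t: "\<And>l::nat. l < 1 \<Longrightarrow> congr p (?x * ?x) (\<Sum>k<(1::nat). of_int (t k l) * ?x)"
    "p dvd tri ?x - (\<Sum>k<(1::nat). t k k)"
    using trace_factorization[of ?x 1 "\<lambda>_. ?x" p, OF icomb_in icomb_in image] by blast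
  have "p dvd t 0 0" using t(2) tr_kerD(3)[OF x] by (simp add: dvd_diff_right_iff)
  then have "congr p (of_int (t 0 0) * ?x) 0"
    using congr_int_coeff[of p "t 0 0" 0 ?x] icomb_in by simp
  then show ?thesis using congr_trans t(1)[of 0] by (simp add: power2_eq_square)
qed

text \<open>On the plane modulo 2 the matrix of \<open>z\<close> has even trace, so by
  Cayley-Hamilton \<open>z\<^sup>2\<close> acts as the determinant. The trace of the squared matrix
  is twice the determinant modulo 4 and agrees there with \<open>tri (z * z)\<close>, which
  therefore decides the parity.\<close>

lemma plane_square_action:
  assumes c: "lat.spans_dual_kernel 2 2 c" and z: "z \<in> tr_ker 2" and y: "y \<in> tr_ker 2"
  shows "4 dvd tri (z * z) \<Longrightarrow> congr 2 (z\<^sup>2 * y) 0"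
    and "\<not> 4 dvd tri (z * z) \<Longrightarrow> congr 2 (z\<^sup>2 * y) y"
proof -
  let ?x = "\<lambda>k. icomb (c k)"
  have zO: "z \<in> OK" using z by (rule tr_kerD)
  have image: "\<exists>e. congr 2 (z * y) (\<Sum>k<2. of_int (e k) * ?x k)" if "y \<in> OK" for y
    by (rule span_congr[OF c _ tr_ker_mult(1)[OF z that]]) (simp, rule exI)
  obtain t where t: "\<And>l. l < 2 \<Longrightarrow> congr 2 (z * ?x l) (\<Sum>k<2. of_int (t k l) * ?x k)"
    "2 dvd tri z - (\<Sum>k<2. t k k)"
    "even (2::int) \<Longrightarrow> 2 * 2 dvd tri (z * z) - (\<Sum>k<2. \<Sum>l<2. t k l * t l k)"
    using trace_factorization[of z 2 ?x 2, OF zO icomb_in image] by blast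
  have t0: "congr 2 (z * ?x 0) (of_int (t 0 0) * ?x 0 + of_int (t 1 0) * ?x 1)"
    and t1: "congr 2 (z * ?x 1) (of_int (t 0 1) * ?x 0 + of_int (t 1 1) * ?x 1)"
    using t(1)[of 0] t(1)[of 1] by (simp_all add: numeral_2_eq_2)
  have "2 dvd tri z" using z by (rule tr_kerD)
  then have tr: "2 dvd t 0 0 + t 1 1" using t(2) by (simp add: numeral_2_eq_2)
  have sq: "4 dvd tri (z * z) - (t 0 0 * t 0 0 + 2 * (t 0 1 * t 1 0) + t 1 1 * t 1 1)"
    using t(3) by (simp add: numeral_2_eq_2 algebra_simps)
  \<comment> \<open>Modulo 2 this is the determinant, since the two diagonal entries have the same
    parity.\<close>
  define D where "D = t 0 0 * t 0 0 + t 0 1 * t 1 0"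
  have D: "4 dvd tri (z * z) - 2 * D"
  proof -
    obtain h where h: "t 0 0 + t 1 1 = 2 * h" using tr unfolding dvd_def by blast
    have t11: "t 1 1 = 2 * h - t 0 0" using h by simp
    have "t 1 1 * t 1 1 - t 0 0 * t 0 0 = 4 * (h * h - h * t 0 0)" unfolding t11 by (simp add: algebra_simps)
    then have "4 dvd t 1 1 * t 1 1 - t 0 0 * t 0 0" by simp
    then have "4 dvd (tri (z * z) - (t 0 0 * t 0 0 + 2 * (t 0 1 * t 1 0) + t 1 1 * t 1 1))
        + (t 1 1 * t 1 1 - t 0 0 * t 0 0)" using sq by (rule dvd_add[rotated])
    then show ?thesis by (simp add: D_def algebra_simps)
  qed
  have x0: "?x 0 \<in> OK" "?x 1 \<in> OK" by (rule icomb_in)+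
  have z0: "congr 2 (z * (z * ?x 0)) (of_int D * ?x 0)"
  proof -
    have "congr 2 (z * (z * ?x 0)) (z * (of_int (t 0 0) * ?x 0 + of_int (t 1 0) * ?x 1))"
      by (rule congr_mult_left[OF t0 zO])
    also have "\<dots> = of_int (t 0 0) * (z * ?x 0) + of_int (t 1 0) * (z * ?x 1)" by (simp add: algebra_simps)
    also have "congr 2 \<dots> (of_int (t 0 0) * (of_int (t 0 0) * ?x 0 + of_int (t 1 0) * ?x 1)
        + of_int (t 1 0) * (of_int (t 0 1) * ?x 0 + of_int (t 1 1) * ?x 1))"
      by (intro congr_add congr_scale t0 t1)
    also have "\<dots> = of_int D * ?x 0 + of_int (t 1 0 * (t 0 0 + t 1 1)) * ?x 1"
      by (simp add: D_def algebra_simps)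
    also have "congr 2 \<dots> (of_int D * ?x 0 + of_int 0 * ?x 1)"
      using tr x0 by (intro congr_add congr_refl congr_int_coeff) auto
    finally show ?thesis by simp
  qed
  have z1: "congr 2 (z * (z * ?x 1)) (of_int D * ?x 1)"
  proof -
    have "congr 2 (z * (z * ?x 1)) (z * (of_int (t 0 1) * ?x 0 + of_int (t 1 1) * ?x 1))"
      by (rule congr_mult_left[OF t1 zO])
    also have "\<dots> = of_int (t 0 1) * (z * ?x 0) + of_int (t 1 1) * (z * ?x 1)" by (simp add: algebra_simps)
    also have "congr 2 \<dots> (of_int (t 0 1) * (of_int (t 0 0) * ?x 0 + of_int (t 1 0) * ?x 1)
        + of_int (t 1 1) * (of_int (t 0 1) * ?x 0 + of_int (t 1 1) * ?x 1))"
      by (intro congr_add congr_scale t0 t1)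
    also have "\<dots> = of_int (t 0 1 * (t 0 0 + t 1 1)) * ?x 0 + of_int (t 0 1 * t 1 0 + t 1 1 * t 1 1) * ?x 1"
      by (simp add: algebra_simps)
    also have "congr 2 \<dots> (of_int 0 * ?x 0 + of_int D * ?x 1)"
    proof (intro congr_add congr_int_coeff x0)
      have "t 0 1 * t 1 0 + t 1 1 * t 1 1 - D = (t 1 1 - t 0 0) * (t 0 0 + t 1 1)"
        by (simp add: D_def algebra_simps)
      then show "2 dvd t 0 1 * t 1 0 + t 1 1 * t 1 1 - D" using tr by simp
    qed (use tr in simp)
    finally show ?thesis by simp
  qed
  obtain e where "congr 2 y (\<Sum>k<2. of_int (e k) * ?x k)" using span_congr[OF c _ y] by auto
  then have e: "congr 2 y (of_int (e 0) * ?x 0 + of_int (e 1) * ?x 1)" by (simp add: numeral_2_eq_2)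
  have zz: "congr 2 (z\<^sup>2 * y) (of_int D * y)"
  proof -
    have "congr 2 (z\<^sup>2 * y) (z\<^sup>2 * (of_int (e 0) * ?x 0 + of_int (e 1) * ?x 1))"
      using e zO by (intro congr_mult_left O_closed)
    also have "\<dots> = of_int (e 0) * (z * (z * ?x 0)) + of_int (e 1) * (z * (z * ?x 1))"
      by (simp add: algebra_simps power2_eq_square)
    also have "congr 2 \<dots> (of_int (e 0) * (of_int D * ?x 0) + of_int (e 1) * (of_int D * ?x 1))"
      by (intro congr_add congr_scale z0 z1)
    also have "\<dots> = of_int D * (of_int (e 0) * ?x 0 + of_int (e 1) * ?x 1)" by (simp add: algebra_simps)
    also have "congr 2 \<dots> (of_int D * y)" by (rule congr_scale[OF congr_sym[OF e]])
    finally show ?thesis .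
  qed
  have yO: "y \<in> OK" using y by (rule tr_kerD)
  show "congr 2 (z\<^sup>2 * y) 0" if "4 dvd tri (z * z)"
  proof -
    have "2 dvd D - 0" using D that by presburger
    from congr_trans[OF zz congr_int_coeff[OF this yO]] show ?thesis by simp
  qed
  show "congr 2 (z\<^sup>2 * y) y" if "\<not> 4 dvd tri (z * z)"
  proof -
    have "2 dvd tri (z * z)" using z zO by (rule tr_kerD(2))
    then have "2 dvd D - 1" using D that by presburger
    from congr_trans[OF zz congr_int_coeff[OF this yO]] show ?thesis by simp
  qed
qed

end


section \<open>The radical at the prime 2\<close>

text \<open>The assumption is that a symmetric matrix, given by its upper triangle, has even
  determinant; the kernel vector over the field with two elements is found by checking all
  parities.\<close>

lemma symmetric_3x3_kernel_mod_2:
  fixes b :: "nat \<Rightarrow> nat \<Rightarrow> int"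
  assumes "even (b 0 0 * b 1 1 * b 2 2 + 2 * (b 0 1 * b 1 2 * b 0 2)
    - b 0 0 * (b 1 2)\<^sup>2 - b 1 1 * (b 0 2)\<^sup>2 - b 2 2 * (b 0 1)\<^sup>2)"
  obtains e :: "nat \<Rightarrow> int" where "odd (e 0) \<or> odd (e 1) \<or> odd (e 2)"
    "even (e 0 * b 0 0 + e 1 * b 0 1 + e 2 * b 0 2)"
    "even (e 0 * b 0 1 + e 1 * b 1 1 + e 2 * b 1 2)"
    "even (e 0 * b 0 2 + e 1 * b 1 2 + e 2 * b 2 2)"
proof -
  have "\<exists>p q r. (p \<or> q \<or> r) \<and>
      even (of_bool p * b 0 0 + of_bool q * b 0 1 + of_bool r * b 0 2) \<and>
      even (of_bool p * b 0 1 + of_bool q * b 1 1 + of_bool r * b 1 2) \<and>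
      even (of_bool p * b 0 2 + of_bool q * b 1 2 + of_bool r * b 2 2)"
    using assms unfolding ex_bool_eq
    by (cases "even (b 0 0)"; cases "even (b 0 1)"; cases "even (b 0 2)";
        cases "even (b 1 1)"; cases "even (b 1 2)"; cases "even (b 2 2)") simp_all
  then obtain p q r where pqr: "p \<or> q \<or> r"
      "even (of_bool p * b 0 0 + of_bool q * b 0 1 + of_bool r * b 0 2)"
      "even (of_bool p * b 0 1 + of_bool q * b 1 1 + of_bool r * b 1 2)"
      "even (of_bool p * b 0 2 + of_bool q * b 1 2 + of_bool r * b 2 2)" by blast
  define e :: "nat \<Rightarrow> int" where "e = (\<lambda>k. if k = 0 then of_bool p else if k = 1 then of_bool q else of_bool r)"
  have "e 0 = of_bool p" "e 1 = of_bool q" "e 2 = of_bool r" by (simp_all add: e_def)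
  then show ?thesis using that[of e] pqr by (metis odd_one of_bool_eq(2))
qed

context integral_field
begin

lemma O_numeral: "numeral k \<in> OK"
  using O_closed(7)[of "numeral k"] by simp

lemma tri_numeral: "x \<in> OK \<Longrightarrow> tri (numeral k * x) = numeral k * tri x"
  using tri_scale[of x "numeral k"] by simp

text \<open>\<open>x / 2\<close> satisfies a monic quadratic equation with integral coefficients,
  and the ring contains all integral elements of \<open>K\<close>.\<close>

lemma half_integral:
  assumes x: "x \<in> OK" and sq: "congr 4 (x\<^sup>2) (of_int (2 * k) * x)"
  shows "congr 2 x 0"
proof -
  obtain z where z: "z \<in> OK" "x\<^sup>2 = of_int (2 * k) * x + of_int 4 * z" using sq by (rule congrE)
  have "(x / 2)\<^sup>2 = of_int k * (x / 2) + z"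
    using z(2) by (simp add: power_divide)
  from algebraic_int_quadratic[OF this] have "algebraic_int (x / 2)" using z(1) by (simp add: O_iff)
  moreover have "x / 2 \<in> K" using x K_closed(11)[of 2] by (auto intro!: K_closed simp: O_iff)
  ultimately have "x / 2 \<in> OK" by (simp add: O_iff)
  then show ?thesis by (rule congrI) simp
qed

text \<open>The square of the trace minus the trace of the square is twice the sum of the
  \<open>s i x * s j x\<close> over pairs. Each of these products is divisible by 2 among the
  algebraic integers, because its square is divisible by 4.\<close>

lemma tri_square_even:
  assumes x: "x \<in> OK" and sq: "congr 2 (x\<^sup>2) 0" and tr: "2 dvd tri x"
  shows "4 dvd tri (x\<^sup>2)"
proof -
  obtain y where y: "y \<in> OK" "x\<^sup>2 = 2 * y" using sq by (auto elim: congrE)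
  define E where "E = (\<Sum>j<n. \<Sum>i<j. s i x * s j x / 2)"
  have "algebraic_int (s i x * s j x / 2)" if "i < n" "j < n" for i j
  proof -
    have "(s i x)\<^sup>2 = 2 * s i y" if "i < n" for i
      using arg_cong[OF y(2), of "s i"] s_simps[OF that] x y(1) K_closed(11)[of 2]
      by (simp add: O_in_K) (metis of_int_numeral s_simps(9)[OF that])
    then have "(s i x * s j x / 2) ^ 2 = s i y * s j y"
      using that by (simp add: power_mult_distrib power_divide)
    moreover have "algebraic_int (s i y * s j y)"
      using that y(1) by (intro algebraic_int_times_plus) (auto simp: field_hom_on_algebraic_int[OF K s_hom] O_iff)
    ultimately have "algebraic_int ((s i x * s j x / 2) ^ 2)" by simp
    then show ?thesis by (rule algebraic_int_of_power) simp
  qed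
  then have int_E: "algebraic_int E"
    unfolding E_def by (intro algebraic_int_sum) auto
  have square: "(\<Sum>j<m. f j)\<^sup>2 = (\<Sum>j<m. (f j)\<^sup>2) + 4 * (\<Sum>j<m. \<Sum>i<j. f i * f j / 2)"
    for m and f :: "nat \<Rightarrow> complex"
  proof (induction m)
    case (Suc m)
    have "2 * (\<Sum>i<m. f i * f m / 2) = (\<Sum>i<m. f i) * f m"
      by (simp add: sum_distrib_right sum_distrib_left)
    then show ?case using Suc by (simp add: power2_sum distrib_left mult.commute)
  qed simp
  have tr_C: "(of_int (tri z) :: complex) = (\<Sum>i<n. s i z)" if "z \<in> OK" for z
    using s_trace[OF O_in_K[OF that]] tri[OF that] by (metis of_rat_of_int_eq)
  have "of_int ((tri x)\<^sup>2) = (\<Sum>j<n. s j x)\<^sup>2" using tr_C[OF x] by simp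
  also have "\<dots> = (\<Sum>j<n. (s j x)\<^sup>2) + 4 * E" unfolding square E_def ..
  also have "(\<Sum>j<n. (s j x)\<^sup>2) = of_int (tri (x\<^sup>2))"
    using x by (simp add: tr_C O_closed s_simps O_in_K)
  finally have "of_int ((tri x)\<^sup>2 - tri (x\<^sup>2)) = 4 * E" by simp
  then obtain k where k: "(tri x)\<^sup>2 - tri (x\<^sup>2) = k" "of_int k = 4 * E" by blast
  then have "E = of_int k / 4" by simp
  also have "\<dots> \<in> \<rat>" by simp
  finally obtain m where "E = of_int m"
    using rational_algebraic_int_is_int[OF int_E] by (auto elim: Ints_cases)
  then have "(of_int k :: complex) = of_int (4 * m)" using k(2) by simp
  then have "(tri x)\<^sup>2 - tri (x\<^sup>2) = 4 * m" unfolding k(1) by (simp only: of_int_eq_iff)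
  moreover have "2 ^ 2 dvd (tri x)\<^sup>2" using tr by (rule dvd_power_same)
  ultimately show ?thesis by (simp add: power2_eq_square) presburger
qed

text \<open>On the radical \<open>y\<^sup>2\<close> acts as the identity and
  \<open>z\<^sup>2\<close> as zero; the product of the two squares is evaluated in both
  ways.\<close>

lemma plane_isotropic_square:
  assumes c: "lat.spans_dual_kernel 2 2 c" and z: "z \<in> tr_ker 2" and y: "y \<in> tr_ker 2"
    and zz: "4 dvd tri (z * z)" and yy: "\<not> 4 dvd tri (y * y)"
  shows "congr 2 (z\<^sup>2) 0"
proof -
  have sq: "z\<^sup>2 \<in> tr_ker 2" "y\<^sup>2 \<in> tr_ker 2"
    using z y by (auto simp: power2_eq_square intro: tr_ker_mult tr_kerD)
  have "congr 2 (z\<^sup>2) (y\<^sup>2 * z\<^sup>2)"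
    by (rule congr_sym[OF plane_square_action(2)[OF c y sq(1) yy]])
  also have "\<dots> = z\<^sup>2 * y\<^sup>2" by simp
  also have "congr 2 \<dots> 0" by (rule plane_square_action(1)[OF c z sq(2) zz])
  finally show ?thesis .
qed

lemma plane_cube:
  assumes c: "lat.spans_dual_kernel 2 2 c" and z: "z \<in> tr_ker 2" and zz: "4 dvd tri (z * z)"
  shows "congr 2 (z ^ 3) 0"
  using plane_square_action(1)[OF c z z zz] by (simp add: power3_eq_cube power2_eq_square)

lemma halve_square:
  assumes x: "x \<in> tr_ker 4" and sq: "congr 2 (x\<^sup>2) 0"
  obtains u where "u \<in> tr_ker 2" "x\<^sup>2 = 2 * u"
proof -
  obtain u where u: "u \<in> OK" "x\<^sup>2 = 2 * u" using sq by (auto elim: congrE)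
  have "of_int 2 * u \<in> tr_ker (2 * 2)"
    using tr_ker_mult(1)[OF x tr_kerD(1)[OF x]] u(2) by (simp add: power2_eq_square)
  then have "u \<in> tr_ker 2" by (rule half_tr_ker[OF u(1)]) simp
  then show ?thesis using that u(2) by blast
qed

text \<open>Half of \<open>x\<^sup>2\<close> is again in the radical, hence a multiple of
  \<open>x\<close> modulo 2. This makes \<open>x / 2\<close> integral, although \<open>x\<close> is
  nonzero modulo 2.\<close>

lemma no_quartic_line:
  assumes c: "lat.spans_dual_kernel 2 1 (\<lambda>_. c)" and x4: "icomb c \<in> tr_ker 4"
  shows False
proof -
  let ?x = "icomb c"
  have two: "(2::int) \<noteq> 0" by simp
  obtain u where u: "u \<in> tr_ker 2" "?x\<^sup>2 = 2 * u"
    using halve_square[OF x4 dual_kernel_line_square[OF two c]] by blast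
  obtain e where "congr 2 u (\<Sum>k<(1::nat). of_int (e k) * ?x)"
    using span_congr[OF c two u(1)] by blast
  then have "congr 2 u (of_int (e 0) * ?x)" by simp
  then have "congr (2 * 2) (of_int 2 * u) (of_int 2 * (of_int (e 0) * ?x))" by (rule congr_scale_mod)
  then have "congr 4 (?x\<^sup>2) (of_int (2 * e 0) * ?x)" by (simp add: u(2) mult.assoc)
  then have "congr 2 ?x 0" by (rule half_integral[OF icomb_in])
  then have "congr 2 (\<Sum>k<(1::nat). of_int ((\<lambda>_. 1) k) * ?x) 0" by simp
  then have "(2::int) dvd 1" by (rule indep_congr[OF c two]) simp
  then show False by simp
qed

text \<open>Modulo 4, multiplication by \<open>x\<close> factors through the span of
  \<open>e\<close> and \<open>x\<close>. There it sends \<open>e\<close> to \<open>x\<close> and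
  \<open>x\<close> to \<open>2 * l * e + 2 * b * x\<close>, so its trace is \<open>2 * b\<close>;
  but \<open>tri x\<close> is divisible by 4.\<close>

lemma plane_idempotent_trace:
  assumes e: "e \<in> OK" "congr 4 (e * e) e" and x: "x \<in> tr_ker 4" and ex: "congr 4 (e * x) x"
    and sq: "congr 4 (x * x) (of_int (2 * l) * e + of_int (2 * b) * x)"
    and span: "\<And>w. w \<in> tr_ker 2 \<Longrightarrow> \<exists>A B. congr 2 w (of_int A * e + of_int B * x)"
    and indep: "\<And>A B. congr 2 (of_int A * e + of_int B * x) 0 \<Longrightarrow> 2 dvd A \<and> 2 dvd B"
    and e2: "e \<in> tr_ker 2"
  shows "2 dvd b"
proof -
  have xO: "x \<in> OK" using x by (rule tr_kerD)
  have x2: "x \<in> tr_ker 2" by (rule tr_ker_mono[OF x]) simp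
  define v where "v = (\<lambda>k::nat. if k = 0 then e else x)"
  have vO: "v k \<in> OK" for k using e(1) xO by (simp add: v_def)
  have image: "\<exists>f. congr 4 (x * y) (\<Sum>k<2. of_int (f k) * v k)" if y: "y \<in> OK" for y
  proof -
    obtain A B where AB: "congr 2 (x * y) (of_int A * e + of_int B * x)"
      using span[OF tr_ker_mult(1)[OF x2 y]] by blast
    obtain g where g: "g \<in> OK" "x * y = (of_int A * e + of_int B * x) + of_int 2 * g"
      using AB by (rule congrE)
    obtain A' B' where AB': "congr 2 (e * g) (of_int A' * e + of_int B' * x)"
      using span[OF tr_ker_mult(1)[OF e2 g(1)]] by blast
    \<comment> \<open>The error \<open>2 * g\<close> of the expansion modulo 2 need not come from
      the radical. Multiplication by \<open>e\<close>, which fixes \<open>x\<close> modulo 4, brings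
      \<open>g\<close> into it.\<close>
    have "congr 4 (x * y) ((e * x) * y)"
      using congr_mult_left[OF congr_sym[OF ex] y] by (simp add: mult_ac)
    also have "\<dots> = of_int A * (e * e) + of_int B * (e * x) + of_int 2 * (e * g)"
      by (subst mult.assoc, subst g(2)) (simp add: algebra_simps)
    also have "congr 4 \<dots> (of_int A * e + of_int B * x + of_int 2 * (of_int A' * e + of_int B' * x))"
      by (rule congr_add[OF congr_add[OF congr_scale[OF e(2)] congr_scale[OF ex]]])
        (use congr_scale_mod[OF AB', of 2] in simp)
    also have "\<dots> = (\<Sum>k<2. of_int ((\<lambda>k. if k = 0 then A + 2 * A' else B + 2 * B') k) * v k)"
      by (simp add: numeral_2_eq_2 v_def algebra_simps)
    finally show ?thesis by (rule exI[of _ "\<lambda>k. if k = 0 then A + 2 * A' else B + 2 * B'"])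
  qed
  obtain t where t: "\<And>l. l < 2 \<Longrightarrow> congr 4 (x * v l) (\<Sum>k<2. of_int (t k l) * v k)"
    "4 dvd tri x - (\<Sum>k<2. t k k)"
    using trace_factorization[of x 2 v 4, OF xO vO image] by blast
  have t0: "congr 4 (x * e) (of_int (t 0 0) * e + of_int (t 1 0) * x)"
    and t1: "congr 4 (x * x) (of_int (t 0 1) * e + of_int (t 1 1) * x)"
    using t(1)[of 0] t(1)[of 1] by (simp_all add: numeral_2_eq_2 v_def)
  have indep4: "4 dvd A \<and> 4 dvd B" if AB: "congr 4 (of_int A * e + of_int B * x) 0" for A B
  proof -
    have "congr 2 (of_int A * e + of_int B * x) 0" using AB by (rule congr_dvd) simp
    then obtain A' B' where A': "A = 2 * A'" "B = 2 * B'" using indep unfolding dvd_def by blast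
    then have "congr (2 * 2) (of_int 2 * (of_int A' * e + of_int B' * x)) (of_int 2 * 0)"
      using AB by (simp add: algebra_simps)
    then have "congr 2 (of_int A' * e + of_int B' * x) 0" by (rule congr_cancel) simp
    then show ?thesis using indep A' by fastforce
  qed
  have "congr 4 (of_int (t 0 0) * e + of_int (t 1 0) * x - x * e) 0"
    using congr_diff[OF congr_sym[OF t0] congr_refl[of 4 "x * e"]] by simp
  then have "congr 4 (of_int (t 0 0) * e + of_int (t 1 0) * x - x * e + (e * x - x)) (0 + 0)"
    using congr_diff[OF ex congr_refl[of 4 x]] by (intro congr_add) simp_all
  then have "congr 4 (of_int (t 0 0) * e + of_int (t 1 0 - 1) * x) 0" by (simp add: algebra_simps)
  then have t00: "4 dvd t 0 0" using indep4 by blast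
  have "congr 4 (of_int (t 0 1) * e + of_int (t 1 1) * x - (of_int (2 * l) * e + of_int (2 * b) * x)) (x * x - x * x)"
    by (rule congr_diff[OF congr_sym[OF t1] congr_sym[OF sq]])
  then have "congr 4 (of_int (t 0 1 - 2 * l) * e + of_int (t 1 1 - 2 * b) * x) 0" by (simp add: algebra_simps)
  then have t11: "4 dvd t 1 1 - 2 * b" using indep4 by blast
  have "4 dvd tri x" using x by (rule tr_kerD)
  then have "4 dvd t 0 0 + t 1 1" using t(2) by (simp add: numeral_2_eq_2 dvd_diff_right_iff)
  then show ?thesis using t00 t11 by presburger
qed

text \<open>As \<open>u = y\<^sup>2\<close> acts as the identity on the radical, \<open>u\<close>
  and \<open>x\<close> form a basis of it. Half of \<open>x\<^sup>2\<close> is written as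
  \<open>l * u + b * x\<close> modulo 2, and the claim becomes that \<open>l\<close> is odd and
  \<open>b\<close> even.\<close>

lemma plane_quartic_square:
  assumes c: "lat.spans_dual_kernel 2 2 c" and x4: "icomb (c 0) \<in> tr_ker 4"
    and yy: "\<not> 4 dvd tri (icomb (c 1) * icomb (c 1))"
  shows "congr 4 ((icomb (c 0))\<^sup>2) (2 * (icomb (c 1))\<^sup>2)"
proof -
  define x y where "x = icomb (c 0)" and "y = icomb (c 1)"
  define u where "u = y\<^sup>2"
  note indep = indep_congr[OF c] and span = span_congr[OF c]
  have xO: "x \<in> OK" and yO: "y \<in> OK" by (auto simp: x_def y_def icomb_in)
  have x2: "x \<in> tr_ker 2" and y2: "y \<in> tr_ker 2"
    using spans_in_tr_ker[OF c] by (auto simp: x_def y_def)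
  have uO: "u \<in> OK" using yO by (simp add: u_def O_closed)
  have u2: "u \<in> tr_ker 2" using tr_ker_mult(1)[OF y2 yO] by (simp add: u_def power2_eq_square)
  have xx: "4 dvd tri (x * x)" using x4 xO by (auto simp: x_def intro: tr_kerD)
  have yy: "\<not> 4 dvd tri (y * y)" using yy by (simp add: y_def)
  have uw: "congr 2 (u * w) w" if "w \<in> tr_ker 2" for w
    unfolding u_def by (rule plane_square_action(2)[OF c y2 that yy])
  have xsq: "congr 2 (x\<^sup>2) 0" by (rule plane_isotropic_square[OF c x2 y2 xx yy])
  obtain h where h: "h \<in> tr_ker 2" "x\<^sup>2 = 2 * h" using halve_square[OF _ xsq] x4 x_def by blast
  have indep_xy: "2 dvd A \<and> 2 dvd B" if "congr 2 (of_int A * x + of_int B * y) 0" for A B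
  proof -
    have AB: "congr 2 (\<Sum>k<2. of_int ((\<lambda>k. if k = 0 then A else B) k) * icomb (c k)) 0"
      using that by (simp add: numeral_2_eq_2 x_def y_def)
    show ?thesis using indep[OF _ AB, of 0] indep[OF _ AB, of 1] by simp
  qed
  obtain f where "congr 2 u (\<Sum>k<2. of_int (f k) * icomb (c k))" using span[OF _ u2] by auto
  then have f: "congr 2 u (of_int (f 0) * x + of_int (f 1) * y)" by (simp add: numeral_2_eq_2 x_def y_def)
  \<comment> \<open>Otherwise \<open>u\<close> is a multiple of \<open>x\<close> modulo 2 and
    \<open>u * u\<close> vanishes there, although \<open>u\<close> acts as the identity.\<close>
  have f1: "odd (f 1)"
  proof
    assume "even (f 1)"
    then have "congr 2 (of_int (f 1) * y) (of_int 0 * y)" by (intro congr_int_coeff yO) simp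
    then have "congr 2 (of_int (f 0) * x + of_int (f 1) * y) (of_int (f 0) * x + 0)"
      by (intro congr_add congr_refl) simp
    then have ux: "congr 2 u (of_int (f 0) * x)" using congr_trans[OF f] by simp
    have "congr 2 (u * u) ((of_int (f 0) * x) * (of_int (f 0) * x))"
      by (rule congr_mult[OF ux ux uO]) (intro O_closed xO)
    also have "\<dots> = (of_int (f 0))\<^sup>2 * x\<^sup>2" by (simp add: power2_eq_square algebra_simps)
    also have "congr 2 \<dots> ((of_int (f 0))\<^sup>2 * 0)" by (intro congr_mult_left xsq O_closed)
    finally have "congr 2 (u * u) 0" by simp
    then have "congr 2 u 0" using congr_trans[OF congr_sym[OF uw[OF u2]]] by blast
    then have "congr 2 (y * u) (y * 0)" by (rule congr_mult_left) (rule yO)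
    then have "congr 2 (u * y) 0" by (simp add: mult.commute)
    then have "congr 2 y 0" using congr_trans[OF congr_sym[OF uw[OF y2]]] by blast
    then have "congr 2 (of_int 0 * x + of_int 1 * y) 0" by simp
    then show False using indep_xy[of 0 1] by simp
  qed
  have yu: "congr 2 y (u + of_int (f 0) * x)"
  proof -
    have "congr 2 (of_int (f 1) * y) (of_int 1 * y)" using f1 by (intro congr_int_coeff yO) simp
    then have "congr 2 (of_int (f 0) * x + of_int (f 1) * y) (of_int (f 0) * x + y)"
      by (intro congr_add congr_refl) simp
    then have "congr 2 u (of_int (f 0) * x + y)" by (rule congr_trans[OF f])
    then have "congr 2 (u + of_int (f 0) * x) (of_int (f 0) * x + y + of_int (f 0) * x)"
      by (intro congr_add congr_refl)
    also have "\<dots> = y + of_int (2 * f 0) * x" by (simp add: algebra_simps)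
    also have "congr 2 \<dots> (y + of_int 0 * x)" by (intro congr_add congr_refl congr_int_coeff xO) simp
    finally show ?thesis by (simp add: congr_sym)
  qed
  have span_u: "\<exists>A B. congr 2 w (of_int A * u + of_int B * x)" if w: "w \<in> tr_ker 2" for w
  proof -
    obtain g where "congr 2 w (\<Sum>k<2. of_int (g k) * icomb (c k))" using span[OF _ w] by auto
    then have "congr 2 w (of_int (g 0) * x + of_int (g 1) * y)" by (simp add: numeral_2_eq_2 x_def y_def)
    also have "congr 2 \<dots> (of_int (g 0) * x + of_int (g 1) * (u + of_int (f 0) * x))"
      by (intro congr_add congr_refl congr_scale yu)
    also have "\<dots> = of_int (g 1) * u + of_int (g 0 + g 1 * f 0) * x" by (simp add: algebra_simps)
    finally show ?thesis by blast
  qed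
  have indep_u: "2 dvd A \<and> 2 dvd B" if AB: "congr 2 (of_int A * u + of_int B * x) 0" for A B
  proof -
    have "congr 2 (of_int A * (of_int (f 0) * x + of_int (f 1) * y) + of_int B * x) (of_int A * u + of_int B * x)"
      by (intro congr_add congr_refl congr_scale congr_sym[OF f])
    then have "congr 2 (of_int (A * f 0 + B) * x + of_int (A * f 1) * y) 0"
      using congr_trans[OF _ AB] by (simp add: algebra_simps)
    then have "2 dvd A * f 0 + B \<and> 2 dvd A * f 1" by (rule indep_xy)
    then show ?thesis using f1 by auto
  qed
  obtain l b where ab: "congr 2 h (of_int l * u + of_int b * x)" using span_u[OF h(1)] by blast
  have "congr (2 * 2) (of_int 2 * h) (of_int 2 * (of_int l * u + of_int b * x))"
    by (rule congr_scale_mod[OF ab])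
  then have sq: "congr 4 (x\<^sup>2) (of_int (2 * l) * u + of_int (2 * b) * x)"
    by (simp add: h(2) algebra_simps)
  have x_nz: "\<not> congr 2 x 0" using indep_xy[of 1 0] by auto
  \<comment> \<open>For even \<open>l\<close> the element \<open>x / 2\<close> would be
    integral.\<close>
  have l: "odd l"
  proof
    assume "even l"
    then have "congr 4 (of_int (2 * l) * u) (of_int 0 * u)" by (intro congr_int_coeff uO) presburger
    then have "congr 4 (of_int (2 * l) * u + of_int (2 * b) * x) (0 + of_int (2 * b) * x)"
      by (intro congr_add congr_refl) simp
    then have "congr 4 (x\<^sup>2) (of_int (2 * b) * x)" using congr_trans[OF sq] by simp
    then show False using half_integral[OF xO] x_nz by blast
  qed
  \<comment> \<open>Squaring lifts the idempotent \<open>u\<close> modulo 2 to an idempotent modulo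
    4. In the same way \<open>x\<close> is replaced by \<open>z\<close>, congruent to it modulo 2
    and fixed by \<open>e\<close> modulo 4.\<close>
  define e where "e = u * u"
  have eO: "e \<in> OK" using uO by (simp add: e_def O_closed)
  have eu: "congr 2 e u" unfolding e_def by (rule uw[OF u2])
  have e_idem: "congr 4 (e * e) e"
  proof -
    obtain k where k: "k \<in> OK" "e = u + of_int 2 * k" using eu by (rule congrE)
    show ?thesis
    proof (rule congrI)
      have "e * e = u * u + of_int 4 * (u * k + k * k)" by (simp add: k(2) algebra_simps)
      then show "e * e = e + of_int 4 * (u * k + k * k)" by (simp add: e_def)
    qed (use uO k(1) in \<open>auto intro: O_closed\<close>)
  qed
  define z where "z = e * x"
  have z4: "z \<in> tr_ker 4" unfolding z_def using x4 eO by (auto simp: x_def intro: tr_ker_mult)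
  have zx: "congr 2 z x"
  proof -
    have "congr 2 z (u * x)" unfolding z_def using congr_mult_left[OF eu xO] by (simp add: mult.commute)
    also have "congr 2 \<dots> x" by (rule uw[OF x2])
    finally show ?thesis .
  qed
  have trans_uz: "congr 2 (of_int A * e + of_int B * z) (of_int A * u + of_int B * x)" for A B
    by (intro congr_add congr_scale eu zx)
  have "2 dvd b"
  proof (rule plane_idempotent_trace[OF eO e_idem z4, where l = l])
    show ez: "congr 4 (e * z) z"
      unfolding z_def using congr_mult_left[OF e_idem xO] by (simp add: mult_ac)
    have e_lin: "congr 4 (of_int (2 * k) * (e * u)) (of_int (2 * k) * e)" for k
    proof -
      have "congr 2 (e * u) (e * e)" by (rule congr_mult_left[OF congr_sym[OF eu] eO])
      also have "congr 2 \<dots> e" using e_idem by (rule congr_dvd) simp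
      finally have "congr (2 * 2) (of_int 2 * (of_int k * (e * u))) (of_int 2 * (of_int k * e))"
        by (intro congr_scale_mod congr_scale)
      then show ?thesis by (simp add: mult.assoc)
    qed
    have "congr 4 (z * z) (e * x\<^sup>2)"
      using congr_mult_left[OF e_idem, of "x\<^sup>2"] xO
      by (simp add: z_def power2_eq_square mult_ac O_closed)
    also have "congr 4 \<dots> (e * (of_int (2 * l) * u + of_int (2 * b) * x))"
      by (rule congr_mult_left[OF sq eO])
    also have "\<dots> = of_int (2 * l) * (e * u) + of_int (2 * b) * z" by (simp add: z_def algebra_simps)
    also have "congr 4 \<dots> (of_int (2 * l) * e + of_int (2 * b) * z)"
      by (intro congr_add congr_refl e_lin)
    finally show "congr 4 (z * z) (of_int (2 * l) * e + of_int (2 * b) * z)" .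
    show "\<exists>A B. congr 2 w (of_int A * e + of_int B * z)" if "w \<in> tr_ker 2" for w
      using span_u[OF that] congr_trans[OF _ congr_sym[OF trans_uz]] by blast
    show "2 dvd A \<and> 2 dvd B" if "congr 2 (of_int A * e + of_int B * z) 0" for A B
      using indep_u congr_trans[OF congr_sym[OF trans_uz] that] by blast
    show "e \<in> tr_ker 2" unfolding e_def by (rule tr_ker_mult(1)[OF u2 uO])
  qed
  have "congr 4 (of_int (2 * l) * u + of_int (2 * b) * x) (of_int 2 * u + of_int 0 * x)"
    using l \<open>2 dvd b\<close> by (intro congr_add congr_int_coeff uO xO) presburger+
  then have "congr 4 (x\<^sup>2) (of_int 2 * u + of_int 0 * x)" by (rule congr_trans[OF sq])
  then show ?thesis by (simp add: x_def y_def u_def)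
qed

text \<open>The dual basis of the three basis vectors modulo 2 is given by the adjugate \<open>P\<close> of their
  Gram matrix, and the trace of multiplication by an element of the kernel vanishes modulo 2; so the
  Casimir element \<open>\<Sum> P\<^sub>k\<^sub>l x\<^sub>k x\<^sub>l\<close> vanishes modulo 2. It is the square of \<open>w = \<Sum> P\<^sub>k\<^sub>k x\<^sub>k\<close>.\<close>
lemma no_nondegenerate_space:
  assumes c: "lat.spans_dual_kernel 2 3 c" and nd: "lat.kernel_form_nondegenerate"
  shows False
proof -
  define x where "x k = icomb (c k)" for k
  have xO: "x k \<in> OK" for k by (simp add: x_def icomb_in)
  have x2: "x k \<in> tr_ker 2" if "k < 3" for k using spans_in_tr_ker[OF c that] by (simp add: x_def)
  have par: "even m" if "4 dvd T" "T = 2 * m + 4 * k" for T m k :: int using that by presburger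
  have four: "4 dvd 2 * m" if "even m" for m :: int using that by presburger
  \<comment> \<open>The halved Gram matrix of the three vectors. Below, \<open>d\<close> is its
    determinant and \<open>P\<close> its adjugate.\<close>
  define b where "b i j = tri (x i * x j) div 2" for i j
  have b: "tri (x i * x j) = 2 * b i j" if "i < 3" for i j
    using tr_kerD(2)[OF x2[OF that] xO[of j]] by (simp add: b_def)
  have b_sym: "b i j = b j i" for i j by (simp add: b_def mult.commute)
  have bs: "b 1 0 = b 0 1" "b 2 0 = b 0 2" "b 2 1 = b 1 2" by (rule b_sym)+
  have nd': "congr 2 v 0" if v: "v \<in> tr_ker 2" and orth: "\<And>w. w \<in> tr_ker 2 \<Longrightarrow> 4 dvd tri (w * v)" for v
  proof -
    have "\<forall>j<n. 2 dvd lat.dual (icoord v) j"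
      using v icomb_tr_ker[of "icoord v" 2] by (simp add: icomb_icoord tr_kerD(1))
    moreover have "4 dvd lat.form w (icoord v)" if "\<forall>j<n. 2 dvd lat.dual w j" for w
      using orth[of "icomb w"] that tri_icomb_icomb[of w "icoord v"] v
      by (simp add: icomb_tr_ker icomb_icoord tr_kerD(1))
    ultimately have "\<forall>i<n. 2 dvd icoord v i"
      using nd unfolding lat.kernel_form_nondegenerate_def by blast
    then have "congr 2 (icomb (icoord v)) 0" by (simp add: congr_icomb_0)
    then show ?thesis by (simp add: icomb_icoord tr_kerD(1)[OF v])
  qed
  define d where "d = b 0 0 * b 1 1 * b 2 2 + 2 * (b 0 1 * b 1 2 * b 0 2)
    - b 0 0 * (b 1 2)\<^sup>2 - b 1 1 * (b 0 2)\<^sup>2 - b 2 2 * (b 0 1)\<^sup>2"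
  \<comment> \<open>A kernel vector of \<open>b\<close> modulo 2 would yield an element of the
    radical orthogonal to it modulo 4.\<close>
  have d_odd: "odd d"
  proof
    assume "even d"
    then obtain e :: "nat \<Rightarrow> int" where e: "odd (e 0) \<or> odd (e 1) \<or> odd (e 2)"
      "even (e 0 * b 0 0 + e 1 * b 0 1 + e 2 * b 0 2)"
      "even (e 0 * b 0 1 + e 1 * b 1 1 + e 2 * b 1 2)"
      "even (e 0 * b 0 2 + e 1 * b 1 2 + e 2 * b 2 2)"
      using symmetric_3x3_kernel_mod_2[of b] unfolding d_def by blast
    define v where "v = (\<Sum>k<3. of_int (e k) * x k)"
    have vO: "v \<in> OK" unfolding v_def by (intro O_sum O_closed xO)
    have v2: "v \<in> tr_ker 2"
      using x2 unfolding v_def by (simp add: eval_nat_numeral tr_ker_add tr_ker_mult O_closed)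
    have xv: "4 dvd tri (x k * v)" if k: "k < 3" for k
    proof -
      have "x k * v = (\<Sum>l<3. of_int (e l) * (x k * x l))"
        by (simp add: v_def sum_distrib_left mult.left_commute)
      then have "tri (x k * v) = (\<Sum>l<3. e l * tri (x k * x l))"
        by (simp only:) (rule tri_lin_comb, auto intro: O_closed xO)
      also have "\<dots> = 2 * (e 0 * b k 0 + e 1 * b k 1 + e 2 * b k 2)"
        using b[OF k] by (simp add: eval_nat_numeral algebra_simps)
      finally have eq: "tri (x k * v) = 2 * (e 0 * b k 0 + e 1 * b k 1 + e 2 * b k 2)" .
      have "k = 0 \<or> k = 1 \<or> k = 2" using k by auto
      then have "even (e 0 * b k 0 + e 1 * b k 1 + e 2 * b k 2)"
        by (elim disjE) (simp_all only: bs e(2-4))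
      then show ?thesis unfolding eq by (rule four)
    qed
    have "congr 2 v 0"
    proof (rule nd'[OF v2])
      fix w assume w: "w \<in> tr_ker 2"
      obtain f where "congr 2 w (\<Sum>k<3. of_int (f k) * x k)" using span_congr[OF c _ w] by (auto simp: x_def)
      then obtain g where g: "g \<in> OK" "w = (\<Sum>k<3. of_int (f k) * x k) + of_int 2 * g" by (rule congrE)
      have "w * v = (\<Sum>k<3. of_int (f k) * (x k * v)) + of_int 2 * (v * g)"
        unfolding g(2) by (simp add: distrib_right sum_distrib_right mult.assoc mult.commute[of v g])
      then have "tri (w * v) = tri (\<Sum>k<3. of_int (f k) * (x k * v)) + 2 * tri (v * g)"
        by (simp add: tri_add tri_numeral O_numeral O_sum O_closed xO vO g(1))
      also have "tri (\<Sum>k<3. of_int (f k) * (x k * v)) = (\<Sum>k<3. f k * tri (x k * v))"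
        by (rule tri_lin_comb) (auto intro: O_closed xO vO)
      finally have "tri (w * v) = (\<Sum>k<3. f k * tri (x k * v)) + 2 * tri (v * g)" .
      moreover have "2 * 2 dvd 2 * tri (v * g)" using tr_kerD(2)[OF v2 g(1)] by (rule mult_dvd_mono[OF dvd_refl])
      moreover have "4 dvd (\<Sum>k<3. f k * tri (x k * v))" using xv by (auto intro!: dvd_sum)
      ultimately show "4 dvd tri (w * v)" by simp
    qed
    then have "congr 2 (\<Sum>k<3. of_int (e k) * icomb (c k)) 0" by (simp add: v_def x_def)
    then have "2 dvd e k" if "k < 3" for k using indep_congr[OF c _ _ that] by simp
    from this[of 0] this[of 1] this[of 2] e(1) show False by simp
  qed
  define P :: "nat \<Rightarrow> nat \<Rightarrow> int" where "P k l =
    (if k = 0 \<and> l = 0 then b 1 1 * b 2 2 - (b 1 2)\<^sup>2 else if k = 1 \<and> l = 1 then b 0 0 * b 2 2 - (b 0 2)\<^sup>2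
     else if k = 2 \<and> l = 2 then b 0 0 * b 1 1 - (b 0 1)\<^sup>2
     else if k + l = 1 then b 0 2 * b 1 2 - b 0 1 * b 2 2
     else if k + l = 2 then b 0 1 * b 1 2 - b 0 2 * b 1 1 else b 0 1 * b 0 2 - b 0 0 * b 1 2)" for k l
  have P_sym: "P k l = P l k" for k l by (auto simp: P_def add.commute)
  have Pb: "P k 0 * b 0 m + P k 1 * b 1 m + P k 2 * b 2 m = (if k = m then d else 0)"
    if "k < 3" "m < 3" for k m
  proof -
    have "(k = 0 \<or> k = 1 \<or> k = 2) \<and> (m = 0 \<or> m = 1 \<or> m = 2)" using that by auto
    then show ?thesis
      by (elim conjE disjE) (simp_all add: P_def d_def bs[unfolded One_nat_def] algebra_simps power2_eq_square)
  qed
  define w where "w = (\<Sum>k<3. of_int (P k k) * x k)"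
  have w3: "w = of_int (P 0 0) * x 0 + of_int (P 1 1) * x 1 + of_int (P 2 2) * x 2"
    by (simp add: w_def eval_nat_numeral)
  have wO: "w \<in> OK" unfolding w3 by (intro O_closed xO)
  have w2: "w \<in> tr_ker 2" unfolding w3 using x2 by (intro tr_ker_add tr_ker_mult O_closed) auto
  have ww: "w\<^sup>2 \<in> tr_ker 2" using tr_ker_mult(1)[OF w2 wO] by (simp add: power2_eq_square)
  have sq_par: "even (m * m - m)" for m :: int by simp
  have "congr 2 (w\<^sup>2) 0"
  proof (rule nd'[OF ww])
    fix y assume y: "y \<in> tr_ker 2"
    have yO: "y \<in> OK" using y by (rule tr_kerD)
    have image: "\<exists>f. congr 2 (y * u) (\<Sum>k<3. of_int (f k) * x k)" if u: "u \<in> OK" for u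
      unfolding x_def by (rule span_congr[OF c _ tr_ker_mult(1)[OF y u]]) (simp, rule exI)
    obtain t where t: "\<And>l. l < 3 \<Longrightarrow> congr 2 (y * x l) (\<Sum>k<3. of_int (t k l) * x k)"
      "2 dvd tri y - (\<Sum>k<3. t k k)"
      using trace_factorization[of y 3 x 2, OF yO xO image] by blast
    define T where "T k l = tri (y * (x k * x l))" for k l
    have T_sym: "T k l = T l k" for k l by (simp add: T_def mult.commute)
    have T_even: "even (T k l)" for k l unfolding T_def using y by (rule tr_kerD) (intro O_closed xO)
    have T: "4 dvd T k l - 2 * (t 0 k * b 0 l + t 1 k * b 1 l + t 2 k * b 2 l)" if kl: "k < 3" "l < 3" for k l
    proof -
      obtain g where g: "g \<in> OK" "y * x k = (\<Sum>m<3. of_int (t m k) * x m) + of_int 2 * g"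
        using t(1)[OF kl(1)] by (rule congrE)
      have "y * (x k * x l) = (\<Sum>m<3. of_int (t m k) * x m + 0) * x l + of_int 2 * (x l * g)"
        unfolding mult.assoc[symmetric] g(2) by (simp add: distrib_right mult.assoc mult.commute[of "x l" g])
      also have "(\<Sum>m<3. of_int (t m k) * x m + 0) * x l = (\<Sum>m<3. of_int (t m k) * (x m * x l))"
        by (simp add: sum_distrib_right mult.assoc)
      finally have "T k l = tri (\<Sum>m<3. of_int (t m k) * (x m * x l)) + 2 * tri (x l * g)"
        unfolding T_def by (simp add: tri_add tri_numeral O_numeral O_sum O_closed xO g(1))
      also have "tri (\<Sum>m<3. of_int (t m k) * (x m * x l)) = (\<Sum>m<3. t m k * tri (x m * x l))"
        by (rule tri_lin_comb) (auto intro: O_closed xO)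
      also have "\<dots> = 2 * (t 0 k * b 0 l + t 1 k * b 1 l + t 2 k * b 2 l)"
        by (simp add: eval_nat_numeral b algebra_simps)
      finally have "T k l - 2 * (t 0 k * b 0 l + t 1 k * b 1 l + t 2 k * b 2 l) = 2 * tri (x l * g)" by simp
      moreover have "2 * 2 dvd 2 * tri (x l * g)"
        using tr_kerD(2)[OF x2[OF kl(2)] g(1)] by (rule mult_dvd_mono[OF dvd_refl])
      ultimately show ?thesis by simp
    qed
    \<comment> \<open>Expanding \<open>y * x k\<close> by the matrix \<open>t\<close> and using that
      \<open>P\<close> times \<open>b\<close> is \<open>d\<close> times the identity, the sum
      becomes \<open>2 * d\<close> times the trace of \<open>t\<close> modulo 4, and that trace is
      even.\<close>
    have casimir: "4 dvd (\<Sum>k<3. \<Sum>l<3. P k l * T k l)"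
    proof -
      have c1: "4 dvd (\<Sum>k<3. \<Sum>l<3. P k l * (T k l - 2 * (t 0 k * b 0 l + t 1 k * b 1 l + t 2 k * b 2 l)))"
        using T by (intro dvd_sum dvd_mult) auto
      have c2: "(\<Sum>k<3. \<Sum>l<3. P k l * (T k l - 2 * (t 0 k * b 0 l + t 1 k * b 1 l + t 2 k * b 2 l)))
          = (\<Sum>k<3. \<Sum>l<3. P k l * T k l) - 2 * (\<Sum>k<3. \<Sum>m<3. t m k * (P k 0 * b 0 m + P k 1 * b 1 m + P k 2 * b 2 m))"
        by (simp add: eval_nat_numeral b_sym[of "Suc 0" 0] b_sym[of "Suc (Suc 0)" 0] b_sym[of "Suc (Suc 0)" "Suc 0"] algebra_simps)
      have c3: "(\<Sum>k<3. \<Sum>m<3. t m k * (P k 0 * b 0 m + P k 1 * b 1 m + P k 2 * b 2 m)) = (\<Sum>k<3. t k k * d)"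
      proof (intro sum.cong refl)
        fix k :: nat assume k: "k \<in> {..<3}"
        have "(\<Sum>m<3. t m k * (P k 0 * b 0 m + P k 1 * b 1 m + P k 2 * b 2 m)) = (\<Sum>m<3. if m = k then t k k * d else 0)"
          using k Pb by (intro sum.cong refl) (auto simp del: One_nat_def)
        then show "(\<Sum>m<3. t m k * (P k 0 * b 0 m + P k 1 * b 1 m + P k 2 * b 2 m)) = t k k * d"
          using k by simp
      qed
      have "even (\<Sum>k<3. t k k)" using t(2) tr_kerD(3)[OF y] by (simp add: dvd_diff_right_iff)
      then have c4: "2 * 2 dvd 2 * (\<Sum>k<3. t k k * d)"
        unfolding sum_distrib_right[symmetric] by (intro mult_dvd_mono dvd_refl dvd_mult2)
      have "4 dvd (\<Sum>k<3. \<Sum>l<3. P k l * T k l) - 2 * (\<Sum>k<3. t k k * d)"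
        using c1 unfolding c2 c3 .
      from dvd_add[OF this, of "2 * (\<Sum>k<3. t k k * d)"] c4 show ?thesis by simp
    qed
    \<comment> \<open>Comparison of \<open>tri (y * w\<^sup>2)\<close> with the Casimir sum modulo
      4: off-diagonal terms occur twice on either side, and on the diagonal \<open>P k k\<close> has
      the parity of its square; as every \<open>T k l\<close> is even, the differences
      vanish.\<close>
    have off: "4 dvd 2 * (P 0 1 * T 0 1 + P 0 2 * T 0 2 + P 1 2 * T 1 2)"
      "4 dvd 2 * (P 0 0 * P 1 1 * T 0 1 + P 0 0 * P 2 2 * T 0 2 + P 1 1 * P 2 2 * T 1 2)"
      "4 dvd (P 0 0 * P 0 0 - P 0 0) * T 0 0 + (P 1 1 * P 1 1 - P 1 1) * T 1 1 + (P 2 2 * P 2 2 - P 2 2) * T 2 2"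
    proof -
      show "4 dvd 2 * (P 0 1 * T 0 1 + P 0 2 * T 0 2 + P 1 2 * T 1 2)"
        "4 dvd 2 * (P 0 0 * P 1 1 * T 0 1 + P 0 0 * P 2 2 * T 0 2 + P 1 1 * P 2 2 * T 1 2)"
        by (rule four, simp add: T_even)+
      have "2 * 2 dvd (P k k * P k k - P k k) * T k k" for k
        by (rule mult_dvd_mono[OF sq_par T_even])
      then show "4 dvd (P 0 0 * P 0 0 - P 0 0) * T 0 0 + (P 1 1 * P 1 1 - P 1 1) * T 1 1 + (P 2 2 * P 2 2 - P 2 2) * T 2 2"
        by (intro dvd_add) simp_all
    qed
    have "y * w\<^sup>2 = of_int (P 0 0 * P 0 0) * (y * (x 0 * x 0)) + of_int (P 1 1 * P 1 1) * (y * (x 1 * x 1))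
        + of_int (P 2 2 * P 2 2) * (y * (x 2 * x 2)) + of_int (2 * (P 0 0 * P 1 1)) * (y * (x 0 * x 1))
        + of_int (2 * (P 0 0 * P 2 2)) * (y * (x 0 * x 2)) + of_int (2 * (P 1 1 * P 2 2)) * (y * (x 1 * x 2))"
      unfolding w3 by (simp add: power2_eq_square algebra_simps)
    then have "tri (y * w\<^sup>2) = P 0 0 * P 0 0 * T 0 0 + P 1 1 * P 1 1 * T 1 1 + P 2 2 * P 2 2 * T 2 2
        + 2 * (P 0 0 * P 1 1) * T 0 1 + 2 * (P 0 0 * P 2 2) * T 0 2 + 2 * (P 1 1 * P 2 2) * T 1 2"
      unfolding T_def by (simp add: tri_add tri_scale O_closed xO yO del: of_int_mult)
    also have "\<dots> = (\<Sum>k<3. \<Sum>l<3. P k l * T k l) - 2 * (P 0 1 * T 0 1 + P 0 2 * T 0 2 + P 1 2 * T 1 2)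
        + 2 * (P 0 0 * P 1 1 * T 0 1 + P 0 0 * P 2 2 * T 0 2 + P 1 1 * P 2 2 * T 1 2)
        + ((P 0 0 * P 0 0 - P 0 0) * T 0 0 + (P 1 1 * P 1 1 - P 1 1) * T 1 1 + (P 2 2 * P 2 2 - P 2 2) * T 2 2)"
      by (simp add: eval_nat_numeral P_sym[of "Suc 0" 0] P_sym[of "Suc (Suc 0)" 0] P_sym[of "Suc (Suc 0)" "Suc 0"]
        T_sym[of "Suc 0" 0] T_sym[of "Suc (Suc 0)" 0] T_sym[of "Suc (Suc 0)" "Suc 0"] algebra_simps)
    finally have eq: "tri (y * w\<^sup>2) = \<dots>" .
    show "4 dvd tri (y * w\<^sup>2)"
      unfolding eq by (rule dvd_add[OF dvd_add[OF dvd_diff[OF casimir off(1)] off(2)] off(3)])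
  qed
  \<comment> \<open>The contradiction: modulo 4 the trace of \<open>w\<^sup>2\<close> is twice the
    sum of the \<open>P k k * b k k\<close>, and this sum has the parity of
    \<open>d\<close>.\<close>
  then have "4 dvd tri (w\<^sup>2)" by (rule tri_square_even[OF wO]) (rule tr_kerD(3)[OF w2])
  moreover have "tri (w\<^sup>2) = 2 * (P 0 0 * P 0 0 * b 0 0 + P 1 1 * P 1 1 * b 1 1 + P 2 2 * P 2 2 * b 2 2)
      + 4 * (P 0 0 * P 1 1 * b 0 1 + P 0 0 * P 2 2 * b 0 2 + P 1 1 * P 2 2 * b 1 2)"
  proof -
    have "w\<^sup>2 = of_int (P 0 0 * P 0 0) * (x 0 * x 0) + of_int (P 1 1 * P 1 1) * (x 1 * x 1)
        + of_int (P 2 2 * P 2 2) * (x 2 * x 2) + of_int (2 * (P 0 0 * P 1 1)) * (x 0 * x 1)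
        + of_int (2 * (P 0 0 * P 2 2)) * (x 0 * x 2) + of_int (2 * (P 1 1 * P 2 2)) * (x 1 * x 2)"
      unfolding w3 by (simp add: power2_eq_square algebra_simps)
    then show ?thesis by (simp add: tri_add tri_scale O_closed xO b del: of_int_mult)
  qed
  ultimately have "even (P 0 0 * P 0 0 * b 0 0 + P 1 1 * P 1 1 * b 1 1 + P 2 2 * P 2 2 * b 2 2)" by (rule par)
  then have "even (P 0 0 * b 0 0 + P 1 1 * b 1 1 + P 2 2 * b 2 2)" by simp
  moreover have "P 0 0 * b 0 0 + P 1 1 * b 1 1 + P 2 2 * b 2 2
      = d + 2 * (b 0 0 * b 1 1 * b 2 2 - b 0 1 * b 1 2 * b 0 2)"
    by (simp add: P_def d_def algebra_simps)
  ultimately have "even (d + 2 * (b 0 0 * b 1 1 * b 2 2 - b 0 1 * b 1 2 * b 0 2))" by (simp only:)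
  then show False using d_odd by simp
qed

end


section \<open>Denominators of the matrix of an isometry\<close>

lemma algebraic_int_adj_mat:
  fixes X :: "'a::field_char_0 mat"
  assumes X: "X \<in> carrier_mat n n" and int: "\<And>i j. i < n \<Longrightarrow> j < n \<Longrightarrow> algebraic_int (X $$ (i,j))"
    and ij: "i < n" "j < n"
  shows "algebraic_int (adj_mat X $$ (i,j))"
proof -
  have del: "mat_delete X j i \<in> carrier_mat (n - 1) (n - 1)"
    using X ij by (intro mat_delete_carrier) auto
  have "algebraic_int (det (mat_delete X j i))"
  proof (rule algebraic_int_det[OF del])
    fix k l assume "k < n - 1" "l < n - 1"
    then show "algebraic_int (mat_delete X j i $$ (k,l))"
      using X ij by (auto simp: mat_delete_def intro!: int)
  qed
  then show ?thesis
    using X ij by (auto simp: adj_mat_def cofactor_def intro!: algebraic_int_times_plus algebraic_int_power)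
qed

text \<open>The square is \<open>y\<^sup>2 + z + r\<close> with \<open>r = x * y / sqrt 2\<close>,
  and \<open>r\<close> is integral because its own square is.\<close>

lemma half_sum_integral:
  fixes x y z :: complex
  assumes "x\<^sup>2 = 2 * y\<^sup>2 + 4 * z" "algebraic_int x" "algebraic_int y" "algebraic_int z"
  shows "algebraic_int (x * (1 / 2) + y * (csqrt 2 / 2))"
proof -
  have sqrt2: "(complex_of_real (sqrt 2))\<^sup>2 = 2" by (simp flip: of_real_power)
  define r where "r = x * y * (csqrt 2 / 2)"
  have "r\<^sup>2 = x\<^sup>2 * y\<^sup>2 / 2" by (simp add: r_def power_mult_distrib power_divide sqrt2)
  also have "\<dots> = (y\<^sup>2 + 2 * z) * y\<^sup>2" by (simp add: assms(1))
  finally have "algebraic_int (r\<^sup>2)"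
    using assms(3,4) int_imp_algebraic_int[of 2]
    by (simp) (intro algebraic_int_times_plus algebraic_int_power; simp)
  then have r: "algebraic_int r" by (rule algebraic_int_of_power) simp
  have "(x * (1 / 2) + y * (csqrt 2 / 2))\<^sup>2 = (x\<^sup>2 + 2 * y\<^sup>2) / 4 + r"
    by (simp add: power2_sum r_def power_mult_distrib power_divide sqrt2 field_simps)
  also have "\<dots> = y\<^sup>2 + z + r" by (simp add: assms(1))
  finally have "algebraic_int ((x * (1 / 2) + y * (csqrt 2 / 2))\<^sup>2)"
    using assms r by (simp only:) (intro algebraic_int_times_plus algebraic_int_power)
  then show ?thesis by (rule algebraic_int_of_power) simp
qed

text \<open>\<open>y i\<close> is the image of \<open>a i\<close> under the isometry, so
  \<open>K.icomb c\<close> is sent to \<open>L.icomb c\<close>. Any property of \<open>c\<close>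
  that is stated through the common Gram matrix holds on both sides.\<close>

locale isometric_pair = K: integral_field K n a s + L: integral_field L n y t
  for K :: "'a::field_char_0 set" and n :: nat and a s and L :: "'b::field_char_0 set" and y t +
  assumes gram_eq: "i < n \<Longrightarrow> j < n \<Longrightarrow> field_trace L (y i * y j) = field_trace K (a i * a j)"
begin

lemma gram_int_eq: "L.gram_int = K.gram_int"
  unfolding K.gram_int_def L.gram_int_def
  by (rule eq_matI) (auto simp: K.tri_def L.tri_def gram_eq)

definition disc :: int where
  "disc = det K.gram_int"

lemma disc_nonzero: "disc \<noteq> 0"
  using K.det_gram_basis K.det_gram_int by (simp add: disc_def)

definition A :: "complex mat" where "A = mat n n (\<lambda>(i,j). s i (a j))"
definition B :: "complex mat" where "B = mat n n (\<lambda>(i,j). t i (y j))"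

lemma A_carrier: "A \<in> carrier_mat n n" and B_carrier: "B \<in> carrier_mat n n"
  by (auto simp: A_def B_def)

lemma trace_C: "x \<in> K \<Longrightarrow> (\<Sum>i<n. s i x) = of_rat (field_trace K x)"
  "z \<in> L \<Longrightarrow> (\<Sum>i<n. t i z) = of_rat (field_trace L z)"
  by (simp_all add: K.s_trace L.s_trace)

lemma AtA: "transpose_mat A * A = map_mat of_rat (K.gram a)"
proof (rule eq_matI)
  fix i j assume "i < dim_row (map_mat of_rat (K.gram a) :: complex mat)" "j < dim_col (map_mat of_rat (K.gram a) :: complex mat)"
  then have ij: "i < n" "j < n" by (auto simp: K.gram_def)
  have tA: "transpose_mat A \<in> carrier_mat n n" using A_carrier by simp
  have "(transpose_mat A * A) $$ (i,j) = (\<Sum>k<n. s k (a i) * s k (a j))"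
    unfolding mult_mat_entry[OF tA A_carrier ij] using ij by (intro sum.cong refl) (simp add: A_def)
  also have "\<dots> = (\<Sum>k<n. s k (a i * a j))"
    using ij by (intro sum.cong refl) (simp add: K.s_simps K.b_in)
  finally show "(transpose_mat A * A) $$ (i,j) = map_mat of_rat (K.gram a) $$ (i,j)"
    using ij by (simp add: trace_C K.K_closed K.b_in K.gram_def)
qed (auto simp: A_def K.gram_def)

lemma BtB: "transpose_mat B * B = map_mat of_rat (K.gram a)"
proof (rule eq_matI)
  fix i j assume "i < dim_row (map_mat of_rat (K.gram a) :: complex mat)" "j < dim_col (map_mat of_rat (K.gram a) :: complex mat)"
  then have ij: "i < n" "j < n" by (auto simp: K.gram_def)
  have tB: "transpose_mat B \<in> carrier_mat n n" using B_carrier by simp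
  have "(transpose_mat B * B) $$ (i,j) = (\<Sum>k<n. t k (y i) * t k (y j))"
    unfolding mult_mat_entry[OF tB B_carrier ij] using ij by (intro sum.cong refl) (simp add: B_def)
  also have "\<dots> = (\<Sum>k<n. t k (y i * y j))"
    using ij by (intro sum.cong refl) (simp add: L.s_simps L.b_in)
  finally show "(transpose_mat B * B) $$ (i,j) = map_mat of_rat (K.gram a) $$ (i,j)"
    using ij by (simp add: trace_C L.K_closed L.b_in K.gram_def gram_eq)
qed (auto simp: B_def K.gram_def)

lemma det_A_square: "(det A)\<^sup>2 = of_int disc"
proof -
  have "det (transpose_mat A * A) = (det A)\<^sup>2"
    using A_carrier by (simp add: det_mult[of _ n] det_transpose[OF A_carrier] power2_eq_square)
  then show ?thesis by (simp add: AtA of_rat_hom.hom_det K.det_gram_int disc_def)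
qed

lemma det_A_nonzero: "det A \<noteq> 0"
  using det_A_square disc_nonzero by auto

definition A' :: "complex mat" where
  "A' = (SOME X. X \<in> carrier_mat n n \<and> A * X = 1\<^sub>m n \<and> X * A = 1\<^sub>m n)"

lemma A': "A' \<in> carrier_mat n n" "A * A' = 1\<^sub>m n" "A' * A = 1\<^sub>m n"
proof -
  have "\<exists>X. X \<in> carrier_mat n n \<and> A * X = 1\<^sub>m n \<and> X * A = 1\<^sub>m n"
    using mat_inverse_field[OF A_carrier det_A_nonzero] by blast
  from someI_ex[OF this] show "A' \<in> carrier_mat n n" "A * A' = 1\<^sub>m n" "A' * A = 1\<^sub>m n"
    unfolding A'_def by blast+
qed

text \<open>The matrix of \<open>\<phi> \<otimes> \<complex>\<close> in the coordinates given by the embeddings.\<close>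
definition U :: "complex mat" where "U = B * A'"

lemma U_carrier: "U \<in> carrier_mat n n"
  using B_carrier A'(1) by (simp add: U_def)

lemma U_A: "U * A = B"
  using B_carrier A' A_carrier by (simp add: U_def assoc_mult_mat[of _ n n _ n _ n])

lemma UtU: "transpose_mat U * U = 1\<^sub>m n"
proof -
  have tr: "transpose_mat B \<in> carrier_mat n n" "transpose_mat A' \<in> carrier_mat n n" "transpose_mat A \<in> carrier_mat n n"
    using B_carrier A_carrier A'(1) by auto
  have "transpose_mat U * U = transpose_mat A' * transpose_mat B * (B * A')"
    using transpose_mult[OF B_carrier A'(1)] by (simp add: U_def)
  also have "\<dots> = transpose_mat A' * (transpose_mat B * B) * A'"
    using tr B_carrier A'(1) by (simp add: assoc_mult_mat[of _ n n _ n _ n])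
  also have "\<dots> = transpose_mat A' * (transpose_mat A * A) * A'" by (simp add: AtA BtB)
  also have "\<dots> = (transpose_mat A' * transpose_mat A) * (A * A')"
    using tr A_carrier A'(1) by (simp add: assoc_mult_mat[of _ n n _ n _ n])
  also have "transpose_mat A' * transpose_mat A = transpose_mat (A * A')"
    using transpose_mult[OF A_carrier A'(1)] by simp
  finally show ?thesis by (simp add: A'(2))
qed

lemma UUt: "U * transpose_mat U = 1\<^sub>m n"
  using mat_mult_left_right_inverse[OF _ U_carrier UtU] U_carrier by simp

text \<open>Cramer: \<open>X = A E\<close> satisfies \<open>U X = B E\<close>, hence \<open>det X \<cdot> U = B E \<cdot> adj X\<close> is integral.\<close>
lemma gain:
  assumes E: "E \<in> carrier_mat n n"
    and AE: "\<And>i j. i < n \<Longrightarrow> j < n \<Longrightarrow> algebraic_int ((A * E) $$ (i,j))"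
    and BE: "\<And>i j. i < n \<Longrightarrow> j < n \<Longrightarrow> algebraic_int ((B * E) $$ (i,j))"
    and ij: "i < n" "j < n"
  shows "algebraic_int (of_int disc * (det E)\<^sup>2 * (U $$ (i,j))\<^sup>2)"
proof -
  define X where "X = A * E"
  have X: "X \<in> carrier_mat n n" using A_carrier E by (simp add: X_def)
  have BE_c: "B * E \<in> carrier_mat n n" using B_carrier E by simp
  have UX: "U * X = B * E"
    using U_carrier A_carrier E by (simp add: X_def assoc_mult_mat[of _ n n _ n _ n, symmetric] U_A)
  have "det X \<cdot>\<^sub>m U = U * (X * adj_mat X)"
    using adj_mat[OF X] U_carrier mult_smult_distrib[OF U_carrier one_carrier_mat[of n], of "det X"] by simp
  also have "\<dots> = B * E * adj_mat X"
    using adj_mat(1)[OF X] U_carrier X by (simp add: assoc_mult_mat[of _ n n _ n _ n, symmetric] UX)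
  finally have "det X * U $$ (i,j) = (B * E * adj_mat X) $$ (i,j)"
    using ij U_carrier by (metis carrier_matD index_smult_mat(1))
  also have "\<dots> = (\<Sum>k<n. (B * E) $$ (i,k) * adj_mat X $$ (k,j))"
    by (rule mult_mat_entry[OF BE_c adj_mat(1)[OF X] ij])
  also have "algebraic_int \<dots>"
    using ij by (intro algebraic_int_sum algebraic_int_times_plus(1) BE algebraic_int_adj_mat[OF X])
      (auto simp: X_def AE)
  finally have "algebraic_int ((det X * U $$ (i,j))\<^sup>2)" by (rule algebraic_int_power)
  moreover have "(det X)\<^sup>2 = of_int disc * (det E)\<^sup>2"
    by (simp add: X_def det_mult[OF A_carrier E] power_mult_distrib det_A_square)
  ultimately show ?thesis by (simp add: power_mult_distrib)
qed

text \<open>The rows of \<open>C\<close> are coordinate vectors of integers of \<open>K\<close>.\<close>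
lemma gain_rows:
  assumes C: "C \<in> carrier_mat n n" and T: "T \<in> carrier_mat n n"
    and lower: "\<And>k j. k < j \<Longrightarrow> j < n \<Longrightarrow> T $$ (k,j) = 0"
    and K_int: "\<And>i j. i < n \<Longrightarrow> j < n \<Longrightarrow> algebraic_int (\<Sum>k<n. s i (K.icomb (\<lambda>l. C $$ (k,l))) * T $$ (k,j))"
    and L_int: "\<And>i j. i < n \<Longrightarrow> j < n \<Longrightarrow> algebraic_int (\<Sum>k<n. t i (L.icomb (\<lambda>l. C $$ (k,l))) * T $$ (k,j))"
    and ij: "i < n" "j < n"
  shows "algebraic_int (of_int (disc * (det C)\<^sup>2) * (\<Prod>k<n. T $$ (k,k))\<^sup>2 * (U $$ (i,j))\<^sup>2)"
proof -
  define D where "D = map_mat (of_int :: int \<Rightarrow> complex) (transpose_mat C)"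
  have D: "D \<in> carrier_mat n n" using C by (simp add: D_def)
  have AD: "(A * D) $$ (i,k) = s i (K.icomb (\<lambda>l. C $$ (k,l)))" if "i < n" "k < n" for i k
  proof -
    have "s i (K.icomb (\<lambda>l. C $$ (k,l))) = (\<Sum>l<n. s i (of_int (C $$ (k,l)) * a l))"
      unfolding K.icomb_def by (rule field_hom_on_sum[OF K.K K.s_hom[OF that(1)]]) (auto intro: K.K_closed K.b_in)
    also have "\<dots> = (\<Sum>l<n. of_int (C $$ (k,l)) * s i (a l))"
      using that by (intro sum.cong refl) (simp add: K.s_simps K.K_closed K.b_in)
    finally show ?thesis
      unfolding mult_mat_entry[OF A_carrier D that] using that C by (simp add: A_def D_def mult.commute)
  qed
  have BD: "(B * D) $$ (i,k) = t i (L.icomb (\<lambda>l. C $$ (k,l)))" if "i < n" "k < n" for i k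
  proof -
    have "t i (L.icomb (\<lambda>l. C $$ (k,l))) = (\<Sum>l<n. t i (of_int (C $$ (k,l)) * y l))"
      unfolding L.icomb_def by (rule field_hom_on_sum[OF L.K L.s_hom[OF that(1)]]) (auto intro: L.K_closed L.b_in)
    also have "\<dots> = (\<Sum>l<n. of_int (C $$ (k,l)) * t i (y l))"
      using that by (intro sum.cong refl) (simp add: L.s_simps L.K_closed L.b_in)
    finally show ?thesis
      unfolding mult_mat_entry[OF B_carrier D that] using that C by (simp add: B_def D_def mult.commute)
  qed
  have carr: "A * D \<in> carrier_mat n n" "B * D \<in> carrier_mat n n" using A_carrier B_carrier D by auto
  have ADT: "(A * (D * T)) $$ (i,j) = (\<Sum>k<n. s i (K.icomb (\<lambda>l. C $$ (k,l))) * T $$ (k,j))"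
    and BDT: "(B * (D * T)) $$ (i,j) = (\<Sum>k<n. t i (L.icomb (\<lambda>l. C $$ (k,l))) * T $$ (k,j))"
    if "i < n" "j < n" for i j
    unfolding assoc_mult_mat[OF A_carrier D T, symmetric] assoc_mult_mat[OF B_carrier D T, symmetric]
      mult_mat_entry[OF carr(1) T that] mult_mat_entry[OF carr(2) T that]
    using AD BD that by simp_all
  have "algebraic_int (of_int disc * (det (D * T))\<^sup>2 * (U $$ (i,j))\<^sup>2)"
    by (rule gain) (use D T ADT BDT K_int L_int ij in auto)
  moreover have "det (D * T) = of_int (det C) * (\<Prod>k<n. T $$ (k,k))"
  proof -
    have "det D = of_int (det C)"
      unfolding D_def using det_transpose[OF C] by (simp add: of_int_hom.hom_det)
    moreover have "det T = (\<Prod>k<n. T $$ (k,k))"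
      using det_lower_triangular[OF lower T] T
      by (simp add: diag_mat_def prod.list_conv_set_nth atLeast0LessThan)
    ultimately show ?thesis using det_mult[OF D T] by simp
  qed
  ultimately show ?thesis by (simp add: power_mult_distrib mult_ac)
qed

lemma gain_diagonal:
  assumes C: "C \<in> carrier_mat n n"
    and K_int: "\<And>i k. i < n \<Longrightarrow> k < n \<Longrightarrow> algebraic_int (s i (K.icomb (\<lambda>l. C $$ (k,l))) * \<tau> k)"
    and L_int: "\<And>i k. i < n \<Longrightarrow> k < n \<Longrightarrow> algebraic_int (t i (L.icomb (\<lambda>l. C $$ (k,l))) * \<tau> k)"
    and ij: "i < n" "j < n"
  shows "algebraic_int (of_int (disc * (det C)\<^sup>2) * (\<Prod>k<n. \<tau> k)\<^sup>2 * (U $$ (i,j))\<^sup>2)"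
proof -
  define T where "T = mat n n (\<lambda>(k,j). if k = j then \<tau> k else 0)"
  have T: "T \<in> carrier_mat n n" by (simp add: T_def)
  have "algebraic_int (of_int (disc * (det C)\<^sup>2) * (\<Prod>k<n. T $$ (k,k))\<^sup>2 * (U $$ (i,j))\<^sup>2)"
  proof (rule gain_rows[OF C T _ _ _ ij])
    fix i j assume ij: "i < n" "j < n"
    have "(\<Sum>k<n. f k * T $$ (k,j)) = f j * \<tau> j" for f
      using ij by (simp add: T_def if_distrib[of "\<lambda>x. _ * x"] cong: if_cong)
    then show "algebraic_int (\<Sum>k<n. s i (K.icomb (\<lambda>l. C $$ (k,l))) * T $$ (k,j))"
      "algebraic_int (\<Sum>k<n. t i (L.icomb (\<lambda>l. C $$ (k,l))) * T $$ (k,j))"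
      using K_int L_int ij by auto
  qed (auto simp: T_def)
  then show ?thesis by (simp add: T_def)
qed

text \<open>The good integers form an ideal, which measures the common denominator of all squared
  entries; it is determined one prime at a time.\<close>

definition good :: "int \<Rightarrow> bool" where
  "good k \<longleftrightarrow> (\<forall>i<n. \<forall>j<n. algebraic_int (of_int k * (U $$ (i,j))\<^sup>2))"

lemma s_int: "i < n \<Longrightarrow> x \<in> K.OK \<Longrightarrow> algebraic_int (s i x)"
  by (simp add: field_hom_on_algebraic_int[OF K.K K.s_hom] K.O_iff)

lemma t_int: "i < n \<Longrightarrow> x \<in> L.OK \<Longrightarrow> algebraic_int (t i x)"
  by (simp add: field_hom_on_algebraic_int[OF L.K L.s_hom] L.O_iff)

lemma good_disc: "good disc"
  unfolding good_def
proof (intro allI impI)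
  fix i j assume ij: "i < n" "j < n"
  have "algebraic_int (of_int (disc * (det (1\<^sub>m n :: int mat))\<^sup>2) * (\<Prod>k<n. 1)\<^sup>2 * (U $$ (i,j))\<^sup>2)"
    by (rule gain_diagonal[OF one_carrier_mat _ _ ij]) (auto intro: s_int t_int K.icomb_in L.icomb_in)
  then show "algebraic_int (of_int disc * (U $$ (i,j))\<^sup>2)" by simp
qed

lemma good_add: "good k \<Longrightarrow> good l \<Longrightarrow> good (k + l)"
  unfolding good_def by (auto simp: distrib_right intro: algebraic_int_times_plus)

lemma good_mult: "good k \<Longrightarrow> good (l * k)"
  unfolding good_def by (auto simp: mult.assoc intro: algebraic_int_times_plus)

text \<open>All good integers are multiples of the least positive one. By the assumptions that one
  is divisible neither by an odd prime nor by 4, so it divides 2.\<close>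

lemma good_2_if_not_dvd:
  assumes odd: "\<And>p::int. prime p \<Longrightarrow> odd p \<Longrightarrow> \<exists>k. good k \<and> \<not> p dvd k"
    and two: "\<exists>k. good k \<and> \<not> 4 dvd k"
  shows "good 2"
proof -
  define m where "m = (LEAST m::nat. m > 0 \<and> good (int m))"
  have "good (int (nat \<bar>disc\<bar>))" using good_disc good_mult[OF good_disc, of "- 1"] by (cases "disc \<ge> 0") auto
  then have "nat \<bar>disc\<bar> > 0 \<and> good (int (nat \<bar>disc\<bar>))" using disc_nonzero by simp
  from LeastI[of "\<lambda>m. m > 0 \<and> good (int m)", OF this] have m: "m > 0" "good (int m)" by (auto simp: m_def)
  have dvd: "int m dvd k" if k: "good k" for k
  proof -
    have "k mod int m = k + (- (k div int m)) * int m" by (simp add: minus_div_mult_eq_mod[symmetric])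
    then have g: "good (k mod int m)" using good_add[OF k good_mult[OF m(2)]] by metis
    have "\<not> nat (k mod int m) > 0"
    proof
      assume pos: "nat (k mod int m) > 0"
      have "good (int (nat (k mod int m)))" using g m(1) by simp
      then have "m \<le> nat (k mod int m)" using pos unfolding m_def by (intro Least_le) auto
      moreover have "nat (k mod int m) < m"
        using m(1) pos_mod_bound[of "int m" k] pos_mod_sign[of "int m" k] by linarith
      ultimately show False by simp
    qed
    then have "k mod int m = 0" using m(1) pos_mod_sign[of "int m" k] by linarith
    then show ?thesis by (rule mod_0_imp_dvd)
  qed
  have no_odd: "\<not> p dvd int m" if "prime p" "odd p" for p
    using odd[OF that] dvd dvd_trans by blast
  have no_four: "\<not> 4 dvd int m" using two dvd dvd_trans by blast
  have "int m dvd 2"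
  proof (cases "odd m")
    case True
    have "int m = 1"
    proof (rule ccontr)
      assume "int m \<noteq> 1"
      then obtain p where "prime p" "p dvd int m"
        using prime_divisor_exists[of "int m"] m(1) by auto
      then show False using no_odd True by (metis dvd_trans even_of_nat)
    qed
    then show ?thesis by simp
  next
    case False
    then obtain k where k: "int m = 2 * k" by (metis dvdE even_of_nat)
    have "k = 1"
    proof (rule ccontr)
      assume "k \<noteq> 1"
      moreover have "k > 0" using k m(1) by simp
      ultimately obtain p where p: "prime p" "p dvd k" using prime_divisor_exists[of k] by auto
      show False
      proof (cases "odd p")
        case True
        then show False using no_odd p k by (metis dvd_mult)
      next
        case False
        then have "2 * 2 dvd 2 * k" using p(2) dvd_trans by (intro mult_dvd_mono) auto
        then show False using no_four k by simp
      qed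
    qed
    then show ?thesis using k by simp
  qed
  then show ?thesis using good_mult[OF m(2)] by (metis dvdE mult.commute)
qed

section \<open>Lowering the denominator at a single prime\<close>

lemma first_row_diag_prod:
  fixes v :: complex
  assumes "r \<le> n"
  shows "(\<Prod>k<n. if k < r then v else 1) = v ^ r"
proof -
  have "(\<Prod>k<n. if k < r then v else 1) = (\<Prod>k<r. v)"
    using assms by (intro prod.mono_neutral_cong_right) auto
  then show ?thesis by simp
qed

text \<open>If the \<open>x\<^sub>k\<close>, \<open>k < r\<close>, become divisible by \<open>\<rho>\<close> in the ring of all algebraic integers, on both
  sides, then the denominator of \<open>u\<^sup>2\<close> drops by \<open>\<rho>\<^bsup>2r\<^esup>\<close>.\<close>
lemma gain_divisible:
  fixes p :: int
  assumes p: "prime p" and c: "indep_mod p n r c" and \<rho>: "\<rho> ^ m = of_int p" "m > 0"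
    and K_div: "\<And>k. k < r \<Longrightarrow> K.congr p ((K.icomb (c k)) ^ m) 0"
    and L_div: "\<And>k. k < r \<Longrightarrow> L.congr p ((L.icomb (c k)) ^ m) 0"
  obtains e :: int where "\<not> p dvd e"
    "\<And>i j. i < n \<Longrightarrow> j < n \<Longrightarrow> algebraic_int (of_int (disc * e\<^sup>2) * ((1 / \<rho>) ^ r)\<^sup>2 * (U $$ (i,j))\<^sup>2)"
proof -
  obtain C where C: "C \<in> carrier_mat n n" "\<not> p dvd det C" "r \<le> n" "\<And>k i. k < r \<Longrightarrow> i < n \<Longrightarrow> C $$ (k,i) = c k i"
    using extend_rows_mod_prime[OF p c] by blast
  have p0: "p \<noteq> 0" using p by auto
  define \<tau> where "\<tau> k = (if k < r then 1 / \<rho> else 1)" for k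
  have K_int: "algebraic_int (s i (K.icomb (\<lambda>l. C $$ (k,l))) * \<tau> k)" if "i < n" "k < n" for i k
  proof (cases "k < r")
    case True
    have eq: "K.icomb (\<lambda>l. C $$ (k,l)) = K.icomb (c k)" using C(4)[OF True] by (rule K.icomb_cong)
    obtain z where z: "z \<in> K.OK" "(K.icomb (c k)) ^ m = of_int p * z"
      using K_div[OF True] by (auto elim: K.congrE)
    have "(s i (K.icomb (c k)) * (1 / \<rho>)) ^ m = s i (K.icomb (c k) ^ m) / of_int p"
      using that by (simp add: power_divide \<rho>(1) K.s_simps K.O_in_K K.icomb_in)
    also have "\<dots> = s i z" using that z p0 by (simp add: K.s_simps K.O_in_K K.K_closed)
    finally have "algebraic_int ((s i (K.icomb (c k)) * (1 / \<rho>)) ^ m)" using s_int that z(1) by simp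
    then have "algebraic_int (s i (K.icomb (c k)) * (1 / \<rho>))" using \<rho>(2) by (rule algebraic_int_of_power)
    then show ?thesis using True by (simp add: eq \<tau>_def)
  qed (simp add: \<tau>_def s_int that K.icomb_in)
  have L_int: "algebraic_int (t i (L.icomb (\<lambda>l. C $$ (k,l))) * \<tau> k)" if "i < n" "k < n" for i k
  proof (cases "k < r")
    case True
    have eq: "L.icomb (\<lambda>l. C $$ (k,l)) = L.icomb (c k)" using C(4)[OF True] by (rule L.icomb_cong)
    obtain z where z: "z \<in> L.OK" "(L.icomb (c k)) ^ m = of_int p * z"
      using L_div[OF True] by (auto elim: L.congrE)
    have "(t i (L.icomb (c k)) * (1 / \<rho>)) ^ m = t i (L.icomb (c k) ^ m) / of_int p"
      using that by (simp add: power_divide \<rho>(1) L.s_simps L.O_in_K L.icomb_in)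
    also have "\<dots> = t i z" using that z p0 by (simp add: L.s_simps L.O_in_K L.K_closed)
    finally have "algebraic_int ((t i (L.icomb (c k)) * (1 / \<rho>)) ^ m)" using t_int that z(1) by simp
    then have "algebraic_int (t i (L.icomb (c k)) * (1 / \<rho>))" using \<rho>(2) by (rule algebraic_int_of_power)
    then show ?thesis using True by (simp add: eq \<tau>_def)
  qed (simp add: \<tau>_def t_int that L.icomb_in)
  have "algebraic_int (of_int (disc * (det C)\<^sup>2) * ((1 / \<rho>) ^ r)\<^sup>2 * (U $$ (i,j))\<^sup>2)" if "i < n" "j < n" for i j
    using gain_diagonal[OF C(1) K_int L_int that] by (simp only: \<tau>_def first_row_diag_prod[OF C(3)])
  then show ?thesis using that C(2) by blast
qed

text \<open>One vector and \<open>\<rho> = sqrt p\<close>: the determinant enters squared, so one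
  factor \<open>p\<close> of \<open>disc\<close> is gained.\<close>

lemma gain_square:
  fixes p :: int
  assumes p: "prime p" and c: "indep_mod p n 1 (\<lambda>_. c)" and d: "p dvd disc"
    and K_div: "K.congr p ((K.icomb c)\<^sup>2) 0" and L_div: "L.congr p ((L.icomb c)\<^sup>2) 0"
  obtains e :: int where "\<not> p dvd e" "good (disc div p * e\<^sup>2)"
proof -
  define \<rho> where "\<rho> = csqrt (of_int p)"
  have \<rho>: "\<rho>\<^sup>2 = of_int p" by (simp add: \<rho>_def)
  have p0: "p \<noteq> 0" using p by auto
  show ?thesis
  proof (rule gain_divisible[OF p c \<rho>])
    fix e :: int assume e: "\<not> p dvd e"
      "\<And>i j. i < n \<Longrightarrow> j < n \<Longrightarrow> algebraic_int (of_int (disc * e\<^sup>2) * ((1 / \<rho>) ^ 1)\<^sup>2 * (U $$ (i,j))\<^sup>2)"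
    obtain m where m: "disc = p * m" using d by (rule dvdE)
    have "of_int (disc * e\<^sup>2) * ((1 / \<rho>) ^ 1)\<^sup>2 = (of_int (disc div p * e\<^sup>2) :: complex)"
      using p0 by (simp add: m power_divide \<rho>)
    then have "good (disc div p * e\<^sup>2)" using e(2) unfolding good_def by (simp only:) blast
    then show ?thesis using that e(1) by blast
  qed (use K_div L_div in auto)
qed

text \<open>Once the only factor \<open>p\<close> of \<open>disc\<close> is removed, what is left is
  prime to \<open>p\<close>, as is the factor \<open>e\<^sup>2\<close> that comes from completing
  the basis.\<close>

lemma good_prime:
  fixes p :: int
  assumes p: "prime p" and d: "p dvd disc" "\<not> p\<^sup>2 dvd disc"
  shows "\<exists>k. good k \<and> \<not> p dvd k"
proof -
  have p0: "p \<noteq> 0" using p by auto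
  obtain x where x: "K.lat.spans_dual_kernel p 1 (\<lambda>_. x)"
    using K.lat.dual_kernel_line[OF p] d unfolding disc_def by blast
  have x': "L.lat.spans_dual_kernel p 1 (\<lambda>_. x)" using x by (simp only: gram_int_eq)
  have indep: "indep_mod p n 1 (\<lambda>_. x)" using x by (simp add: K.lat.spans_dual_kernel_def)
  obtain e :: int where e: "\<not> p dvd e" "good (disc div p * e\<^sup>2)"
    using gain_square[OF p indep d(1) K.dual_kernel_line_square[OF p0 x] L.dual_kernel_line_square[OF p0 x']] by blast
  obtain m where m: "disc = p * m" using d(1) by (rule dvdE)
  have "\<not> p dvd m" using d(2) p0 unfolding m power2_eq_square by simp
  then have "\<not> p dvd disc div p * e\<^sup>2" using p e(1) p0 by (simp add: m prime_dvd_mult_iff prime_dvd_power_iff)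
  then show ?thesis using e(2) by blast
qed

lemma gain_at_two:
  assumes c: "indep_mod 2 n 1 (\<lambda>_. c)" and d: "4 dvd disc" "\<not> 8 dvd disc"
    and div: "K.congr 2 ((K.icomb c)\<^sup>2) 0" "L.congr 2 ((L.icomb c)\<^sup>2) 0"
  shows "\<exists>k. good k \<and> \<not> 4 dvd k"
proof -
  have d2: "2 dvd disc" using d(1) by presburger
  obtain e :: int where e: "\<not> 2 dvd e" "good (disc div 2 * e\<^sup>2)"
    using gain_square[OF _ c d2 div] by auto
  have "odd (e\<^sup>2)" using e(1) by simp
  then have "coprime 4 (e\<^sup>2)" using coprime_power_left_iff[of 2 2 "e\<^sup>2"] by simp
  moreover have "\<not> 4 dvd disc div 2" using d by presburger
  ultimately have "\<not> 4 dvd disc div 2 * e\<^sup>2" by (simp add: coprime_dvd_mult_left_iff)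
  then show ?thesis using e(2) by blast
qed

text \<open>A line gives a square root of 2. On a plane, if both basis vectors have norm divisible
  by 4, their cubes are divisible by 2 and a cube root of 2 is split off twice. Otherwise some
  element has a square that acts as the identity, and then any vector of norm divisible by 4 has its
  square divisible by 2.\<close>

lemma good_two_exact_4:
  assumes d: "4 dvd disc" "\<not> 8 dvd disc"
  shows "\<exists>k. good k \<and> \<not> 4 dvd k"
proof (rule K.lat.dual_kernel_at_most_plane[OF d[unfolded disc_def]])
  fix x assume x: "K.lat.spans_dual_kernel 2 1 (\<lambda>_. x)"
  have x': "L.lat.spans_dual_kernel 2 1 (\<lambda>_. x)" using x by (simp only: gram_int_eq)
  have indep: "indep_mod 2 n 1 (\<lambda>_. x)" using x by (simp add: K.lat.spans_dual_kernel_def)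
  show ?thesis
    by (rule gain_at_two[OF indep d K.dual_kernel_line_square[OF _ x] L.dual_kernel_line_square[OF _ x']]) auto
next
  fix c assume c: "K.lat.spans_dual_kernel 2 2 c"
  have c': "L.lat.spans_dual_kernel 2 2 c" using c by (simp only: gram_int_eq)
  have indep: "indep_mod 2 n 2 c" using c by (simp add: K.lat.spans_dual_kernel_def)
  have tri: "K.tri (K.icomb u * K.icomb v) = K.lat.form u v" "L.tri (L.icomb u * L.icomb v) = K.lat.form u v" for u v
    by (simp_all only: K.tri_icomb_icomb L.tri_icomb_icomb gram_int_eq)
  have ker: "K.icomb (c k) \<in> K.tr_ker 2" "L.icomb (c k) \<in> L.tr_ker 2" if "k < 2" for k
    using K.spans_in_tr_ker[OF c that] L.spans_in_tr_ker[OF c' that] by auto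
  define f where "f i j = K.lat.form (c i) (c j)" for i j
  show ?thesis
  proof (cases "4 dvd f 0 0 \<and> 4 dvd f 1 1")
    case True
    define \<rho> where "\<rho> = complex_of_real (root 3 2)"
    have \<rho>: "\<rho> ^ 3 = of_int 2" by (simp add: \<rho>_def flip: of_real_power)
    have ff: "4 dvd f k k" if "k < 2" for k using True that by (auto simp: less_2_cases_iff)
    show ?thesis
    proof (rule gain_divisible[OF _ indep \<rho>])
      show "K.congr 2 (K.icomb (c k) ^ 3) 0" if "k < 2" for k
        using K.plane_cube[OF c ker(1)[OF that]] ff[OF that] by (simp add: tri f_def)
      show "L.congr 2 (L.icomb (c k) ^ 3) 0" if "k < 2" for k
        using L.plane_cube[OF c' ker(2)[OF that]] ff[OF that] by (simp add: tri f_def)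
      fix e :: int assume e: "\<not> 2 dvd e"
        "\<And>i j. i < n \<Longrightarrow> j < n \<Longrightarrow> algebraic_int (of_int (disc * e\<^sup>2) * ((1 / \<rho>) ^ 2)\<^sup>2 * (U $$ (i,j))\<^sup>2)"
      obtain m where m: "disc = 4 * m" using d(1) by (rule dvdE)
      have "odd m" using d(2) unfolding m by (auto elim!: evenE)
      define k where "k = m * e\<^sup>2"
      have k: "odd k" using \<open>odd m\<close> e(1) by (simp add: k_def)
      \<comment> \<open>Of the factor 4 there remains
        \<open>4 / \<rho> ^ 4 = \<rho>\<^sup>2\<close>, which divides \<open>\<rho> ^ 3 = 2\<close>.
        Taking cubes turns this into a computation with integers.\<close>
      have "algebraic_int (of_int (2 * k) * (U $$ (i,j))\<^sup>2)" if "i < n" "j < n" for i j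
      proof -
        have \<rho>12: "\<rho> ^ 12 = 16"
          using arg_cong[OF \<rho>, of "\<lambda>x. x ^ 4"] by (simp flip: power_mult)
        have "(of_int (disc * e\<^sup>2) * ((1 / \<rho>) ^ 2)\<^sup>2 * (U $$ (i,j))\<^sup>2) ^ 3
            = (4 * of_int k) ^ 3 * ((U $$ (i,j))\<^sup>2) ^ 3 / \<rho> ^ 12"
          by (simp add: m k_def power_mult_distrib power_divide flip: power_mult)
        also have "2 * \<dots> = (of_int (2 * k) * (U $$ (i,j))\<^sup>2) ^ 3"
          by (simp add: \<rho>12 power_mult_distrib)
        finally have "(of_int (2 * k) * (U $$ (i,j))\<^sup>2) ^ 3
            = of_int 2 * (of_int (disc * e\<^sup>2) * ((1 / \<rho>) ^ 2)\<^sup>2 * (U $$ (i,j))\<^sup>2) ^ 3" by simp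
        moreover have "algebraic_int (of_int 2 * (of_int (disc * e\<^sup>2) * ((1 / \<rho>) ^ 2)\<^sup>2 * (U $$ (i,j))\<^sup>2) ^ 3)"
          by (intro algebraic_int_times_plus(1)[OF _ algebraic_int_power[OF e(2)[OF that]]] int_imp_algebraic_int) simp
        ultimately have "algebraic_int ((of_int (2 * k) * (U $$ (i,j))\<^sup>2) ^ 3)" by metis
        then show ?thesis by (rule algebraic_int_of_power) simp
      qed
      then have "good (2 * k)" by (simp add: good_def)
      moreover have "\<not> 4 dvd 2 * k" using k by presburger
      ultimately show ?thesis by blast
    qed simp_all
  next
    case False
    have even_f: "2 dvd f i j" if "i < 2" for i j
      using K.tr_kerD(2)[OF ker(1)[OF that] K.icomb_in, of "c j"] by (simp add: tri f_def)
    \<comment> \<open>A vector, nonzero modulo 2, of norm divisible by 4: a basis vector if one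
      qualifies, otherwise the sum of both.\<close>
    obtain g h k where gh: "odd g \<or> odd h" and k: "k < (2::nat)" "\<not> 4 dvd f k k"
      and iso: "4 dvd g * g * f 0 0 + h * h * f 1 1 + 2 * (g * h * f 0 1)"
    proof -
      consider "4 dvd f 0 0" "\<not> 4 dvd f 1 1" | "\<not> 4 dvd f 0 0" "4 dvd f 1 1" | "\<not> 4 dvd f 0 0" "\<not> 4 dvd f 1 1"
        using False by blast
      then show ?thesis
      proof cases
        case 1
        then show ?thesis using that[of 1 0 1] by simp
      next
        case 2
        then show ?thesis using that[of 0 1 0] by simp
      next
        case 3
        have "4 dvd f 0 0 + f 1 1 + 2 * f 0 1"
          using 3 even_f[of 0 0] even_f[of 1 1] even_f[of 0 1] by presburger
        then show ?thesis using that[of 1 1 0] 3 by simp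
      qed
    qed
    define v where "v = (\<lambda>i. g * c 0 i + h * c 1 i)"
    have v: "indep_mod 2 n 1 (\<lambda>_. v)"
      unfolding indep_mod_def
    proof (intro allI impI)
      fix e :: "nat \<Rightarrow> int" and l :: nat
      assume e: "\<forall>i<n. 2 dvd (\<Sum>k<1. e k * v i)" and l: "l < 1"
      have "2 dvd (\<Sum>k<2. (\<lambda>k. if k = 0 then e 0 * g else e 0 * h) k * c k i)" if "i < n" for i
        using e that by (simp add: numeral_2_eq_2 v_def algebra_simps)
      note * = indep_modD[OF indep this]
      show "2 dvd e l" using *[of 0] *[of 1] gh l by auto
    qed
    have vv: "K.lat.form v v = g * g * f 0 0 + h * h * f 1 1 + 2 * (g * h * f 0 1)"
    proof -
      have "K.lat.form v v = g * K.lat.form v (c 0) + h * K.lat.form v (c 1)"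
        by (subst (2) v_def) (rule K.lat.form_lin)
      also have "K.lat.form v (c 0) = g * f 0 0 + h * f 0 1"
        by (subst K.lat.form_sym) (simp only: v_def K.lat.form_lin f_def)
      also have "K.lat.form v (c 1) = g * f 0 1 + h * f 1 1"
        by (subst K.lat.form_sym) (simp only: v_def K.lat.form_lin f_def K.lat.form_sym[of "c 1" "c 0"])
      finally show ?thesis by (simp add: algebra_simps)
    qed
    have vker: "K.icomb v \<in> K.tr_ker 2" "L.icomb v \<in> L.tr_ker 2"
      using ker[of 0] ker[of 1] unfolding v_def K.icomb_lin L.icomb_lin
      by (auto intro: K.tr_ker_add K.tr_ker_mult L.tr_ker_add L.tr_ker_mult K.O_closed L.O_closed)
    have "K.congr 2 ((K.icomb v)\<^sup>2) 0"
      by (rule K.plane_isotropic_square[OF c vker(1) ker(1)[OF k(1)]]) (use iso vv k in \<open>simp_all add: tri f_def\<close>)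
    moreover have "L.congr 2 ((L.icomb v)\<^sup>2) 0"
      by (rule L.plane_isotropic_square[OF c' vker(2) ker(2)[OF k(1)]]) (use iso vv k in \<open>simp_all add: tri f_def\<close>)
    ultimately show ?thesis by (rule gain_at_two[OF v d])
  qed
qed

text \<open>Only the plane with a vector \<open>u\<close> of weight 4 is possible. There the
  congruence of \<open>(icomb u)\<^sup>2\<close> and \<open>2 * (icomb v)\<^sup>2\<close> modulo 4,
  valid in both rings, makes half of \<open>u + sqrt 2 * v\<close> integral.\<close>

lemma good_two_exact_8:
  assumes d: "8 dvd disc" "\<not> 16 dvd disc"
  shows "\<exists>k. good k \<and> \<not> 4 dvd k"
proof (rule K.lat.dual_kernel_cases_8[OF d[unfolded disc_def]])
  fix x assume x: "K.lat.spans_dual_kernel 2 1 (\<lambda>_. x)" "\<And>j. j < n \<Longrightarrow> 4 dvd K.lat.dual x j"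
  then show ?thesis using K.no_quartic_line[OF x(1)] by (simp add: K.icomb_tr_ker)
next
  fix c assume "K.lat.spans_dual_kernel 2 3 c" K.lat.kernel_form_nondegenerate
  then show ?thesis using K.no_nondegenerate_space by blast
next
  fix u v assume uv: "K.lat.spans_dual_kernel 2 2 ((\<lambda>_. u)(1 := v))" "\<And>j. j < n \<Longrightarrow> 4 dvd K.lat.dual u j"
    "\<not> 4 dvd K.lat.form v v"
  define c :: "nat \<Rightarrow> nat \<Rightarrow> int" where "c = (\<lambda>_. u)(1 := v)"
  have cuv: "c 0 = u" "c 1 = v" by (simp_all add: c_def)
  have c: "K.lat.spans_dual_kernel 2 2 c" using uv(1) by (simp add: c_def)
  have c': "L.lat.spans_dual_kernel 2 2 c" using c by (simp only: gram_int_eq)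
  have indep: "indep_mod 2 n 2 c" using c by (simp add: K.lat.spans_dual_kernel_def)
  have K4: "K.congr 4 ((K.icomb u)\<^sup>2) (2 * (K.icomb v)\<^sup>2)"
    using K.plane_quartic_square[OF c] uv(2,3) unfolding cuv by (simp add: K.icomb_tr_ker K.tri_icomb_icomb)
  have L4: "L.congr 4 ((L.icomb u)\<^sup>2) (2 * (L.icomb v)\<^sup>2)"
    using L.plane_quartic_square[OF c'] uv(2,3) unfolding cuv
    by (simp add: L.icomb_tr_ker L.tri_icomb_icomb gram_int_eq)
  obtain C where C: "C \<in> carrier_mat n n" "\<not> 2 dvd det C" "2 \<le> n" "\<And>k i. k < 2 \<Longrightarrow> i < n \<Longrightarrow> C $$ (k,i) = c k i"
    using extend_rows_mod_prime[OF _ indep] by auto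
  \<comment> \<open>Column 0 forms \<open>(u + sqrt 2 * v) / 2\<close> and the other columns keep
    the basis. The matrix is lower triangular of determinant 1/2, whose square removes a factor 4
    from \<open>disc\<close>.\<close>
  define T :: "complex mat" where "T = mat n n (\<lambda>(k,j). if k = j then (if j = 0 then 1 / 2 else 1)
    else if k = 1 \<and> j = 0 then csqrt 2 / 2 else 0)"
  have T: "T \<in> carrier_mat n n" by (simp add: T_def)
  have col: "(\<Sum>k<n. h k * T $$ (k,j)) = (if j = 0 then h 0 * (1 / 2) + h 1 * (csqrt 2 / 2) else h j)"
    if "j < n" for j and h :: "nat \<Rightarrow> complex"
  proof (cases "j = 0")
    case True
    have "(\<Sum>k<n. h k * T $$ (k,j)) = (\<Sum>k<2. h k * T $$ (k,j))"
      using C(3) True by (intro sum.mono_neutral_right) (auto simp: T_def)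
    then show ?thesis using True C(3) by (simp add: T_def numeral_2_eq_2)
  next
    case False
    then have "(\<Sum>k<n. h k * T $$ (k,j)) = (\<Sum>k<n. if k = j then h j else 0)"
      using that by (intro sum.cong refl) (auto simp: T_def)
    then show ?thesis using False that by simp
  qed
  have prod_T: "(\<Prod>k<n. T $$ (k,k)) = 1 / 2"
  proof -
    have "(\<Prod>k<n. T $$ (k,k)) = (\<Prod>k<n. if k = 0 then 1 / 2 else 1)" by (intro prod.cong) (auto simp: T_def)
    then show ?thesis using C(3) by simp
  qed
  have Kc: "K.icomb (\<lambda>l. C $$ (0,l)) = K.icomb u" "K.icomb (\<lambda>l. C $$ (1,l)) = K.icomb v"
    and Lc: "L.icomb (\<lambda>l. C $$ (0,l)) = L.icomb u" "L.icomb (\<lambda>l. C $$ (1,l)) = L.icomb v"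
    using C(4)[of 0] C(4)[of 1] cuv by (auto intro!: K.icomb_cong L.icomb_cong)
  have K_half: "algebraic_int (s i (K.icomb u) * (1 / 2) + s i (K.icomb v) * (csqrt 2 / 2))" if "i < n" for i
  proof -
    obtain z where z: "z \<in> K.OK" "(K.icomb u)\<^sup>2 = 2 * (K.icomb v)\<^sup>2 + of_int 4 * z" using K4 by (rule K.congrE)
    have "s i ((K.icomb u)\<^sup>2) = s i (of_int 2 * (K.icomb v)\<^sup>2 + of_int 4 * z)" using z(2) by simp
    then have "(s i (K.icomb u))\<^sup>2 = of_int 2 * (s i (K.icomb v))\<^sup>2 + of_int 4 * s i z"
      using that z(1) by (simp only: K.s_simps K.O_in_K K.icomb_in K.K_closed)
    then show ?thesis using that z(1) by (intro half_sum_integral[of _ _ "s i z"]) (simp_all add: s_int K.icomb_in)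
  qed
  have L_half: "algebraic_int (t i (L.icomb u) * (1 / 2) + t i (L.icomb v) * (csqrt 2 / 2))" if "i < n" for i
  proof -
    obtain z where z: "z \<in> L.OK" "(L.icomb u)\<^sup>2 = 2 * (L.icomb v)\<^sup>2 + of_int 4 * z" using L4 by (rule L.congrE)
    have "t i ((L.icomb u)\<^sup>2) = t i (of_int 2 * (L.icomb v)\<^sup>2 + of_int 4 * z)" using z(2) by simp
    then have "(t i (L.icomb u))\<^sup>2 = of_int 2 * (t i (L.icomb v))\<^sup>2 + of_int 4 * t i z"
      using that z(1) by (simp only: L.s_simps L.O_in_K L.icomb_in L.K_closed)
    then show ?thesis using that z(1) by (intro half_sum_integral[of _ _ "t i z"]) (simp_all add: t_int L.icomb_in)
  qed
  have main: "algebraic_int (of_int (disc * (det C)\<^sup>2) * (\<Prod>k<n. T $$ (k,k))\<^sup>2 * (U $$ (i,j))\<^sup>2)"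
    if "i < n" "j < n" for i j
  proof (rule gain_rows[OF C(1) T _ _ _ that])
    fix i j assume ij: "i < n" "j < n"
    show "algebraic_int (\<Sum>k<n. s i (K.icomb (\<lambda>l. C $$ (k,l))) * T $$ (k,j))"
      using ij K_half[OF ij(1)] by (simp add: col Kc[unfolded One_nat_def] s_int K.icomb_in)
    show "algebraic_int (\<Sum>k<n. t i (L.icomb (\<lambda>l. C $$ (k,l))) * T $$ (k,j))"
      using ij L_half[OF ij(1)] by (simp add: col Lc[unfolded One_nat_def] t_int L.icomb_in)
  qed (auto simp: T_def)
  define m where "m = disc div 4"
  have m: "disc = 4 * m" "\<not> 4 dvd m" using d unfolding m_def by presburger+
  have "of_int (disc * (det C)\<^sup>2) * (\<Prod>k<n. T $$ (k,k))\<^sup>2 = (of_int (m * (det C)\<^sup>2) :: complex)"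
    by (simp add: prod_T m(1) power_divide)
  then have "good (m * (det C)\<^sup>2)" using main unfolding good_def by (simp only:) blast
  moreover have "coprime 4 ((det C)\<^sup>2)" using C(2) coprime_power_left_iff[of 2 2 "(det C)\<^sup>2"] by simp
  then have "\<not> 4 dvd m * (det C)\<^sup>2" using m(2) by (simp add: coprime_dvd_mult_left_iff)
  ultimately show ?thesis by blast
qed

lemma good_2:
  assumes odd: "\<And>p::int. prime p \<Longrightarrow> odd p \<Longrightarrow> \<not> p\<^sup>2 dvd disc" and two: "\<not> 16 dvd disc"
  shows "good 2"
proof (rule good_2_if_not_dvd)
  show "\<exists>k. good k \<and> \<not> p dvd k" if "prime p" "odd p" for p
    using good_prime[OF that(1) _ odd[OF that]] good_disc by blast
  show "\<exists>k. good k \<and> \<not> 4 dvd k"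
    using good_two_exact_4 good_two_exact_8[OF _ two] good_disc by blast
qed

end


section \<open>Isometries come from isomorphisms\<close>

text \<open>Power sums of numbers in \<open>[-1,1]\<close> can only be integers eventually if no number contributes a
  term that decays without vanishing.\<close>
lemma integral_power_sums:
  fixes r :: "'i \<Rightarrow> real"
  assumes I: "finite I" and bound: "\<And>i. i \<in> I \<Longrightarrow> \<bar>r i\<bar> \<le> 1"
    and int: "\<And>k. (\<Sum>i\<in>I. r i ^ (2 * k)) \<in> \<int>" and i: "i \<in> I"
  shows "r i = -1 \<or> r i = 0 \<or> r i = 1"
proof (rule ccontr)
  assume not: "\<not> ?thesis"
  \<comment> \<open>The numbers of absolute value 1 contribute the integer 1 to every even power
    sum. What is left is a nonnegative integer tending to 0, so it is 0 for some
    \<open>k\<close>.\<close>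
  define J where "J = {i \<in> I. \<bar>r i\<bar> < 1}"
  define f where "f k = (\<Sum>i\<in>J. r i ^ (2 * k))" for k
  have J: "finite J" "J \<subseteq> I" using I by (auto simp: J_def)
  have f_int: "f k \<in> \<int>" for k
  proof -
    have "(\<Sum>i\<in>I - J. r i ^ (2 * k)) = (\<Sum>i\<in>I - J. 1)"
    proof (intro sum.cong refl)
      fix i assume "i \<in> I - J"
      then have "\<bar>r i\<bar> = 1" using bound[of i] by (auto simp: J_def)
      then have "r i ^ 2 = 1" by (simp add: power2_eq_1_iff abs_if split: if_splits)
      then show "r i ^ (2 * k) = 1" by (simp add: power_mult)
    qed
    then have "f k = (\<Sum>i\<in>I. r i ^ (2 * k)) - of_nat (card (I - J))"
      using sum.subset_diff[OF J(2) I, of "\<lambda>i. r i ^ (2 * k)"] by (simp add: f_def)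
    then show ?thesis using int by simp
  qed
  have "(\<lambda>k. \<Sum>i\<in>J. (r i ^ 2) ^ k) \<longlonglongrightarrow> (\<Sum>i\<in>J. 0)"
  proof (intro tendsto_sum LIMSEQ_power_zero)
    fix i assume "i \<in> J"
    then show "norm (r i ^ 2) < 1" by (auto simp: J_def abs_square_less_1)
  qed
  moreover have "f = (\<lambda>k. \<Sum>i\<in>J. (r i ^ 2) ^ k)" by (simp add: f_def power_mult fun_eq_iff)
  ultimately have "f \<longlonglongrightarrow> 0" by simp
  then have "eventually (\<lambda>k. f k < 1) sequentially" by (rule order_tendstoD) simp
  then obtain k where "f k < 1" by (auto simp: eventually_sequentially)
  moreover have nonneg: "r i ^ (2 * k) \<ge> 0" for i by (simp add: power_mult)
  then have "f k \<ge> 0" unfolding f_def by (intro sum_nonneg)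
  ultimately have "f k = 0" using f_int[of k] by (auto elim!: Ints_cases)
  then have "\<forall>i\<in>J. r i ^ (2 * k) = 0" using sum_nonneg_eq_0_iff[OF J(1) nonneg] by (simp add: f_def)
  moreover have "i \<in> J" using i not bound[OF i] by (auto simp: J_def abs_if split: if_splits)
  ultimately show False using not by simp
qed

text \<open>If some nonzero entry is not 1 or -1, then exactly two entries are nonzero, both of
  square 1/2; their product is 1/2 or -1/2, and the square of the sum is 1 plus twice this
  product.\<close>

lemma unit_row_cases:
  fixes r :: "nat \<Rightarrow> real"
  assumes sum1: "(\<Sum>j<n. (r j)\<^sup>2) = 1" and vals: "\<And>j. j < n \<Longrightarrow> (r j)\<^sup>2 = 0 \<or> (r j)\<^sup>2 = 1 / 2 \<or> (r j)\<^sup>2 = 1"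
  obtains (single) j where "j < n" "(r j)\<^sup>2 = 1" "\<And>k. k < n \<Longrightarrow> k \<noteq> j \<Longrightarrow> r k = 0"
    | (double) "(\<Sum>j<n. r j)\<^sup>2 = 0 \<or> (\<Sum>j<n. r j)\<^sup>2 = 2"
proof -
  have "\<exists>j<n. r j \<noteq> 0"
  proof (rule ccontr)
    assume "\<not> ?thesis"
    then have "(\<Sum>j<n. (r j)\<^sup>2) = 0" by (intro sum.neutral) auto
    then show False using sum1 by simp
  qed
  then obtain j where j: "j < n" "r j \<noteq> 0" by blast
  have rest: "(\<Sum>k\<in>{..<n} - {j}. (r k)\<^sup>2) = 1 - (r j)\<^sup>2"
    using sum1 j by (subst (asm) sum.remove[of _ j]) auto
  show ?thesis
  proof (cases "(r j)\<^sup>2 = 1")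
    case True
    then have "(\<Sum>k\<in>{..<n} - {j}. (r k)\<^sup>2) = 0" using rest by simp
    then have "\<forall>k\<in>{..<n} - {j}. (r k)\<^sup>2 = 0" by (subst (asm) sum_nonneg_eq_0_iff) auto
    then show ?thesis using single[OF j(1) True] by simp
  next
    case False
    then have rj: "(r j)\<^sup>2 = 1 / 2" using vals[OF j(1)] j(2) by auto
    have "\<exists>k\<in>{..<n} - {j}. r k \<noteq> 0"
    proof (rule ccontr)
      assume "\<not> ?thesis"
      then have "(\<Sum>k\<in>{..<n} - {j}. (r k)\<^sup>2) = 0" by (intro sum.neutral) auto
      then show False using rest rj by simp
    qed
    then obtain k where k: "k < n" "k \<noteq> j" "r k \<noteq> 0" by auto
    have rest2: "(\<Sum>l\<in>{..<n} - {j} - {k}. (r l)\<^sup>2) = 1 / 2 - (r k)\<^sup>2"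
      using rest rj k by (subst (asm) sum.remove[of _ k]) auto
    have "(\<Sum>l\<in>{..<n} - {j} - {k}. (r l)\<^sup>2) \<ge> 0" by (intro sum_nonneg) auto
    then have rk: "(r k)\<^sup>2 = 1 / 2" using rest2 vals[OF k(1)] k(3) by auto
    then have "(\<Sum>l\<in>{..<n} - {j} - {k}. (r l)\<^sup>2) = 0" using rest2 by simp
    then have "\<forall>l\<in>{..<n} - {j} - {k}. (r l)\<^sup>2 = 0" by (subst (asm) sum_nonneg_eq_0_iff) auto
    then have "(\<Sum>l\<in>{..<n} - {j} - {k}. r l) = 0" by (intro sum.neutral) auto
    then have S: "(\<Sum>l<n. r l) = r j + r k"
      using j(1) k by (subst sum.remove[of _ j]) (auto simp: sum.remove[of "{..<n} - {j}" k])
    have "(r j * r k)\<^sup>2 = (1 / 2)\<^sup>2" 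
      unfolding power_mult_distrib rj rk by (simp add: power2_eq_square)
    then have "r j * r k = 1 / 2 \<or> r j * r k = - (1 / 2)" using power2_eq_iff by blast
    moreover have "(\<Sum>l<n. r l)\<^sup>2 = 1 + 2 * (r j * r k)" by (simp add: S power2_sum rj rk)
    ultimately show ?thesis using double by auto
  qed
qed

context isometric_pair
begin

lemma t_icomb:
  assumes "i < n"
  shows "t i (L.icomb c) = (\<Sum>j<n. U $$ (i,j) * s j (K.icomb c))"
proof -
  have B_entry: "t i (y l) = (\<Sum>j<n. U $$ (i,j) * s j (a l))" if "l < n" for l
  proof -
    have "t i (y l) = (U * A) $$ (i,l)" using assms that by (simp add: U_A) (simp add: B_def)
    also have "\<dots> = (\<Sum>j<n. U $$ (i,j) * A $$ (j,l))" by (rule mult_mat_entry[OF U_carrier A_carrier assms that])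
    also have "\<dots> = (\<Sum>j<n. U $$ (i,j) * s j (a l))" using that by (intro sum.cong refl) (simp add: A_def)
    finally show ?thesis .
  qed
  have "t i (L.icomb c) = (\<Sum>l<n. of_int (c l) * t i (y l))"
    unfolding L.icomb_def
    by (subst field_hom_on_sum[OF L.K L.s_hom[OF assms]]) (auto simp: assms L.s_simps L.K_closed L.b_in)
  also have "\<dots> = (\<Sum>j<n. U $$ (i,j) * (\<Sum>l<n. of_int (c l) * s j (a l)))"
    by (simp add: B_entry sum_distrib_left mult.left_commute) (rule sum.swap)
  also have "\<dots> = (\<Sum>j<n. U $$ (i,j) * s j (K.icomb c))"
  proof (intro sum.cong refl arg_cong2[of _ _ _ _ "(*)"])
    fix j assume "j \<in> {..<n}"
    then have j: "j < n" by simp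
    show "(\<Sum>l<n. of_int (c l) * s j (a l)) = s j (K.icomb c)"
      unfolding K.icomb_def
      by (subst field_hom_on_sum[OF K.K K.s_hom[OF j]]) (auto simp: j K.s_simps K.K_closed K.b_in)
  qed
  finally show ?thesis .
qed

text \<open>The inverse of \<open>A\<close> is the inverse Gram matrix times the transpose of
  \<open>A\<close>. So its row \<open>l\<close> consists of the conjugates of one element of
  \<open>K\<close>, a member of the trace-dual basis.\<close>

lemma dual_basis:
  obtains a' where "\<And>l. l < n \<Longrightarrow> a' l \<in> K" "\<And>l j. l < n \<Longrightarrow> j < n \<Longrightarrow> A' $$ (l,j) = s j (a' l)"
proof -
  obtain Gi where Gi: "Gi \<in> carrier_mat n n" "K.gram a * Gi = 1\<^sub>m n" "Gi * K.gram a = 1\<^sub>m n"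
    using mat_inverse_field[OF K.gram_carrier K.det_gram_basis] by blast
  define X where "X = map_mat of_rat Gi * transpose_mat A"
  have tA: "transpose_mat A \<in> carrier_mat n n" using A_carrier by simp
  have Gc: "map_mat (of_rat :: rat \<Rightarrow> complex) Gi \<in> carrier_mat n n" using Gi(1) by simp
  have X: "X \<in> carrier_mat n n" using Gc tA by (simp add: X_def)
  have "X * A = map_mat of_rat Gi * map_mat of_rat (K.gram a)"
    unfolding X_def using assoc_mult_mat[OF Gc tA A_carrier] AtA by simp
  also have "\<dots> = map_mat of_rat (Gi * K.gram a)"
    by (rule of_rat_hom.mat_hom_mult[OF Gi(1) K.gram_carrier, symmetric])
  also have "\<dots> = 1\<^sub>m n" by (simp add: Gi(3) of_rat_hom.mat_hom_one)
  finally have XA: "X * A = 1\<^sub>m n" .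
  have "X * (A * A') = X * A * A'" using X A_carrier A'(1) by (simp add: assoc_mult_mat[of _ n n _ n _ n])
  then have "X = A'" using X A'(1) by (simp add: A'(2) XA)
  define a' where "a' l = (\<Sum>k<n. of_rat (Gi $$ (l,k)) * a k)" for l
  have "A' $$ (l,j) = s j (a' l)" if lj: "l < n" "j < n" for l j
  proof -
    have "A' $$ (l,j) = (\<Sum>k<n. of_rat (Gi $$ (l,k)) * s j (a k))"
      unfolding \<open>X = A'\<close>[symmetric] X_def mult_mat_entry[OF Gc tA lj]
      using lj Gi(1) by (intro sum.cong refl) (auto simp: A_def)
    also have "\<dots> = s j (a' l)"
      unfolding a'_def
      by (subst field_hom_on_sum[OF K.K K.s_hom[OF lj(2)]]) (auto simp: lj K.s_simps K.K_closed K.b_in)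
    finally show ?thesis .
  qed
  moreover have "a' l \<in> K" for l unfolding a'_def by (rule K.comb_in)
  ultimately show ?thesis using that by blast
qed

text \<open>The functions on pairs of embeddings that come from \<open>K \<otimes> L\<close>.\<close>
inductive tensor :: "(nat \<Rightarrow> nat \<Rightarrow> complex) \<Rightarrow> bool" where
  pure: "x \<in> K \<Longrightarrow> z \<in> L \<Longrightarrow> tensor (\<lambda>i j. s j x * t i z)"
| add: "tensor f \<Longrightarrow> tensor g \<Longrightarrow> tensor (\<lambda>i j. f i j + g i j)"
| agree: "tensor f \<Longrightarrow> (\<And>i j. i < n \<Longrightarrow> j < n \<Longrightarrow> f i j = g i j) \<Longrightarrow> tensor g"

lemma tensor_mult_pure: "tensor f \<Longrightarrow> x \<in> K \<Longrightarrow> z \<in> L \<Longrightarrow> tensor (\<lambda>i j. f i j * (s j x * t i z))"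
proof (induction rule: tensor.induct)
  case (pure x' z')
  have "tensor (\<lambda>i j. s j (x' * x) * t i (z' * z))"
    using pure by (intro tensor.pure K.K_closed L.K_closed)
  then show ?case by (rule tensor.agree) (use pure in \<open>simp add: K.s_simps L.s_simps\<close>)
next
  case (add f g)
  have "tensor (\<lambda>i j. f i j * (s j x * t i z) + g i j * (s j x * t i z))"
    using add by (intro tensor.add)
  then show ?case by (rule tensor.agree) (simp add: distrib_right)
next
  case (agree f g)
  then show ?case by (auto intro: tensor.agree[of "\<lambda>i j. f i j * (s j x * t i z)"])
qed

lemma tensor_mult: "tensor g \<Longrightarrow> tensor f \<Longrightarrow> tensor (\<lambda>i j. f i j * g i j)"
proof (induction rule: tensor.induct)
  case (pure x z)
  then show ?case by (simp add: tensor_mult_pure)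
next
  case (add g h)
  have "tensor (\<lambda>i j. f i j * g i j + f i j * h i j)" using add by (intro tensor.add)
  then show ?case by (rule tensor.agree) (simp add: distrib_left)
next
  case (agree g h)
  then show ?case by (auto intro: tensor.agree[of "\<lambda>i j. f i j * g i j"])
qed

lemma tensor_of_int: "tensor (\<lambda>i j. of_int c)"
  by (rule tensor.agree[OF tensor.pure[of "of_int c" 1]]) (simp_all add: K.s_simps L.s_simps K.K_closed L.K_closed)

lemma tensor_power: "tensor f \<Longrightarrow> tensor (\<lambda>i j. f i j ^ k)"
  using tensor_of_int[of 1] by (induction k) (auto intro: tensor_mult)

lemma tensor_sum: "(\<And>l. l < (m::nat) \<Longrightarrow> tensor (f l)) \<Longrightarrow> tensor (\<lambda>i j. \<Sum>l<m. f l i j)"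
proof (induction m)
  case 0
  then show ?case using tensor_of_int[of 0] by simp
qed (simp add: tensor.add)

text \<open>The total of a pure tensor is the product of a trace of \<open>K\<close> and a trace of
  \<open>L\<close>.\<close>

lemma tensor_total_rational: "tensor f \<Longrightarrow> (\<Sum>i<n. \<Sum>j<n. f i j) \<in> \<rat>"
proof (induction rule: tensor.induct)
  case (pure x z)
  have "(\<Sum>i<n. \<Sum>j<n. s j x * t i z) = (\<Sum>j<n. s j x) * (\<Sum>i<n. t i z)"
    by (subst sum.swap) (simp add: sum_product)
  then show ?case using pure by (simp add: trace_C)
next
  case (add f g)
  then show ?case by (simp add: sum.distrib)
next
  case (agree f g)
  have "(\<Sum>i<n. \<Sum>j<n. f i j) = (\<Sum>i<n. \<Sum>j<n. g i j)" by (intro sum.cong refl) (simp add: agree.hyps)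
  then show ?case using agree.IH by simp
qed

lemma tensor_U: "tensor (\<lambda>i j. U $$ (i,j))"
proof -
  obtain a' where a': "\<And>l. l < n \<Longrightarrow> a' l \<in> K" "\<And>l j. l < n \<Longrightarrow> j < n \<Longrightarrow> A' $$ (l,j) = s j (a' l)"
    using dual_basis by blast
  have "tensor (\<lambda>i j. \<Sum>l<n. s j (a' l) * t i (y l))"
    using a'(1) L.b_in by (intro tensor_sum tensor.pure)
  then show ?thesis
  proof (rule tensor.agree)
    fix i j assume ij: "i < n" "j < n"
    show "(\<Sum>l<n. s j (a' l) * t i (y l)) = U $$ (i,j)"
      unfolding U_def mult_mat_entry[OF B_carrier A'(1) ij]
      using ij by (intro sum.cong refl) (simp add: a'(2) B_def)
  qed
qed

lemma det_B_nonzero: "det B \<noteq> 0"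
proof -
  have "det U * det A = det B" using det_mult[OF U_carrier A_carrier] by (simp add: U_A)
  moreover have "det U \<noteq> 0"
    using det_mult[OF _ U_carrier, of "transpose_mat U"] U_carrier by (auto simp: UtU)
  ultimately show ?thesis using det_A_nonzero by auto
qed

text \<open>Dedekind's argument. As \<open>B\<close> is invertible, \<open>\<rho>\<close> is a
  combination of the independent \<open>t i\<close> with coefficients \<open>c i\<close>.
  Multiplicativity gives \<open>c i * (\<rho> x - t i x) = 0\<close>, so \<open>\<rho>\<close>
  equals a \<open>t i\<close> with nonzero coefficient.\<close>

lemma embedding_of_L_cases:
  assumes \<rho>: "field_hom_on L \<rho>"
  obtains i where "i < n" "\<And>l. l < n \<Longrightarrow> \<rho> (y l) = t i (y l)"
proof -
  obtain B' where B': "B' \<in> carrier_mat n n" "B * B' = 1\<^sub>m n" "B' * B = 1\<^sub>m n"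
    using mat_inverse_field[OF B_carrier det_B_nonzero] by blast
  have indep: "w k = 0" if w: "\<And>l. l < n \<Longrightarrow> (\<Sum>i<n. w i * t i (y l)) = 0" and k: "k < n" for w k
  proof -
    have "w k = (\<Sum>i<n. w i * (B * B') $$ (i,k))"
      using k by (simp add: B'(2) if_distrib[of "\<lambda>x. _ * x"] cong: if_cong)
    also have "\<dots> = (\<Sum>i<n. \<Sum>l<n. (w i * t i (y l)) * B' $$ (l,k))"
      using k by (intro sum.cong refl) (subst mult_mat_entry[OF B_carrier B'(1)], auto simp: B_def sum_distrib_left mult.assoc)
    also have "\<dots> = (\<Sum>l<n. (\<Sum>i<n. w i * t i (y l)) * B' $$ (l,k))"
      by (subst sum.swap) (simp add: sum_distrib_right)
    finally show ?thesis by (simp add: w)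
  qed
  define c where "c i = (\<Sum>l<n. \<rho> (y l) * B' $$ (l,i))" for i
  have c: "\<rho> (y l) = (\<Sum>i<n. c i * t i (y l))" if l: "l < n" for l
  proof -
    have "\<rho> (y l) = (\<Sum>k<n. \<rho> (y k) * (B' * B) $$ (k,l))"
      using l by (simp add: B'(3) if_distrib[of "\<lambda>x. _ * x"] cong: if_cong)
    also have "\<dots> = (\<Sum>k<n. \<Sum>i<n. \<rho> (y k) * B' $$ (k,i) * t i (y l))"
      using l by (intro sum.cong refl) (subst mult_mat_entry[OF B'(1) B_carrier], auto simp: B_def sum_distrib_left mult.assoc)
    also have "\<dots> = (\<Sum>i<n. c i * t i (y l))"
      by (subst sum.swap) (simp add: c_def sum_distrib_right)
    finally show ?thesis .
  qed
  note \<rho>_simps = field_hom_on_simps[OF L.K \<rho>]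
  have cx: "\<rho> x = (\<Sum>i<n. c i * t i x)" if x: "x \<in> L" for x
  proof -
    have "\<rho> x = (\<Sum>l<n. of_rat (L.coord x l) * \<rho> (y l))"
      by (subst L.coord[OF x], subst field_hom_on_sum[OF L.K \<rho>]) (auto simp: \<rho>_simps L.K_closed L.b_in)
    also have "\<dots> = (\<Sum>i<n. c i * (\<Sum>l<n. of_rat (L.coord x l) * t i (y l)))"
      by (simp add: c sum_distrib_left mult.left_commute) (rule sum.swap)
    also have "\<dots> = (\<Sum>i<n. c i * t i x)"
    proof (intro sum.cong refl arg_cong2[of _ _ _ _ "(*)"])
      fix i assume "i \<in> {..<n}"
      then have i: "i < n" by simp
      show "(\<Sum>l<n. of_rat (L.coord x l) * t i (y l)) = t i x"
        by (subst (2) L.coord[OF x], subst field_hom_on_sum[OF L.K L.s_hom[OF i]])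
          (auto simp: i L.s_simps L.K_closed L.b_in)
    qed
    finally show ?thesis .
  qed
  have zero: "c i * (\<rho> x - t i x) = 0" if x: "x \<in> L" and i: "i < n" for x i
  proof (rule indep[OF _ i])
    fix l assume l: "l < n"
    have "(\<Sum>i<n. c i * (\<rho> x - t i x) * t i (y l)) = \<rho> x * (\<Sum>i<n. c i * t i (y l)) - (\<Sum>i<n. c i * t i (x * y l))"
      using x l by (simp add: L.s_simps L.b_in sum_distrib_left sum_subtractf[symmetric] algebra_simps)
    also have "\<dots> = \<rho> x * \<rho> (y l) - \<rho> (x * y l)"
      using cx[of "x * y l"] x l by (simp add: c L.K_closed L.b_in)
    finally show "(\<Sum>i<n. c i * (\<rho> x - t i x) * t i (y l)) = 0"
      using x l by (simp add: \<rho>_simps L.b_in)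
  qed
  have "\<exists>i<n. c i \<noteq> 0"
  proof (rule ccontr)
    assume "\<not> ?thesis"
    then have "\<rho> 1 = 0" using cx[OF L.K_closed(2)] by simp
    then show False by (simp add: \<rho>_simps)
  qed
  then obtain i where "i < n" "c i \<noteq> 0" by blast
  then show ?thesis using that zero[OF L.b_in] by fastforce
qed

text \<open>Conjugation takes row \<open>i\<close> to some row \<open>k\<close>. For
  \<open>k \<noteq> i\<close> the orthogonality of these rows would say that the squared absolute
  values of row \<open>i\<close> sum to 0; so row \<open>i\<close> is its own conjugate.\<close>

lemma U_real:
  assumes real: "\<And>i x. i < n \<Longrightarrow> x \<in> K \<Longrightarrow> s i x \<in> \<real>" and ij: "i < n" "j < n"
  shows "U $$ (i,j) \<in> \<real>"
proof -
  obtain a' where a': "\<And>l. l < n \<Longrightarrow> a' l \<in> K" "\<And>l j. l < n \<Longrightarrow> j < n \<Longrightarrow> A' $$ (l,j) = s j (a' l)"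
    using dual_basis by blast
  have A'_real: "cnj (A' $$ (l,j)) = A' $$ (l,j)" if "l < n" "j < n" for l j
    using real[OF that(2) a'(1)[OF that(1)]] a'(2)[OF that] by (simp add: Reals_cnj_iff)
  have U_entry: "U $$ (i,j) = (\<Sum>l<n. t i (y l) * A' $$ (l,j))" if "i < n" "j < n" for i j
    unfolding U_def mult_mat_entry[OF B_carrier A'(1) that] using that by (intro sum.cong refl) (simp add: B_def)
  have "field_hom_on L (\<lambda>x. cnj (t i x))"
    using L.s_hom[OF ij(1)] by (simp add: field_hom_on_def)
  then obtain k where k: "k < n" "\<And>l. l < n \<Longrightarrow> cnj (t i (y l)) = t k (y l)"
    using embedding_of_L_cases by metis
  have conj: "cnj (U $$ (i,j)) = U $$ (k,j)" if "j < n" for j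
    using that ij k by (simp add: U_entry A'_real)
  have entry: "(\<Sum>j<n. U $$ (i,j) * U $$ (k,j)) = (if i = k then 1 else 0)" if "k < n" for k
  proof -
    have tU: "transpose_mat U \<in> carrier_mat n n" using U_carrier by simp
    have "(U * transpose_mat U) $$ (i,k) = (\<Sum>j<n. U $$ (i,j) * U $$ (k,j))"
      unfolding mult_mat_entry[OF U_carrier tU ij(1) that] using that U_carrier by (intro sum.cong refl) auto
    then show ?thesis using ij(1) that by (simp add: UUt)
  qed
  have "i = k"
  proof (rule ccontr)
    assume "i \<noteq> k"
    then have "(\<Sum>j<n. U $$ (i,j) * cnj (U $$ (i,j))) = 0" using entry[OF k(1)] conj by simp
    moreover have "complex_of_real (\<Sum>j<n. (cmod (U $$ (i,j)))\<^sup>2) = (\<Sum>j<n. U $$ (i,j) * cnj (U $$ (i,j)))"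
      unfolding of_real_sum by (intro sum.cong refl) (rule complex_norm_square)
    ultimately have "complex_of_real (\<Sum>j<n. (cmod (U $$ (i,j)))\<^sup>2) = 0" by simp
    then have "(\<Sum>j<n. (cmod (U $$ (i,j)))\<^sup>2) = 0" by (simp only: of_real_eq_0_iff)
    then have "\<forall>j<n. U $$ (i,j) = 0" by (subst (asm) sum_nonneg_eq_0_iff) auto
    then show False using entry[OF ij(1)] by simp
  qed
  then show ?thesis using conj[OF ij(2)] by (simp add: Reals_cnj_iff)
qed

lemma t0_inj: "u \<in> L \<Longrightarrow> v \<in> L \<Longrightarrow> t 0 u = t 0 v \<Longrightarrow> u = v"
  using L.s_simps(11)[OF L.n_pos, of "u - v"] L.s_simps(6)[OF L.n_pos, of u v] L.K_closed(4) by simp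

text \<open>The isomorphism is \<open>s j\<close> followed by the inverse of \<open>t 0\<close>,
  written in coordinates; the sign \<open>e\<close> is absorbed into them.\<close>

lemma isomorphic_if_signed_embedding:
  assumes j: "j < n" and e: "e = 1 \<or> e = (-1::int)"
    and ty: "\<And>l. l < n \<Longrightarrow> t 0 (y l) = of_int e * s j (a l)"
  shows "field_isomorphic K L"
proof -
  note n0 = L.n_pos
  have ee: "of_int e * (of_int e * x) = x" for x :: complex using e by auto
  define \<theta> where "\<theta> x = (\<Sum>l<n. of_rat (of_int e * K.coord x l) * y l)" for x
  have \<theta>_in: "\<theta> x \<in> L" for x unfolding \<theta>_def by (rule L.comb_in)
  have t_comb: "t 0 (\<Sum>l<n. of_rat (q l) * y l) = (\<Sum>l<n. of_rat (q l) * (of_int e * s j (a l)))" for q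
    by (subst field_hom_on_sum[OF L.K L.s_hom[OF n0]]) (auto simp: n0 L.s_simps L.K_closed L.b_in ty)
  have s_comb: "s j x = (\<Sum>l<n. of_rat (K.coord x l) * s j (a l))" if "x \<in> K" for x
    by (subst K.coord[OF that], subst field_hom_on_sum[OF K.K K.s_hom[OF j]]) (auto simp: j K.s_simps K.K_closed K.b_in)
  have t\<theta>: "t 0 (\<theta> x) = s j x" if "x \<in> K" for x
    unfolding \<theta>_def t_comb s_comb[OF that]
    by (intro sum.cong refl) (simp add: of_rat_mult mult.left_commute ee)
  have hom: "field_hom_on K \<theta>"
    unfolding field_hom_on_def
    by (intro conjI ballI; rule t0_inj)
      (simp_all add: \<theta>_in L.K_closed K.K_closed L.s_simps[OF n0] t\<theta> K.s_simps[OF j])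
  have inj: "inj_on \<theta> K"
  proof (rule inj_onI)
    fix u v assume uv: "u \<in> K" "v \<in> K" "\<theta> u = \<theta> v"
    then have "s j (u - v) = 0" using t\<theta>[of u] t\<theta>[of v] by (simp add: K.s_simps[OF j])
    then show "u = v" using K.s_simps(11)[OF j, of "u - v"] uv K.K_closed(4) by simp
  qed
  have "z \<in> \<theta> ` K" if z: "z \<in> L" for z
  proof -
    define x where "x = (\<Sum>l<n. of_rat (of_int e * L.coord z l) * a l)"
    have x: "x \<in> K" unfolding x_def by (rule K.comb_in)
    have "t 0 (\<theta> x) = s j x" by (rule t\<theta>[OF x])
    also have "\<dots> = (\<Sum>l<n. of_rat (of_int e * L.coord z l) * s j (a l))"
      unfolding x_def by (subst field_hom_on_sum[OF K.K K.s_hom[OF j]]) (auto simp: j K.s_simps K.K_closed K.b_in)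
    also have "\<dots> = t 0 (\<Sum>l<n. of_rat (L.coord z l) * y l)"
      unfolding t_comb by (intro sum.cong refl) (simp add: of_rat_mult mult_ac)
    also have "(\<Sum>l<n. of_rat (L.coord z l) * y l) = z" using L.coord[OF z] by simp
    finally have "\<theta> x = z" using t0_inj \<theta>_in z by blast
    then show ?thesis using x by blast
  qed
  then have "bij_betw \<theta> K L" using inj \<theta>_in by (auto simp: bij_betw_def)
  then show ?thesis using hom unfolding field_isomorphic_def by blast
qed

lemma isomorphic:
  assumes real: "\<And>i x. i < n \<Longrightarrow> x \<in> K \<Longrightarrow> s i x \<in> \<real>"
    and odd: "\<And>p::int. prime p \<Longrightarrow> odd p \<Longrightarrow> \<not> p\<^sup>2 dvd disc" and two: "\<not> 16 dvd disc"
  shows "field_isomorphic K L"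
proof -
  note n0 = L.n_pos
  define r where "r i j = Re (U $$ (i,j))" for i j
  have r: "U $$ (i,j) = of_real (r i j)" if "i < n" "j < n" for i j
    using U_real[OF real that] by (simp add: r_def)
  have row: "(\<Sum>j<n. (r i j)\<^sup>2) = 1" if i: "i < n" for i
  proof -
    have tU: "transpose_mat U \<in> carrier_mat n n" using U_carrier by simp
    have "(U * transpose_mat U) $$ (i,i) = (\<Sum>j<n. U $$ (i,j) * U $$ (i,j))"
      unfolding mult_mat_entry[OF U_carrier tU i i] using i U_carrier by (intro sum.cong refl) auto
    then have "complex_of_real (\<Sum>j<n. (r i j)\<^sup>2) = 1"
      using i by (simp add: UUt r power2_eq_square)
    then show ?thesis by (simp only: of_real_eq_1_iff)
  qed
  have bound: "(r i j)\<^sup>2 \<le> 1" if "i < n" "j < n" for i j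
  proof -
    have "(r i j)\<^sup>2 \<le> (\<Sum>j<n. (r i j)\<^sup>2)" by (rule member_le_sum) (use that in auto)
    then show ?thesis using row[OF that(1)] by simp
  qed
  have good2: "good 2" by (rule good_2[OF odd two])
  define v where "v p = 2 * (r (fst p) (snd p))\<^sup>2 - 1" for p
  let ?I = "{..<n} \<times> {..<n}"
  \<comment> \<open>The sum is rational as the total of a tensor, and an algebraic integer because 2
    is good.\<close>
  have v_int: "(\<Sum>p\<in>?I. v p ^ (2 * k)) \<in> \<int>" for k
  proof -
    define h where "h i j = (2 * (U $$ (i,j))\<^sup>2 - 1) ^ (2 * k)" for i j
    have "tensor (\<lambda>i j. of_int 2 * (U $$ (i,j))\<^sup>2 + of_int (- 1))"
      by (intro tensor.add tensor_mult tensor_power tensor_of_int tensor_U)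
    then have "tensor h" unfolding h_def by (intro tensor_power) simp
    then have rat: "(\<Sum>i<n. \<Sum>j<n. h i j) \<in> \<rat>" by (rule tensor_total_rational)
    have h_int: "algebraic_int (h i j)" if "i < n" "j < n" for i j
      unfolding h_def using good2 that
      by (intro algebraic_int_power algebraic_int_diff) (auto simp: good_def)
    have "algebraic_int (\<Sum>i<n. \<Sum>j<n. h i j)" by (intro algebraic_int_sum h_int) auto
    then have "(\<Sum>i<n. \<Sum>j<n. h i j) \<in> \<int>" using rat by (rule rational_algebraic_int_is_int)
    moreover have "(\<Sum>i<n. \<Sum>j<n. h i j) = complex_of_real (\<Sum>p\<in>?I. v p ^ (2 * k))"
      by (simp add: sum.cartesian_product' h_def r v_def)
    ultimately show ?thesis by (metis of_real_in_Ints_iff)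
  qed
  have vals: "(r i j)\<^sup>2 = 0 \<or> (r i j)\<^sup>2 = 1 / 2 \<or> (r i j)\<^sup>2 = 1" if "i < n" "j < n" for i j
  proof -
    have "v (i,j) = -1 \<or> v (i,j) = 0 \<or> v (i,j) = 1"
    proof (rule integral_power_sums[OF _ _ v_int])
      fix p assume "p \<in> ?I"
      then show "\<bar>v p\<bar> \<le> 1" using bound[of "fst p" "snd p"] by (auto simp: v_def abs_le_iff)
    qed (use that in auto)
    then show ?thesis by (auto simp: v_def)
  qed
  define w where "w = L.icomb (K.icoord 1)"
  have w: "w \<in> L" using L.icomb_in L.O_in_K by (simp add: w_def)
  have t0w: "t 0 w = of_real (\<Sum>j<n. r 0 j)"
    using n0 t_icomb[OF n0, of "K.icoord 1"] by (simp add: w_def K.icomb_icoord K.O_closed K.s_simps r)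
  have trace_w: "L.tri (w * w) = int n"
  proof -
    have "L.tri (w * w) = K.lat.form (K.icoord 1) (K.icoord 1)"
      by (simp only: w_def L.tri_icomb_icomb gram_int_eq)
    also have "\<dots> = K.tri (1 * 1)"
      by (simp only: K.tri_icomb_icomb[symmetric] K.icomb_icoord[OF K.O_closed(2)])
    also have "\<dots> = int n" by (simp add: K.tri_def K.tr_one)
    finally show ?thesis .
  qed
  have trace_scalar: "w * w \<noteq> of_int m" if "m \<noteq> 1" for m
  proof
    assume "w * w = of_int m"
    then have "L.tri (w * w) = m * int n"
      using L.tri_scale[OF L.O_closed(2), of m] by (simp add: L.tri_def L.tr_one)
    then show False using trace_w that n0 by simp
  qed
  have no_double: False if S: "(\<Sum>j<n. r 0 j)\<^sup>2 = 0 \<or> (\<Sum>j<n. r 0 j)\<^sup>2 = 2"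
  proof -
    have ww: "t 0 (w * w) = of_real ((\<Sum>j<n. r 0 j)\<^sup>2)"
      using w n0 by (simp add: L.s_simps t0w power2_eq_square)
    obtain m :: int where m: "m \<noteq> 1" "(\<Sum>j<n. r 0 j)\<^sup>2 = of_int m"
      using S by (metis of_int_0 of_int_numeral one_neq_zero zero_neq_one numeral_eq_one_iff num.distinct(1))
    have "t 0 (w * w) = t 0 (of_int m)" unfolding ww m(2) using n0 by (simp add: L.s_simps)
    then have "w * w = of_int m" using w by (intro t0_inj) (auto intro: L.K_closed)
    then show False using trace_scalar m(1) by blast
  qed
  show ?thesis
  proof (rule unit_row_cases[OF row[OF n0] vals[OF n0]])
    fix j assume j: "j < n" "(r 0 j)\<^sup>2 = 1" "\<And>k. k < n \<Longrightarrow> k \<noteq> j \<Longrightarrow> r 0 k = 0"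
    obtain e :: int where e: "e = 1 \<or> e = -1" "r 0 j = of_int e"
      using j(2) by (metis of_int_1 of_int_minus power2_eq_1_iff)
    show ?thesis
    proof (rule isomorphic_if_signed_embedding[OF j(1) e(1)])
      fix l assume l: "l < n"
      define c where "c = (\<lambda>i. if i = l then 1 else 0 :: int)"
      have "K.icomb c = a l" "L.icomb c = y l"
        using l by (simp_all add: K.icomb_def L.icomb_def c_def if_distrib[of of_int] if_distrib[of "\<lambda>x. x * _"] cong: if_cong)
      then have "t 0 (y l) = (\<Sum>k<n. U $$ (0,k) * s k (a l))" using t_icomb[OF n0, of c] by simp
      also have "\<dots> = (\<Sum>k<n. if k = j then of_int e * s j (a l) else 0)"
        using n0 j(3) e(2) by (intro sum.cong refl) (auto simp: r)
      finally show "t 0 (y l) = of_int e * s j (a l)" using j(1) by simp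
    qed
  qed (use no_double in blast)+
qed

end


section \<open>Fundamental discriminants\<close>

text \<open>That \<open>L\<close> has degree \<open>n\<close> comes out here: a rational relation
  among the images of the basis is cleared of denominators and pulled back along the bijection, and
  every element of \<open>L\<close> has an integral multiple.\<close>

lemma isometric_pair_of_isometry:
  fixes K :: "'a::field_char_0 set" and L :: "'b::field_char_0 set"
  assumes Kf: "integral_field K n a s" and L: "number_field L" and iso: "trace_lattices_isometric K L"
  obtains y t where "isometric_pair K n a s L y t"
proof -
  interpret K: integral_field K n a s by fact
  obtain m b where "based_field L m b" using number_field_based[OF L] by blast
  then interpret Lb: based_field L m b .
  obtain \<phi> where bij: "bij_betw \<phi> (ring_of_integers K) (ring_of_integers L)"
    and add: "\<And>u v. u \<in> K.OK \<Longrightarrow> v \<in> K.OK \<Longrightarrow> \<phi> (u + v) = \<phi> u + \<phi> v"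
    and scale: "\<And>k u. u \<in> K.OK \<Longrightarrow> \<phi> (of_int k * u) = of_int k * \<phi> u"
    and tr: "\<And>u v. u \<in> K.OK \<Longrightarrow> v \<in> K.OK \<Longrightarrow> field_trace L (\<phi> u * \<phi> v) = field_trace K (u * v)"
    using iso unfolding trace_lattices_isometric_def int_scale_def by blast
  have \<phi>_in: "\<phi> u \<in> ring_of_integers L" if "u \<in> K.OK" for u using bij that by (auto simp: bij_betw_def)
  have zero: "\<phi> 0 = 0" using scale[OF K.O_closed(1), of 0] by simp
  define y where "y i = \<phi> (a i)" for i
  have sum: "\<phi> (\<Sum>i\<in>I. of_int (c i) * a i) = (\<Sum>i\<in>I. of_int (c i) * y i)" if "I \<subseteq> {..<n}" for c I
    using finite_subset[OF that finite_lessThan] that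
  proof (induction I rule: finite_induct)
    case (insert i I)
    have "(\<Sum>i\<in>I. of_int (c i) * a i) \<in> K.OK" using insert.prems by (intro K.O_sum K.O_closed) auto
    then show ?case using insert by (simp add: add scale K.O_closed y_def)
  qed (simp add: zero)
  have \<phi>_icomb: "\<phi> (K.icomb c) = (\<Sum>i<n. of_int (c i) * y i)" for c
    unfolding K.icomb_def by (rule sum) simp
  have int_span: "\<exists>c. z = (\<Sum>i<n. of_int (c i) * y i)" if z: "z \<in> ring_of_integers L" for z
  proof -
    obtain u where u: "u \<in> K.OK" "z = \<phi> u" using bij z by (auto simp: bij_betw_def)
    then have "z = \<phi> (K.icomb (K.icoord u))" by (simp add: K.icomb_icoord)
    then show ?thesis unfolding \<phi>_icomb by blast
  qed
  have bf: "based_field L n y"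
  proof
    show "subfield_set L" by (rule Lb.K)
    show "y i \<in> L" if "i < n" for i
      using \<phi>_in[OF K.O_closed(9)[OF that]] by (simp add: y_def ring_of_integers_def)
    show "\<exists>q::nat \<Rightarrow> rat. x = (\<Sum>i<n. of_rat (q i) * y i)" if x: "x \<in> L" for x
    proof -
      obtain D :: int where D: "D > 0" "algebraic_int (of_int D * x)"
        using Lb.algebraic[OF x] rat_monic_root_multiple_integral by metis
      then have "of_int D * x \<in> ring_of_integers L" using x by (simp add: ring_of_integers_def Lb.K_closed)
      then obtain c where c: "of_int D * x = (\<Sum>i<n. of_int (c i) * y i)" using int_span by blast
      have "x = inverse (of_int D) * (of_int D * x)" using D(1) by simp
      also have "\<dots> = (\<Sum>i<n. of_rat (of_int (c i) / of_int D) * y i)"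
        unfolding c by (simp add: sum_distrib_left of_rat_divide field_simps)
      finally show ?thesis by (intro exI[of _ "\<lambda>i. of_int (c i) / of_int D"])
    qed
    fix q :: "nat \<Rightarrow> rat" and i assume q: "(\<Sum>i<n. of_rat (q i) * y i) = 0" and i: "i < n"
    obtain D :: int where D: "D > 0" "\<And>i. i < n \<Longrightarrow> of_int D * q i \<in> \<int>"
      using common_denominator[of n q] by blast
    have "\<exists>z::int. of_int D * q i = of_int z" if "i < n" for i
      using D(2)[OF that] by (auto elim: Ints_cases)
    then obtain c :: "nat \<Rightarrow> int" where c: "\<And>i. i < n \<Longrightarrow> of_int D * q i = of_int (c i)" by metis
    have "\<phi> (K.icomb c) = (\<Sum>i<n. of_int D * (of_rat (q i) * y i))"
      unfolding \<phi>_icomb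
    proof (intro sum.cong refl)
      fix i assume "i \<in> {..<n}"
      then have "of_rat (of_int D * q i) = (of_int (c i) :: 'b)" using c by simp
      then show "of_int (c i) * y i = of_int D * (of_rat (q i) * y i)" by (simp add: of_rat_mult)
    qed
    also have "\<dots> = \<phi> 0" using q by (simp add: sum_distrib_left[symmetric] zero)
    finally have "K.icomb c = 0"
      using bij K.icomb_in K.O_closed(1) by (auto simp: bij_betw_def inj_on_def)
    then have "c i = 0" using K.coord_icomb[OF i, of c] K.coord_scale[OF K.K_closed(1) i, of 0] by simp
    then show "q i = 0" using c[OF i] D(1) by simp
  qed
  then obtain t where t: "embedded_field L n y t" using embedded_field_exists by blast
  interpret e: embedded_field L n y t by fact
  have "isometric_pair K n a s L y t"
  proof
    show "algebraic_int (y i)" if "i < n" for i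
      using \<phi>_in[OF K.O_closed(9)[OF that]] by (simp add: y_def ring_of_integers_def)
    show "e.coord x i \<in> \<int>" if x: "x \<in> L" "algebraic_int x" and i: "i < n" for x i
    proof -
      obtain c where c: "x = (\<Sum>i<n. of_int (c i) * y i)" using int_span[of x] x by (auto simp: ring_of_integers_def)
      have "e.coord x i = of_int (c i)" by (rule e.coord_eq) (use c i in simp_all)
      then show ?thesis by simp
    qed
    show "field_trace L (y i * y j) = field_trace K (a i * a j)" if "i < n" "j < n" for i j
      using that by (simp add: y_def tr K.O_closed)
  qed
  then show ?thesis using that by blast
qed

text \<open>The image of a basis of \<open>K\<close> is a basis of \<open>L\<close> in which
  multiplication by \<open>\<phi> x\<close> has the matrix of multiplication by \<open>x\<close>, so
  traces are preserved.\<close>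

lemma isometric_if_isomorphic:
  fixes K :: "'a::field_char_0 set" and L :: "'b::field_char_0 set"
  assumes K: "number_field K" and L: "number_field L" and iso: "field_isomorphic K L"
  shows "trace_lattices_isometric K L"
proof -
  obtain n b where "based_field K n b" using number_field_based[OF K] by blast
  then interpret K: based_field K n b .
  obtain \<phi> where \<phi>: "field_hom_on K \<phi>" and bij: "bij_betw \<phi> K L"
    using iso unfolding field_isomorphic_def by blast
  note \<phi>_simps = field_hom_on_simps[OF K.K \<phi>]
  have \<phi>_in: "\<phi> x \<in> L" if "x \<in> K" for x using bij that by (auto simp: bij_betw_def)
  have comb: "\<phi> (\<Sum>i<n. of_rat (q i) * b i) = (\<Sum>i<n. of_rat (q i) * \<phi> (b i))" for q
    by (subst field_hom_on_sum[OF K.K \<phi>]) (auto simp: \<phi>_simps K.K_closed K.b_in)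
  have bf: "based_field L n (\<lambda>i. \<phi> (b i))"
  proof
    show "subfield_set L" using L by (simp add: number_field_def)
    show "\<phi> (b i) \<in> L" if "i < n" for i using that by (intro \<phi>_in K.b_in)
    show "\<exists>q::nat \<Rightarrow> rat. z = (\<Sum>i<n. of_rat (q i) * \<phi> (b i))" if z: "z \<in> L" for z
    proof -
      obtain x where x: "x \<in> K" "z = \<phi> x" using bij z by (auto simp: bij_betw_def)
      have "z = \<phi> (\<Sum>i<n. of_rat (K.coord x i) * b i)" using K.coord[OF x(1)] x(2) by simp
      then show ?thesis unfolding comb by (intro exI[of _ "K.coord x"])
    qed
    fix q :: "nat \<Rightarrow> rat" and i assume q: "(\<Sum>i<n. of_rat (q i) * \<phi> (b i)) = 0" and i: "i < n"
    then have "\<phi> (\<Sum>i<n. of_rat (q i) * b i) = 0" by (simp add: comb)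
    then have "(\<Sum>i<n. of_rat (q i) * b i) = 0" using \<phi>_simps(11)[OF K.comb_in] by blast
    then show "q i = 0" using K.b_indep i by blast
  qed
  interpret L: based_field L n "\<lambda>i. \<phi> (b i)" by fact
  have coord: "L.coord (\<phi> x) i = K.coord x i" if "x \<in> K" "i < n" for x i
    by (rule L.coord_eq) (use K.coord[OF that(1)] comb[of "K.coord x"] that in simp_all)
  have tr: "field_trace L (\<phi> x) = field_trace K x" if x: "x \<in> K" for x
  proof -
    have "L.coord_trace (\<phi> x) = K.coord_trace x"
      unfolding L.coord_trace_def K.coord_trace_def
    proof (intro sum.cong refl)
      fix i assume "i \<in> {..<n}"
      then have i: "i < n" by simp
      show "L.coord (\<phi> x * \<phi> (b i)) i = K.coord (x * b i) i"
        using coord[OF K.K_closed(5)[OF x K.b_in[OF i]] i] \<phi>_simps(4)[OF x K.b_in[OF i]] by simp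
    qed
    then show ?thesis
      using field_trace_eq_coord_trace[OF bf \<phi>_in[OF x]] field_trace_eq_coord_trace[OF K.based_field_axioms x] by simp
  qed
  have OK: "\<phi> x \<in> ring_of_integers L \<longleftrightarrow> x \<in> ring_of_integers K" if "x \<in> K" for x
    using that \<phi>_in field_hom_on_algebraic_int[OF K.K \<phi> that] by (simp add: ring_of_integers_def)
  have mult: "\<phi> x * \<phi> y = \<phi> (x * y)" if "x \<in> K" "y \<in> K" for x y
    using \<phi>_simps(4)[OF that] by simp
  have sc: "\<phi> (of_int k * x) = of_int k * \<phi> x" if "x \<in> K" for k x
    using \<phi>_simps(4)[OF subfield_set_of_int(2)[OF K.K] that] by (simp add: \<phi>_simps(9))
  have sub: "ring_of_integers K \<subseteq> K" by (auto simp: ring_of_integers_def)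
  have "bij_betw \<phi> (ring_of_integers K) (ring_of_integers L)"
    unfolding bij_betw_def
  proof
    show "inj_on \<phi> (ring_of_integers K)" using bij sub by (auto simp: bij_betw_def intro: inj_on_subset)
    show "\<phi> ` ring_of_integers K = ring_of_integers L"
    proof
      show "\<phi> ` ring_of_integers K \<subseteq> ring_of_integers L" using OK sub by auto
      show "ring_of_integers L \<subseteq> \<phi> ` ring_of_integers K"
      proof
        fix z assume z: "z \<in> ring_of_integers L"
        then have "z \<in> L" by (simp add: ring_of_integers_def)
        then obtain x where "x \<in> K" "z = \<phi> x" using bij by (auto simp: bij_betw_def)
        then show "z \<in> \<phi> ` ring_of_integers K" using OK z by auto
      qed
    qed
  qed
  then show ?thesis
    unfolding trace_lattices_isometric_def
    using sub mult sc by (intro exI[of _ \<phi>]) (auto simp: int_scale_def \<phi>_simps(3) K.K_closed tr subset_iff)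
qed

lemma det_2x2:
  fixes f :: "nat \<times> nat \<Rightarrow> 'a::comm_ring_1"
  shows "det (mat 2 2 f) = f (0,0) * f (1,1) - f (0,1) * f (1,0)"
proof -
  have M: "mat 2 2 f \<in> carrier_mat 2 2" by simp
  have "mat_delete (mat 2 2 f) 0 0 = mat 1 1 (\<lambda>_. f (1,1))" "mat_delete (mat 2 2 f) 0 1 = mat 1 1 (\<lambda>_. f (1,0))"
    by (auto simp: mat_delete_def)
  then show ?thesis
    by (subst laplace_expansion_row[OF M, of 0]) (simp_all add: numeral_2_eq_2 cofactor_def det_single)
qed

text \<open>For an integral basis \<open>\<alpha>, \<beta>\<close> the element \<open>y = \<alpha> Tr \<beta> - \<beta> Tr \<alpha>\<close> has \<open>y\<^sup>2 = d\<close>; if \<open>m\<^sup>2\<close> divides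
  \<open>d\<close> then \<open>\<int>[y/m]\<close> is an order of discriminant \<open>4d/m\<^sup>2\<close>.\<close>
lemma square_dvd_quadratic_disc:
  fixes F :: "'a::field_char_0 set"
  assumes F: "number_field F" and deg: "field_degree F = 2" and disc: "field_disc F = of_int d"
    and m: "m\<^sup>2 dvd d" "m \<noteq> 0"
  shows "m dvd 2"
proof -
  obtain n a s where "integral_field F n a s" and disc': "field_disc F = det (mat n n (\<lambda>(i,j). field_trace F (a i * a j)))"
    and "field_degree F = n"
    using number_field_integral_field[OF F] by blast
  then have "integral_field F 2 a s" and n: "n = 2" using deg by auto
  then interpret F: integral_field F 2 a s by simp
  have d_gram: "det (F.gram a) = of_int d" using disc disc' by (simp add: F.gram_def n)
  then have d0: "d \<noteq> 0" using F.det_gram_basis by auto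
  define \<alpha> \<beta> where "\<alpha> = a 0" and "\<beta> = a 1"
  have \<alpha>\<beta>: "\<alpha> \<in> F.OK" "\<beta> \<in> F.OK" using F.O_closed(9)[of 0] F.O_closed(9)[of 1] by (simp_all add: \<alpha>_def \<beta>_def)
  note inF = F.O_in_K
  have trC: "(of_int (F.tri x) :: complex) = s 0 x + s 1 x" if "x \<in> F.OK" for x
  proof -
    have "(of_int (F.tri x) :: complex) = of_rat (of_int (F.tri x))" by simp
    also have "\<dots> = (\<Sum>i<2. s i x)" using F.s_trace[OF inF[OF that]] by (simp only: F.tri[OF that])
    finally show ?thesis by (simp add: numeral_2_eq_2)
  qed
  have d_tri: "d = F.tri (\<alpha> * \<alpha>) * F.tri (\<beta> * \<beta>) - F.tri (\<alpha> * \<beta>) * F.tri (\<alpha> * \<beta>)"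
  proof -
    have "of_int d = (of_int (det F.gram_int) :: rat)" using d_gram F.det_gram_int by simp
    then have "d = det F.gram_int" by (simp only: of_int_eq_iff)
    then show ?thesis by (simp add: F.gram_int_def det_2x2 \<alpha>_def \<beta>_def mult.commute)
  qed
  define y where "y = of_int (F.tri \<beta>) * \<alpha> - of_int (F.tri \<alpha>) * \<beta>"
  have y: "y \<in> F.OK" unfolding y_def by (intro F.O_closed \<alpha>\<beta>)
  note hom0 = F.s_simps[of 0, simplified] and hom1 = F.s_simps[of 1, simplified]
  \<comment> \<open>The conjugates of \<open>y\<close> are the determinant of the matrix of
    conjugates of the basis and its negative, so both have square \<open>d\<close>.\<close>
  have sy: "s 0 y = s 0 \<alpha> * s 1 \<beta> - s 1 \<alpha> * s 0 \<beta>" "s 1 y = s 1 \<alpha> * s 0 \<beta> - s 0 \<alpha> * s 1 \<beta>"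
    using \<alpha>\<beta> inF unfolding y_def by (simp_all add: hom0 hom1 F.K_closed trC algebra_simps)
  have yy: "y * y = of_int d"
  proof -
    have "s 0 (y * y - of_int d) = 0"
    proof -
      have "s 0 (y * y - of_int d) = s 0 y * s 0 y - of_int d" using y inF by (simp add: hom0 F.K_closed)
      also have "(of_int d :: complex) = of_int (F.tri (\<alpha> * \<alpha>)) * of_int (F.tri (\<beta> * \<beta>)) - of_int (F.tri (\<alpha> * \<beta>)) * of_int (F.tri (\<alpha> * \<beta>))"
        by (subst d_tri) simp
      also have "\<dots> = (s 0 \<alpha> * s 0 \<alpha> + s 1 \<alpha> * s 1 \<alpha>) * (s 0 \<beta> * s 0 \<beta> + s 1 \<beta> * s 1 \<beta>)
          - (s 0 \<alpha> * s 0 \<beta> + s 1 \<alpha> * s 1 \<beta>) * (s 0 \<alpha> * s 0 \<beta> + s 1 \<alpha> * s 1 \<beta>)"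
        using \<alpha>\<beta> inF by (simp add: trC F.O_closed hom0 hom1)
      finally show ?thesis unfolding sy by (simp add: algebra_simps)
    qed
    moreover have "y * y - of_int d \<in> F" using y inF by (intro F.K_closed) auto
    ultimately show ?thesis using hom0(11) by simp
  qed
  have tri_y: "F.tri y = 0"
  proof -
    have "(of_int (F.tri y) :: complex) = 0" unfolding trC[OF y] sy by simp
    then show ?thesis by simp
  qed
  obtain k where k: "d = m\<^sup>2 * k" using m(1) by (rule dvdE)
  define z where "z = y / of_int m"
  have zz: "z * z = of_int k"
    using yy m(2) by (simp add: z_def k power2_eq_square)
  have "z\<^sup>2 = of_int 0 * z + of_int k" using zz by (simp add: power2_eq_square)
  then have "algebraic_int z" by (rule algebraic_int_quadratic) (rule int_imp_algebraic_int, simp)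
  moreover have "z \<in> F" unfolding z_def using y inF by (intro F.K_closed) auto
  ultimately have z: "z \<in> F.OK" by (simp add: F.O_iff)
  have tri_z: "F.tri z = 0"
  proof -
    have "m * F.tri z = F.tri (of_int m * z)" using z by (simp add: F.tri_scale)
    also have "of_int m * z = y" using m(2) by (simp add: z_def)
    finally show ?thesis using tri_y m(2) by simp
  qed
  \<comment> \<open>The family 1, \<open>z\<close> has Gram determinant \<open>4 * k\<close>;
    expressed in the integral basis, it also has
    \<open>(det C)\<^sup>2 * m\<^sup>2 * k\<close>.\<close>
  define e where "e = (\<lambda>i::nat. if i = 0 then 1 else z)"
  have e: "e i \<in> F.OK" for i using z F.O_closed(2) by (simp add: e_def)
  define C where "C = mat 2 2 (\<lambda>(i,j). F.icoord (e j) i)"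
  have C: "map_mat (of_int :: int \<Rightarrow> rat) C \<in> carrier_mat 2 2" by (simp add: C_def)
  have "det (F.gram e) = (det (map_mat of_int C))\<^sup>2 * det (F.gram a)"
  proof (rule F.gram_change(2)[OF C F.b_in])
    fix j :: nat assume "j < 2"
    then show "e j = (\<Sum>i<2. of_rat (map_mat of_int C $$ (i,j)) * a i)"
      using F.icomb_icoord[OF e[of j]] by (simp add: C_def F.icomb_def)
  qed
  also have "\<dots> = (of_int (det C))\<^sup>2 * of_int d" by (simp add: d_gram of_int_hom.hom_det)
  also have "det (F.gram e) = of_int (4 * k)"
  proof -
    have "field_trace F (of_int k) = of_int (2 * k)"
      using F.tr_scale_int[OF F.K_closed(2), of k] by (simp add: F.tr_one)
    moreover have "field_trace F z = 0" using F.tri[OF z] tri_z by simp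
    ultimately show ?thesis by (simp add: F.gram_def det_2x2 e_def zz F.tr_one)
  qed
  finally have "(of_int (4 * k) :: rat) = of_int ((det C)\<^sup>2 * d)" by simp
  then have "4 * k = (det C)\<^sup>2 * (m\<^sup>2 * k)" unfolding k by (simp only: of_int_eq_iff)
  moreover have "k \<noteq> 0" using d0 k by auto
  ultimately have "2\<^sup>2 = (m * det C)\<^sup>2" by (simp add: power_mult_distrib mult_ac)
  then have "m * det C = 2 \<or> m * det C = - 2" using power2_eq_iff[of 2 "m * det C"] by auto
  then show ?thesis by (metis dvd_minus_iff dvd_triv_left)
qed

text \<open>For an odd prime the quadratic case would give \<open>p dvd 2\<close>, and for
  \<open>16 = 4\<^sup>2\<close> it would give \<open>4 dvd 2\<close>. If \<open>d = 1\<close>, only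
  units have a square dividing it.\<close>

lemma fundamental_discriminant_square_factors:
  assumes "fundamental_discriminant d"
  shows "prime p \<Longrightarrow> odd p \<Longrightarrow> \<not> p\<^sup>2 dvd d" and "\<not> 16 dvd d"
proof -
  have dvd2: "m dvd 2" if "m\<^sup>2 dvd d" "m \<noteq> 0" for m
    using assms that square_dvd_quadratic_disc[of _ d m]
    by (auto simp: fundamental_discriminant_def dest: is_unit_power_iff[THEN iffD1])
  show "\<not> p\<^sup>2 dvd d" if "prime p" "odd p"
  proof
    assume "p\<^sup>2 dvd d"
    then have "p dvd 2" using dvd2 that(1) by auto
    then have "p = 2" using primes_dvd_imp_eq[OF that(1), of 2] by simp
    then show False using that(2) by simp
  qed
  show "\<not> 16 dvd d"
  proof
    assume "16 dvd d"
    then have "4 dvd (2::int)" using dvd2[of 4] by simp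
    then show False by simp
  qed
qed

theorem theorem5p3:
  fixes K :: "'a::field_char_0 set" and L :: "'b::field_char_0 set"
    and n :: nat and d :: int
  assumes "number_field K" and "number_field L"
    and "totally_real K" and "field_degree K = n"
    and "field_disc K = of_int d" and "fundamental_discriminant d"
  shows "trace_lattices_isometric K L \<longleftrightarrow> field_isomorphic K L"
proof
  assume iso: "trace_lattices_isometric K L"
  obtain m a s where K: "integral_field K m a s"
    and disc: "field_disc K = det (mat m m (\<lambda>(i,j). field_trace K (a i * a j)))"
    using number_field_integral_field[OF assms(1)] by blast
  obtain y t where "isometric_pair K m a s L y t"
    using isometric_pair_of_isometry[OF K assms(2) iso] by blast
  then interpret isometric_pair K m a s L y t .
  have "(of_int d :: rat) = of_int disc"
    using assms(5) K.det_gram_int unfolding disc K.gram_def disc_def by simp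
  then have d: "d = disc" by (simp only: of_int_eq_iff)
  have real: "s i x \<in> \<real>" if "i < m" "x \<in> K" for i x
    using assms(3) K.s_hom[OF that(1)] that(2) unfolding totally_real_def by blast
  show "field_isomorphic K L"
    using isomorphic[OF real] fundamental_discriminant_square_factors[OF assms(6)] unfolding d by blast
next
  assume "field_isomorphic K L"
  then show "trace_lattices_isometric K L" by (rule isometric_if_isomorphic[OF assms(1,2)])
qed

end
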